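(* Let $\mathbf w=w_0w_1w_2\cdots$ be an automatic (resp. morphic) infinite word over $\Sigma_b=\{0,1,\ldots,b-1\}$ ($b\ge2$), and let $x\in\Sigma_b^+$ be a nonempty finite word. Assume $\mathbf w$ has no suffix of the form $x^\omega$ and contains infinitely many maximal $x$-blocks. For $k\ge0$ let $(i_k,j_k)$ be the starting and ending positions of the $k$-th maximal $x$-block in $\mathbf w$. Then $\limsup_{k\to\infty} j_k/i_k$ is finite and rational (resp. algebraic).
   Context: Positions are indexed from $0$. A factor $y=w_i\cdots w_j$ of $\mathbf w$ is an $x$-block if there exist a proper (possibly empty) suffix $x'$ of $x$ and a proper (possibly empty) prefix $x''$ of $x$ such that $y=x'x^nx''$ for some integer $n\ge1$. Such an $x$-block is maximal if $x''w_{j+1}$ is not a prefix of $x$, and either $i=0$ or $w_{i-1}x'$ is not a suffix of $x$. Maximal $x$-blocks are enumerated in increasing order of starting position. Morphic/automatic words: Let $\Sigma$ be a finite alphabet. A morphism $h:\Sigma^*\to\Sigma^*$ is prolongable on $a\in\Sigma$ if $h(a)=ax$ with $x\in\Sigma^+$ and $h^n(x)$ nonempty for all $n\ge0$; then $h^n(a)$ converges to the infinite word $h^\omega(a)=a\,x\,h(x)\,h^2(x)\cdots$, called a pure morphic word. A coding is a letter-to-letter morphism. An infinite word is morphic if it is the image under a coding of a pure morphic word, and automatic if it is the image under a coding of a pure morphic word $h^\omega(a)$ with $h$ uniform (all $|h(c)|$ equal). *)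

theory Defs
  imports "HOL-Analysis.Analysis" "HOL-Computational_Algebra.Polynomial"
begin

text \<open>Infinite words are functions nat => nat; finite words are nat lists.
  Letters of an abstract alphabet are natural numbers from a finite set A.\<close>

definition hext :: "(nat \<Rightarrow> nat list) \<Rightarrow> nat list \<Rightarrow> nat list" where
  "hext h u = concat (map h u)"

definition prolongable :: "nat set \<Rightarrow> (nat \<Rightarrow> nat list) \<Rightarrow> nat \<Rightarrow> bool" where
  "prolongable A h a \<longleftrightarrow> finite A \<and> a \<in> A \<and> (\<forall>c\<in>A. set (h c) \<subseteq> A) \<and>
     (\<exists>y. h a = a # y \<and> y \<noteq> [] \<and> (\<forall>n. (hext h ^^ n) y \<noteq> []))"

definition pure_morphic_word :: "nat set \<Rightarrow> (nat \<Rightarrow> nat list) \<Rightarrow> nat \<Rightarrow> (nat \<Rightarrow> nat) \<Rightarrow> bool" where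
  "pure_morphic_word A h a W \<longleftrightarrow> prolongable A h a \<and>
     (\<forall>n i. i < length ((hext h ^^ n) [a]) \<longrightarrow> W i = ((hext h ^^ n) [a]) ! i)"

definition morphic :: "(nat \<Rightarrow> nat) \<Rightarrow> bool" where
  "morphic w \<longleftrightarrow> (\<exists>A h a W \<tau>. pure_morphic_word A h a W \<and> w = \<tau> \<circ> W)"

definition automatic :: "(nat \<Rightarrow> nat) \<Rightarrow> bool" where
  "automatic w \<longleftrightarrow> (\<exists>A h a W \<tau> m. pure_morphic_word A h a W \<and> (\<forall>c\<in>A. length (h c) = m)
                       \<and> w = \<tau> \<circ> W)"

definition factor :: "(nat \<Rightarrow> nat) \<Rightarrow> nat \<Rightarrow> nat \<Rightarrow> nat list" where
  "factor w i j = map w [i..<Suc j]"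

definition proper_suffix_of :: "nat list \<Rightarrow> nat list \<Rightarrow> bool" where
  "proper_suffix_of u x \<longleftrightarrow> (\<exists>v. v \<noteq> [] \<and> x = v @ u)"

definition proper_prefix_of :: "nat list \<Rightarrow> nat list \<Rightarrow> bool" where
  "proper_prefix_of u x \<longleftrightarrow> (\<exists>v. v \<noteq> [] \<and> x = u @ v)"

definition is_prefix_of :: "nat list \<Rightarrow> nat list \<Rightarrow> bool" where
  "is_prefix_of u x \<longleftrightarrow> (\<exists>v. x = u @ v)"

definition is_suffix_of :: "nat list \<Rightarrow> nat list \<Rightarrow> bool" where
  "is_suffix_of u x \<longleftrightarrow> (\<exists>v. x = v @ u)"

definition max_block :: "nat list \<Rightarrow> (nat \<Rightarrow> nat) \<Rightarrow> nat \<Rightarrow> nat \<Rightarrow> bool" where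
  "max_block x w i j \<longleftrightarrow> i \<le> j \<and>
     (\<exists>x' x'' n. proper_suffix_of x' x \<and> proper_prefix_of x'' x \<and> n \<ge> 1 \<and>
        factor w i j = x' @ concat (replicate n x) @ x'' \<and>
        \<not> is_prefix_of (x'' @ [w (Suc j)]) x \<and>
        (i = 0 \<or> \<not> is_suffix_of (w (i - 1) # x') x))"

definition max_blocks :: "nat list \<Rightarrow> (nat \<Rightarrow> nat) \<Rightarrow> (nat \<times> nat) set" where
  "max_blocks x w = {(i, j). max_block x w i j}"

end

theory Submission
  imports Defs "HOL-Computational_Algebra.Polynomial_FPS" "HOL-Computational_Algebra.Polynomial_Factorial"
    "HOL-Computational_Algebra.Field_as_Ring" "HOL-Real_Asymp.Real_Asymp"
begin

text \<open>
  Write \<open>w = \<tau> \<circ> W\<close> with \<open>W\<close> fixed by \<open>h\<close>. A block of \<open>x\<close> is a run between two consecutive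
  mismatches of \<open>w\<close> with a fixed rotation of the periodic word generated by \<open>x\<close>. Whether the \<open>n\<close>-fold
  image of a letter is readable along \<open>x\<close> from a given phase is a deterministic function of a finite
  amount of data, so after replacing \<open>h\<close> by a power \<open>g\<close> it does not depend on \<open>n\<close>. Each run is then
  born inside the image of one letter of \<open>W\<close> at a unique level \<open>n\<close>, and up to translation it is
  determined by \<open>n\<close> and one of finitely many types. Runs of a given type and level have the same length,
  so only the first occurrence of each letter matters for the limit superior.

  For a fixed type, both ends of the run are nonnegative integer linear combinations of a vector
  evolving by a fixed nonnegative integer matrix \<open>M\<close>. A power of \<open>M\<close> has transitive support, so
  every vertex on a cycle carries a loop; eliminating the states one by one and using the renewal theorem for
  each loop, all coordinates grow like \<open>C * t ^ k * r ^ t\<close> along arithmetic progressions, hence the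
  quotients of the two ends converge. By Abel summation the limit is the value at the common
  radius of convergence of a rational function over the rationals. The radius is algebraic, being a
  pole of a rational generating function, and it is rational if all images have the same length.
\<close>

unbundle no vec_syntax
unbundle fps_syntax

section \<open>Rational generating functions and algebraic limits\<close>

text \<open>Working with sums, products and stars of nonnegative series only, leading terms can
  never cancel, so every elimination step keeps an explicit growth rate; this takes the place of a
  spectral analysis of \<open>M\<close>. The star is the delicate operation: its coefficients solve
  a renewal equation, and a periodic one would oscillate. Loops exclude this, at the price of
  passing to a power of \<open>M\<close>, and so limits are obtained only along residue classes of
  the level.

  Growth alone makes the quotient of the two ends converge but says nothing about the arithmetic of
  the growth constants, which are just real numbers. Rationality over \<open>rat\<close> is
  therefore part of the same invariant.

  Both ends of a run must grow at comparable rates. This is where the absence of a suffix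
  \<open>x x x ...\<close> enters: it bounds the right end linearly by the left end, which also
  makes the limit superior finite.

  Runs between mismatches and maximal blocks correspond only when they are long. This is harmless:
  late blocks of bounded length have ratio close to 1, and no ratio with a positive start is below
  1.\<close>

definition rpoly :: "rat poly \<Rightarrow> real poly" where
  "rpoly p = map_poly of_rat p"

lemma coeff_rpoly [simp]: "coeff (rpoly p) i = of_rat (coeff p i)"
  by (simp add: rpoly_def coeff_map_poly)

lemma rpoly_0 [simp]: "rpoly 0 = 0"
  by (simp add: rpoly_def)

lemma rpoly_1 [simp]: "rpoly 1 = 1"
  by (simp add: rpoly_def)

lemma rpoly_add: "rpoly (p + q) = rpoly p + rpoly q"
  by (rule poly_eqI) (simp add: of_rat_add)

lemma rpoly_diff: "rpoly (p - q) = rpoly p - rpoly q"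
  by (rule poly_eqI) (simp add: of_rat_diff)

lemma rpoly_mult: "rpoly (p * q) = rpoly p * rpoly q"
  by (rule poly_eqI) (simp add: coeff_mult of_rat_sum of_rat_mult)

lemma rpoly_power: "rpoly (p ^ n) = rpoly p ^ n"
  by (induction n) (simp_all add: rpoly_mult)

lemma rpoly_eq_0_iff [simp]: "rpoly p = 0 \<longleftrightarrow> p = 0"
proof
  assume *: "rpoly p = 0"
  show "p = 0"
  proof (rule poly_eqI)
    fix i
    have "coeff (rpoly p) i = 0" using * by simp
    then show "coeff p i = coeff 0 i" by simp
  qed
qed simp

lemma degree_rpoly [simp]: "degree (rpoly p) = degree p"
  unfolding rpoly_def by (rule degree_map_poly) simp

lemma poly_rpoly_of_rat: "poly (rpoly p) (of_rat x) = of_rat (poly p x)"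
  by (simp add: poly_altdef of_rat_sum of_rat_mult of_rat_power)

text \<open>Keeping coefficients in the type \<open>rat\<close> makes gcds, Bezout coefficients and
  linear dependencies rational by typing alone; only evaluation takes place in the reals.\<close>

lemma algebraic_rpoly_iff: "algebraic (x::real) \<longleftrightarrow> (\<exists>q. q \<noteq> 0 \<and> poly (rpoly q) x = 0)"
proof
  assume "algebraic x"
  then obtain p where p: "\<forall>i. coeff p i \<in> \<rat>" "p \<noteq> 0" "poly p x = 0"
    by (auto simp: algebraic_altdef)
  define q where "q = map_poly (\<lambda>c. inv of_rat c :: rat) p"
  have inj: "inj (of_rat :: rat \<Rightarrow> real)" by (auto simp: inj_def)
  \<comment> \<open>\<open>coeff_map_poly\<close> requires a map that fixes 0.\<close>
  have inv0: "inv of_rat (0::real) = (0::rat)"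
    using inv_f_f[OF inj, of 0] by simp
  have "rpoly q = p"
  proof (rule poly_eqI)
    fix i
    obtain r where "coeff p i = of_rat r" using p(1) by (meson Rats_cases)
    then show "coeff (rpoly q) i = coeff p i"
      by (simp add: q_def coeff_map_poly inv0 inv_f_f[OF inj])
  qed
  then show "\<exists>q. q \<noteq> 0 \<and> poly (rpoly q) x = 0" using p by (metis rpoly_0)
next
  assume "\<exists>q. q \<noteq> 0 \<and> poly (rpoly q) x = 0"
  then obtain q where "q \<noteq> 0" "poly (rpoly q) x = 0" by blast
  then show "algebraic x" by (intro algebraicI'[of "rpoly q"]) auto
qed

section \<open>Rational functions at algebraic points\<close>

lemma rat_vector_space: "vector_space (\<lambda>(q::rat) (r::real). of_rat q * r)"
  by unfold_locales (simp_all add: algebra_simps of_rat_add of_rat_mult)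

text \<open>Reduction modulo \<open>q\<close> does not change the value at the root \<open>x\<close>
  and leaves a degree below \<open>degree q\<close>.\<close>

lemma poly_in_rat_span:
  assumes q: "q \<noteq> 0" "poly (rpoly q) x = 0"
  shows "poly (rpoly r) x \<in> module.span (\<lambda>(q::rat) (r::real). of_rat q * r) ((\<lambda>i. x ^ i) ` {..<degree q})"
proof -
  interpret rat_space: vector_space "\<lambda>(q::rat) (r::real). of_rat q * r" by (rule rat_vector_space)
  have "degree q > 0"
  proof (rule ccontr)
    assume "\<not> ?thesis"
    then obtain c where "q = [:c:]" by (metis degree_eq_zeroE gr0I)
    then show False using q by (simp add: rpoly_def map_poly_pCons)
  qed
  define s where "s = r mod q"
  have deg: "degree s < degree q"
    using \<open>degree q > 0\<close> q(1) unfolding s_def by (metis degree_0 degree_mod_less)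
  have "r = (r div q) * q + s" by (simp add: s_def)
  then have "poly (rpoly r) x = poly (rpoly s) x"
    using q(2) by (metis add_0 mult_zero_right poly_add poly_mult rpoly_add rpoly_mult)
  also have "\<dots> = (\<Sum>i\<le>degree s. of_rat (coeff s i) * x ^ i)"
    by (simp add: poly_altdef)
  also have "\<dots> \<in> rat_space.span ((\<lambda>i. x ^ i) ` {..<degree q})"
    using deg by (intro rat_space.span_sum rat_space.span_scale rat_space.span_base) auto
  finally show ?thesis .
qed

lemma rat_dependent:
  fixes f :: "nat \<Rightarrow> real"
  assumes span: "f ` {..d} \<subseteq> module.span (\<lambda>(q::rat) (r::real). of_rat q * r) S"
    and S: "finite S" "card S \<le> d"
  shows "\<exists>c::nat\<Rightarrow>rat. (\<exists>i\<le>d. c i \<noteq> 0) \<and> (\<Sum>i\<le>d. of_rat (c i) * f i) = 0"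
proof -
  interpret rat_space: vector_space "\<lambda>(q::rat) (r::real). of_rat q * r" by (rule rat_vector_space)
  show "\<exists>c::nat\<Rightarrow>rat. (\<exists>i\<le>d. c i \<noteq> 0) \<and> (\<Sum>i\<le>d. of_rat (c i) * f i) = 0"
  \<comment> \<open>Linear dependence is a property of sets, so a repeated value is treated
    separately; it gives the relation \<open>f i - f j = 0\<close>.\<close>
  proof (cases "inj_on f {..d}")
    case False
    then obtain i j where ij: "i \<le> d" "j \<le> d" "i \<noteq> j" "f i = f j" by (auto simp: inj_on_def)
    define c :: "nat \<Rightarrow> rat" where "c k = (if k = i then 1 else if k = j then -1 else 0)" for k
    have "(\<Sum>k\<le>d. of_rat (c k) * f k) = (\<Sum>k\<in>{i,j}. of_rat (c k) * f k)"
      using ij by (intro sum.mono_neutral_right) (auto simp: c_def)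
    also have "\<dots> = 0" using ij by (simp add: c_def of_rat_minus)
    finally have "(\<Sum>k\<le>d. of_rat (c k) * f k) = 0" .
    moreover have "c i \<noteq> 0" by (simp add: c_def)
    ultimately show ?thesis using ij by blast
  next
    case True
    have "rat_space.dependent (f ` {..d})"
    proof (rule ccontr)
      assume "\<not> ?thesis"
      then have "card (f ` {..d}) \<le> card S"
        using rat_space.independent_span_bound[of S "f ` {..d}"] span S by auto
      moreover have "card (f ` {..d}) = Suc d" using True by (simp add: card_image)
      ultimately show False using S by simp
    qed
    then obtain t u where t: "finite t" "t \<subseteq> f ` {..d}" "(\<Sum>v\<in>t. of_rat (u v) * v) = 0" "\<exists>v\<in>t. u v \<noteq> 0"
      unfolding rat_space.dependent_explicit by blast
    define c where "c i = (if f i \<in> t then u (f i) else 0)" for i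
    have "(\<Sum>i\<le>d. of_rat (c i) * f i) = (\<Sum>v\<in>f ` {..d}. of_rat (if v \<in> t then u v else 0) * v)"
      using True by (simp add: sum.reindex c_def)
    also have "\<dots> = (\<Sum>v\<in>t. of_rat (u v) * v)"
      using t by (intro sum.mono_neutral_cong_right) auto
    finally have "(\<Sum>i\<le>d. of_rat (c i) * f i) = 0" using t by simp
    moreover have "\<exists>i\<le>d. c i \<noteq> 0" using t by (force simp: c_def)
    ultimately show ?thesis by blast
  qed
qed

text \<open>For \<open>d = degree q\<close>, the \<open>d + 1\<close> numbers \<open>u ^ i * v ^ (d - i)\<close> lie in the
  \<open>d\<close>-dimensional rational span of the powers of \<open>x\<close>; dividing a linear dependency by
  \<open>v ^ d\<close> gives a polynomial equation for \<open>u / v\<close>.\<close>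

lemma algebraic_rational_function:
  assumes x: "algebraic x" and v: "poly (rpoly V) x \<noteq> 0"
  shows "algebraic (poly (rpoly U) x / poly (rpoly V) x)"
proof -
  obtain q where q: "q \<noteq> 0" "poly (rpoly q) x = 0" using x by (auto simp: algebraic_rpoly_iff)
  define d where "d = degree q"
  define u v where "u = poly (rpoly U) x" and "v = poly (rpoly V) x"
  have v0: "v \<noteq> 0" using assms by (simp add: v_def)
  define f where "f i = u ^ i * v ^ (d - i)" for i
  define S where "S = (\<lambda>i. x ^ i) ` {..<d}"
  have span: "f ` {..d} \<subseteq> module.span (\<lambda>(q::rat) (r::real). of_rat q * r) S"
  proof clarify
    fix i
    have "f i = poly (rpoly (U ^ i * V ^ (d - i))) x"
      by (simp add: f_def u_def v_def rpoly_mult rpoly_power poly_power)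
    then show "f i \<in> module.span (\<lambda>(q::rat) (r::real). of_rat q * r) S"
      using poly_in_rat_span[OF q] by (simp add: S_def d_def)
  qed
  have "\<exists>c. (\<exists>i\<le>d. c i \<noteq> 0) \<and> (\<Sum>i\<le>d. of_rat (c i) * f i) = 0"
    using span by (rule rat_dependent) (simp_all add: S_def card_image_le[THEN order_trans])
  then obtain c i where c: "i \<le> d" "c i \<noteq> 0" "(\<Sum>i\<le>d. of_rat (c i) * f i) = 0" by blast
  define r where "r = (\<Sum>i\<le>d. monom (c i) i)"
  have coeff_r: "coeff r k = (if k \<le> d then c k else 0)" for k
    by (simp add: r_def coeff_sum)
  then have "r \<noteq> 0" using c by (metis coeff_0)
  have "poly (rpoly r) (u / v) * v ^ d = (\<Sum>i\<le>d. of_rat (c i) * (u / v) ^ i * v ^ d)"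
  proof -
    have "poly (rpoly r) (u/v) = (\<Sum>i\<le>d. coeff (rpoly r) i * (u/v) ^ i)"
    proof -
      have "degree r \<le> d"
        by (rule degree_le) (simp add: coeff_r)
      then have "(\<Sum>i\<le>degree (rpoly r). coeff (rpoly r) i * (u/v) ^ i) = (\<Sum>i\<le>d. coeff (rpoly r) i * (u/v) ^ i)"
        by (intro sum.mono_neutral_left) (auto simp: coeff_eq_0)
      then show ?thesis by (simp add: poly_altdef)
    qed
    then show ?thesis by (simp add: coeff_r sum_distrib_right)
  qed
  also have "\<dots> = (\<Sum>i\<le>d. of_rat (c i) * f i)"
    using v0 by (intro sum.cong refl) (simp add: f_def power_divide power_diff)
  finally have "poly (rpoly r) (u / v) = 0" using c v0 by simp
  then show ?thesis using \<open>r \<noteq> 0\<close> by (auto simp: algebraic_rpoly_iff u_def v_def)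
qed

text \<open>After cancelling the gcd, a zero of the denominator at \<open>x\<close> would, by
  finiteness of the limit, also be a zero of the numerator, contradicting Bezout.\<close>

lemma rational_function_limit:
  fixes R :: "real \<Rightarrow> real"
  assumes V: "V \<noteq> 0" and lim: "(R \<longlongrightarrow> l) (at_left x)"
    and eq: "eventually (\<lambda>z. R z * poly (rpoly V) z = poly (rpoly U) z) (at_left x)"
  obtains U' V' where "poly (rpoly V') x \<noteq> 0" "l = poly (rpoly U') x / poly (rpoly V') x"
proof -
  define g where "g = gcd U V"
  have g0: "g \<noteq> 0" using V by (simp add: g_def)
  obtain U' V' where UV: "U = U' * g" "V = V' * g" "coprime U' V'"
    using gcd_coprime_exists[of U V] V g0 unfolding g_def by blast
  have "eventually (\<lambda>z. poly (rpoly g) z \<noteq> 0) (at_left x)"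
  proof -
    have "finite {z. poly (rpoly g) z = 0}" using g0 by (simp add: poly_roots_finite)
    then have "eventually (\<lambda>z. z \<notin> {z. poly (rpoly g) z = 0}) (at x)"
      using islimpt_finite by (metis islimpt_iff_eventually)
    then have "eventually (\<lambda>z. z \<notin> {z. poly (rpoly g) z = 0}) (at_left x)"
      by (simp add: eventually_at_split)
    then show ?thesis by simp
  qed
  then have ev: "eventually (\<lambda>z. R z * poly (rpoly V') z = poly (rpoly U') z) (at_left x)"
    using eq by eventually_elim (simp add: UV rpoly_mult)
  have "((\<lambda>z. R z * poly (rpoly V') z) \<longlongrightarrow> l * poly (rpoly V') x) (at_left x)"
    by (intro tendsto_intros lim)
  then have "((\<lambda>z. poly (rpoly U') z) \<longlongrightarrow> l * poly (rpoly V') x) (at_left x)"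
    by (rule Lim_transform_eventually[OF _ ev])
  moreover have "((\<lambda>z. poly (rpoly U') z) \<longlongrightarrow> poly (rpoly U') x) (at_left x)"
    by (intro tendsto_intros)
  ultimately have *: "l * poly (rpoly V') x = poly (rpoly U') x"
    by (rule tendsto_unique[OF trivial_limit_at_left_real])
  obtain a b where "a * U' + b * V' = 1"
    using bezout_coefficients_fst_snd[of U' V'] UV(3) by auto
  then have "poly (rpoly (a * U' + b * V')) x = 1" by simp
  then have "poly (rpoly a) x * poly (rpoly U') x + poly (rpoly b) x * poly (rpoly V') x = 1"
    by (simp add: rpoly_add rpoly_mult)
  then have "poly (rpoly V') x \<noteq> 0" using * by auto
  then show ?thesis using that * by (metis nonzero_eq_divide_eq)
qed

text \<open>The denominator is cleared because \<open>q\<close> may vanish at 0, in which case it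
  has no inverse power series.\<close>

definition fps_rational :: "real fps \<Rightarrow> bool" where
  "fps_rational F \<longleftrightarrow> (\<exists>p q. q \<noteq> 0 \<and> fps_of_poly (rpoly q) * F = fps_of_poly (rpoly p))"

lemma fps_rationalI:
  "q \<noteq> 0 \<Longrightarrow> fps_of_poly (rpoly q) * F = fps_of_poly (rpoly p) \<Longrightarrow> fps_rational F"
  by (auto simp: fps_rational_def)

lemma fps_rational_poly: "fps_rational (fps_of_poly (rpoly p))"
  by (rule fps_rationalI[of 1]) simp_all

lemma fps_rational_add:
  assumes "fps_rational F" "fps_rational G"
  shows "fps_rational (F + G)"
proof -
  obtain p q where pq: "q \<noteq> 0" "fps_of_poly (rpoly q) * F = fps_of_poly (rpoly p)"
    using assms by (auto simp: fps_rational_def)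
  obtain p' q' where pq': "q' \<noteq> 0" "fps_of_poly (rpoly q') * G = fps_of_poly (rpoly p')"
    using assms by (auto simp: fps_rational_def)
  have "fps_of_poly (rpoly (q * q')) * (F + G) =
      fps_of_poly (rpoly q') * (fps_of_poly (rpoly q) * F) + fps_of_poly (rpoly q) * (fps_of_poly (rpoly q') * G)"
    by (simp add: rpoly_mult fps_of_poly_mult algebra_simps)
  also have "\<dots> = fps_of_poly (rpoly (q' * p + q * p'))"
    by (simp add: pq pq' rpoly_mult fps_of_poly_mult rpoly_add fps_of_poly_add)
  finally show ?thesis using pq pq' by (intro fps_rationalI[of "q * q'"]) auto
qed

lemma fps_rational_mult:
  assumes "fps_rational F" "fps_rational G"
  shows "fps_rational (F * G)"
proof -
  obtain p q where pq: "q \<noteq> 0" "fps_of_poly (rpoly q) * F = fps_of_poly (rpoly p)"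
    using assms by (auto simp: fps_rational_def)
  obtain p' q' where pq': "q' \<noteq> 0" "fps_of_poly (rpoly q') * G = fps_of_poly (rpoly p')"
    using assms by (auto simp: fps_rational_def)
  have "fps_of_poly (rpoly (q * q')) * (F * G) =
      (fps_of_poly (rpoly q) * F) * (fps_of_poly (rpoly q') * G)"
    by (simp add: rpoly_mult fps_of_poly_mult algebra_simps)
  also have "\<dots> = fps_of_poly (rpoly (p * p'))"
    by (simp add: pq pq' rpoly_mult fps_of_poly_mult)
  finally show ?thesis using pq pq' by (intro fps_rationalI[of "q * q'"]) auto
qed

text \<open>If \<open>F = p / q\<close>, then \<open>1 / (1 - F) = q / (q - p)\<close>.\<close>

lemma fps_rational_star:
  assumes F: "fps_rational F" "F $ 0 = 0" and T: "T * (1 - F) = 1"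
  shows "fps_rational T"
proof -
  obtain p q where pq: "q \<noteq> 0" "fps_of_poly (rpoly q) * F = fps_of_poly (rpoly p)"
    using assms by (auto simp: fps_rational_def)
  have eq: "fps_of_poly (rpoly (q - p)) = fps_of_poly (rpoly q) * (1 - F)"
    by (simp add: rpoly_diff fps_of_poly_diff pq(2)[symmetric] algebra_simps)
  have "1 - F \<noteq> 0" using T by auto
  then have "q - p \<noteq> 0"
    using eq pq(1) by (metis fps_of_poly_0 fps_of_poly_eq_iff mult_eq_0_iff rpoly_0 rpoly_eq_0_iff)
  moreover have "fps_of_poly (rpoly (q - p)) * T = fps_of_poly (rpoly q)"
    using T by (simp add: eq mult.assoc mult.commute)
  ultimately show ?thesis by (rule fps_rationalI)
qed

section \<open>Growth of convolutions\<close>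

text \<open>The coefficient of \<open>z ^ t\<close> in \<open>(1 - z) ^ (- k - 1)\<close>,
  asymptotically \<open>t ^ k / k!\<close>. Unlike the power, it is positive at \<open>t = 0\<close>
  for every \<open>k\<close> and its convolutions are exact.\<close>

definition rising :: "nat \<Rightarrow> nat \<Rightarrow> real" where
  "rising k t = real ((k + t) choose k)"

lemma rising_pos [simp]: "rising k t > 0"
  by (simp add: rising_def)

lemma rising_nonneg [simp]: "rising k t \<ge> 0"
  by (simp add: rising_def)

lemma rising_neq_0 [simp]: "rising k t \<noteq> 0"
  using rising_pos[of k t] by linarith

lemma rising_0 [simp]: "rising 0 t = 1"
  by (simp add: rising_def)

lemma rising_at_0 [simp]: "rising k 0 = 1"
  by (simp add: rising_def)

lemma sum_rising: "(\<Sum>j\<le>t. rising k j) = rising (Suc k) t"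
  using choose_rising_sum(1)[of k t] by (simp add: rising_def flip: of_nat_sum)

lemma rising_mono: "s \<le> t \<Longrightarrow> rising k s \<le> rising k t"
  by (cases k) (auto simp: sum_rising[symmetric] intro!: sum_mono2)

lemma rising_ge_1: "rising k t \<ge> 1"
  using rising_mono[of 0 t k] by simp

lemma rising_Suc_right: "rising k (Suc t) * (1 + real t) = rising k t * (1 + real t + real k)"
proof -
  have "real (Suc (k + t)) * real ((k + t) choose t) = real (Suc (k + t) choose Suc t) * real (Suc t)"
    by (metis Suc_times_binomial_eq of_nat_mult)
  moreover have "Suc (k + t) choose Suc t = (k + Suc t) choose k" "(k + t) choose t = (k + t) choose k"
    using binomial_symmetric[of k "k + Suc t"] binomial_symmetric[of k "k + t"] by simp_all
  ultimately show ?thesis by (simp add: rising_def algebra_simps del: binomial_Suc_Suc)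
qed

lemma rising_Suc_left: "rising (Suc k) t * (1 + real k) = rising k t * (1 + real k + real t)"
proof -
  have "real (Suc (k + t)) * real ((k + t) choose k) = real (Suc (k + t) choose Suc k) * real (Suc k)"
    by (metis Suc_times_binomial_eq of_nat_mult)
  then show ?thesis by (simp add: rising_def algebra_simps del: binomial_Suc_Suc)
qed

lemma rising_Suc_ratio: "(\<lambda>t. rising k t / rising (Suc k) t) \<longlonglongrightarrow> 0"
proof -
  have "rising k t / rising (Suc k) t = (1 + real k) / (1 + real k + real t)" for t
    using rising_Suc_left[of k t] by (simp add: field_simps)
  moreover have "(\<lambda>t. (1 + real k) / (1 + real k + real t)) \<longlonglongrightarrow> 0"
    by real_asymp
  ultimately show ?thesis by simp
qed

lemma rising_mono_left: "k \<le> m \<Longrightarrow> rising k t \<le> rising m t"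
proof (induction m rule: dec_induct)
  case (step m)
  have "rising m t \<le> (\<Sum>j\<le>t. rising m j)"
    by (intro member_le_sum) auto
  then show ?case using step by (simp add: sum_rising)
qed simp

lemma rising_less_ratio:
  assumes "k < m"
  shows "(\<lambda>t. rising k t / rising m t) \<longlonglongrightarrow> 0"
proof (rule tendsto_sandwich[OF _ _ tendsto_const rising_Suc_ratio[of k]])
  show "\<forall>\<^sub>F t in sequentially. rising k t / rising m t \<le> rising k t / rising (Suc k) t"
    using assms by (intro always_eventually allI divide_left_mono mult_pos_pos rising_mono_left) auto
qed auto

lemma rising_shift: "(\<lambda>t. rising k (t - j) / rising k t) \<longlonglongrightarrow> 1"
proof (induction j)
  case 0
  have "rising k t / rising k t = 1" for t using rising_pos[of k t] by simp
  then show ?case by simp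
next
  case (Suc j)
  have "(\<lambda>t. rising k (t - 1) / rising k t) \<longlonglongrightarrow> 1"
  proof (rule LIMSEQ_imp_Suc)
    have "rising k (Suc t - 1) / rising k (Suc t) = (1 + real t) / (1 + real t + real k)" for t
      using rising_Suc_right[of k t] by (simp add: field_simps)
    moreover have "(\<lambda>t. (1 + real t) / (1 + real t + real k)) \<longlonglongrightarrow> 1"
      by real_asymp
    ultimately show "(\<lambda>t. rising k (Suc t - 1) / rising k (Suc t)) \<longlonglongrightarrow> 1" by simp
  qed
  moreover have "(\<lambda>t. rising k (t - 1 - j) / rising k (t - 1)) \<longlonglongrightarrow> 1"
    using Suc.IH by (rule filterlim_compose) (rule filterlim_minus_const_nat_at_top)
  ultimately have "(\<lambda>t. (rising k (t - 1 - j) / rising k (t - 1)) * (rising k (t - 1) / rising k t)) \<longlonglongrightarrow> 1 * 1"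
    by (intro tendsto_mult)
  moreover have "(rising k (t - 1 - j) / rising k (t - 1)) * (rising k (t - 1) / rising k t) = rising k (t - Suc j) / rising k t" for t
    using rising_pos[of k "t - 1"] by simp
  ultimately show ?case by simp
qed

text \<open>The product of the series of \<open>(1 - z) ^ (- k - 1)\<close> and
  \<open>(1 - z) ^ (- m - 1)\<close>: the exponents add.\<close>

lemma rising_convolution: "(\<Sum>j\<le>t. rising k j * rising m (t - j)) = rising (Suc (k + m)) t"
proof (induction m arbitrary: t)
  case 0
  show ?case by (simp add: sum_rising)
next
  case (Suc m)
  have "(\<Sum>j\<le>t. rising k j * rising (Suc m) (t - j)) = (\<Sum>j\<le>t. \<Sum>i\<le>t - j. rising k j * rising m i)"
    by (simp add: sum_rising[symmetric] sum_distrib_left)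
  also have "\<dots> = (\<Sum>s\<le>t. \<Sum>j\<le>s. rising k j * rising m (s - j))"
    by (subst sum.Sigma, simp, simp, subst sum.triangle_reindex_eq[symmetric])
       (auto intro!: sum.cong)
  also have "\<dots> = rising (Suc (k + Suc m)) t"
    by (simp add: Suc.IH sum_rising)
  finally show ?case .
qed

text \<open>A Cauchy product with the geometric series raises \<open>k\<close> by one.\<close>

lemma summable_rising:
  assumes "0 \<le> q" "q < 1"
  shows "summable (\<lambda>t. rising k t * q ^ t)"
proof (induction k)
  case 0
  show ?case using assms by simp
next
  case (Suc k)
  have "summable (\<lambda>t. \<Sum>j\<le>t. (rising k j * q ^ j) * q ^ (t - j))"
    using Suc.IH assms by (intro summable_Cauchy_product) (simp_all add: abs_mult)
  moreover have "(\<Sum>j\<le>t. (rising k j * q ^ j) * q ^ (t - j)) = rising (Suc k) t * q ^ t" for t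
    by (simp add: sum_rising[symmetric] sum_distrib_right mult.assoc flip: power_add)
  ultimately show ?case by simp
qed

text \<open>Dominated convergence for sums of growing length. It serves for convolutions, with
  \<open>s n = n\<close>, and along the subsequences of the renewal argument.\<close>

lemma tannery_finite_sums:
  fixes p :: "nat \<Rightarrow> real"
  assumes p: "summable (\<lambda>j. \<bar>p j\<bar>)" and s: "filterlim s at_top sequentially"
    and bd: "\<And>n j. j \<le> s n \<Longrightarrow> \<bar>c n j\<bar> \<le> B"
    and lim: "\<And>j. (\<lambda>n. c n j) \<longlonglongrightarrow> d j"
  shows "(\<lambda>n. \<Sum>j\<le>s n. p j * c n j) \<longlonglongrightarrow> (\<Sum>j. p j * d j)"
proof -
  define a where "a j n = (if j \<le> s n then p j * c n j else 0)" for j n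
  have B: "0 \<le> B" using bd[of 0 0] by linarith
  have "((\<lambda>n. suminf (\<lambda>j. a j n)) \<longlongrightarrow> suminf (\<lambda>j. p j * d j)) sequentially"
  proof (rule tannerys_theorem[THEN conjunct2, THEN conjunct2])
    fix j
    have "eventually (\<lambda>n. j \<le> s n) sequentially" using s by (simp add: filterlim_at_top)
    then have "eventually (\<lambda>n. p j * c n j = a j n) sequentially"
      by eventually_elim (simp add: a_def)
    moreover have "(\<lambda>n. p j * c n j) \<longlonglongrightarrow> p j * d j" by (intro tendsto_intros lim)
    ultimately show "(\<lambda>n. a j n) \<longlonglongrightarrow> p j * d j" by (rule Lim_transform_eventually[rotated])
  next
    show "eventually (\<lambda>(k, n). norm (a k n) \<le> \<bar>p k\<bar> * B) (sequentially \<times>\<^sub>F sequentially)"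
    proof (intro always_eventually allI, clarify)
      fix k n show "norm (a k n) \<le> \<bar>p k\<bar> * B"
        using bd[of k n] B by (auto simp: a_def abs_mult intro!: mult_left_mono)
    qed
    show "summable (\<lambda>k. \<bar>p k\<bar> * B)" using p by (rule summable_mult2)
  qed simp
  moreover have "suminf (\<lambda>j. a j n) = (\<Sum>j\<le>s n. p j * c n j)" for n
    by (subst suminf_finite[of "{..s n}"]) (auto simp: a_def)
  ultimately show ?thesis by simp
qed

text \<open>Toeplitz averaging: the finitely many early terms die with their weights, the late ones
  with \<open>x\<close>. The bounded factor may depend on \<open>t\<close>, as required for
  convolutions.\<close>

lemma toeplitz_null:
  fixes w :: "nat \<Rightarrow> nat \<Rightarrow> real"
  assumes w: "\<And>t j. w t j \<ge> 0" "\<And>t. (\<Sum>j\<le>t. w t j) = 1" "\<And>j. (\<lambda>t. w t j) \<longlonglongrightarrow> 0"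
    and x: "x \<longlonglongrightarrow> 0" and y: "\<And>t j. \<bar>y t j\<bar> \<le> B"
  shows "(\<lambda>t. \<Sum>j\<le>t. w t j * (x j * y t j)) \<longlonglongrightarrow> 0"
proof (rule LIMSEQ_I)
  fix e :: real assume e: "e > 0"
  have B: "B \<ge> 0" using y[of 0 0] by linarith
  \<comment> \<open>The \<open>+ 1\<close> keeps the denominator positive when
    \<open>B = 0\<close>.\<close>
  define e' where "e' = e / (2 * (B + 1))"
  have e': "e' > 0" using e B by (simp add: e'_def)
  obtain N where N: "\<And>j. j \<ge> N \<Longrightarrow> \<bar>x j\<bar> < e'"
    using LIMSEQ_D[OF x e'] by auto
  have "(\<lambda>t. \<Sum>j<N. w t j * (\<bar>x j\<bar> * B)) \<longlonglongrightarrow> (\<Sum>j<N. 0 * (\<bar>x j\<bar> * B))"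
    by (intro tendsto_intros w)
  then have "(\<lambda>t. \<Sum>j<N. w t j * (\<bar>x j\<bar> * B)) \<longlonglongrightarrow> 0" by simp
  then obtain T where T: "\<And>t. t \<ge> T \<Longrightarrow> \<bar>\<Sum>j<N. w t j * (\<bar>x j\<bar> * B)\<bar> < e / 2"
    using LIMSEQ_D[of _ 0 "e/2"] e by fastforce
  show "\<exists>no. \<forall>n\<ge>no. norm ((\<Sum>j\<le>n. w n j * (x j * y n j)) - 0) < e"
  proof (intro exI allI impI)
    fix t assume t: "t \<ge> max T N"
    have "\<bar>\<Sum>j\<le>t. w t j * (x j * y t j)\<bar> \<le> (\<Sum>j\<le>t. \<bar>w t j * (x j * y t j)\<bar>)" by (rule sum_abs)
    also have "\<dots> \<le> (\<Sum>j\<le>t. (if j < N then w t j * (\<bar>x j\<bar> * B) else 0) + w t j * (e' * B))"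
    proof (rule sum_mono)
      fix j
      have 1: "\<bar>w t j * (x j * y t j)\<bar> \<le> w t j * (\<bar>x j\<bar> * B)"
        using w(1)[of t j] y[of t j] by (auto simp: abs_mult intro!: mult_left_mono)
      have 2: "w t j * (\<bar>x j\<bar> * B) \<le> w t j * (e' * B)" if "j \<ge> N"
        using w(1)[of t j] N[OF that] B by (intro mult_left_mono mult_right_mono) auto
      show "\<bar>w t j * (x j * y t j)\<bar> \<le> (if j < N then w t j * (\<bar>x j\<bar> * B) else 0) + w t j * (e' * B)"
        using 1 2 w(1)[of t j] e' B by (auto intro: add_increasing2 order.trans simp: not_less)
    qed
    also have "\<dots> = (\<Sum>j<N. w t j * (\<bar>x j\<bar> * B)) + e' * B"
    proof -
      have "(\<Sum>j\<le>t. (if j < N then w t j * (\<bar>x j\<bar> * B) else 0)) = (\<Sum>j<N. w t j * (\<bar>x j\<bar> * B))"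
        using t by (intro sum.mono_neutral_cong_right) auto
      then show ?thesis using w(2)[of t] by (simp add: sum.distrib flip: sum_distrib_right)
    qed
    also have "\<dots> < e / 2 + e / 2"
    proof (rule add_less_le_mono)
      show "(\<Sum>j<N. w t j * (\<bar>x j\<bar> * B)) < e / 2" using T[of t] t by simp
      show "e' * B \<le> e / 2" using e B by (simp add: e'_def field_simps)
    qed
    finally show "norm ((\<Sum>j\<le>t. w t j * (x j * y t j)) - 0) < e" by simp
  qed
qed

text \<open>\<open>C = 0\<close> is allowed and then only says that \<open>a\<close> is of smaller
  order; a true rate is expressed by adding \<open>C > 0\<close>.\<close>

definition growth :: "(nat \<Rightarrow> real) \<Rightarrow> nat \<Rightarrow> real \<Rightarrow> real \<Rightarrow> bool" where
  "growth a k r C \<longleftrightarrow> r > 0 \<and> (\<lambda>t. a t / (rising k t * r ^ t)) \<longlonglongrightarrow> C"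

lemma growth_bounded:
  assumes "growth a k r C"
  obtains B where "\<And>t. \<bar>a t\<bar> / (rising k t * r ^ t) \<le> B"
proof -
  have "Bseq (\<lambda>t. a t / (rising k t * r ^ t))"
    using assms by (auto simp: growth_def intro: convergent_imp_Bseq convergentI)
  then obtain B where B: "\<And>t. norm (a t / (rising k t * r ^ t)) \<le> B" by (meson BseqE)
  have "\<bar>a t\<bar> / (rising k t * r ^ t) \<le> B" for t
    using B[of t] assms by (simp add: growth_def abs_mult)
  then show ?thesis by (rule that)
qed

lemma growth_ratio_less:
  assumes "0 < r" "0 < r'" "r < r' \<or> (r = r' \<and> k < k')"
  shows "(\<lambda>t. (rising k t * r ^ t) / (rising k' t * r' ^ t)) \<longlonglongrightarrow> 0"
  using assms(3)
proof
  assume less: "r < r'"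
  have "summable (\<lambda>t. rising k t * (r / r') ^ t)"
    using assms less by (intro summable_rising) auto
  then have 0: "(\<lambda>t. rising k t * (r / r') ^ t) \<longlonglongrightarrow> 0" by (rule summable_LIMSEQ_zero)
  show ?thesis
  proof (rule tendsto_sandwich[OF _ _ tendsto_const 0])
    have "(rising k t * r ^ t) / (rising k' t * r' ^ t) \<le> rising k t * (r / r') ^ t" for t
    proof -
      have "(rising k t * r ^ t) / (rising k' t * r' ^ t) = (rising k t * (r / r') ^ t) / rising k' t"
        by (simp add: power_divide)
      also have "\<dots> \<le> (rising k t * (r / r') ^ t) / 1"
        using assms rising_ge_1[of k' t] by (intro divide_left_mono) auto
      finally show ?thesis by simp
    qed
    then show "\<forall>\<^sub>F t in sequentially. (rising k t * r ^ t) / (rising k' t * r' ^ t) \<le> rising k t * (r / r') ^ t"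
      by simp
  qed (use assms in auto)
next
  assume eq: "r = r' \<and> k < k'"
  then have "(rising k t * r ^ t) / (rising k' t * r' ^ t) = rising k t / rising k' t" for t
    using assms by simp
  then show ?thesis using rising_less_ratio[of k k'] eq by simp
qed

lemma growth_dominated:
  assumes "growth a k r C" "0 < r'" "r < r' \<or> (r = r' \<and> k < k')"
  shows "growth a k' r' 0"
proof -
  have r: "0 < r" using assms by (simp add: growth_def)
  have "(\<lambda>t. (a t / (rising k t * r ^ t)) * ((rising k t * r ^ t) / (rising k' t * r' ^ t))) \<longlonglongrightarrow> C * 0"
    using assms growth_ratio_less[OF r assms(2,3)] by (intro tendsto_mult) (auto simp: growth_def)
  moreover have "(a t / (rising k t * r ^ t)) * ((rising k t * r ^ t) / (rising k' t * r' ^ t)) = a t / (rising k' t * r' ^ t)" for t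
    using r by simp
  ultimately show ?thesis using assms by (simp add: growth_def)
qed

lemma growth_add:
  "growth a k r C \<Longrightarrow> growth b k r D \<Longrightarrow> growth (\<lambda>t. a t + b t) k r (C + D)"
  by (auto simp: growth_def add_divide_distrib intro: tendsto_add)

lemma growth_cong:
  assumes "growth a k r C" "eventually (\<lambda>t. a t = b t) sequentially"
  shows "growth b k r C"
  using assms unfolding growth_def
  by (auto intro: Lim_transform_eventually elim!: eventually_mono)

text \<open>A factor that converges absolutely at the radius \<open>1 / r\<close> only multiplies
  the leading constant by its value there.\<close>

lemma growth_convolution_summable:
  assumes a: "growth a k r C" and b: "summable (\<lambda>j. \<bar>b j\<bar> / r ^ j)"
  shows "growth (\<lambda>t. \<Sum>j\<le>t. b j * a (t - j)) k r (C * (\<Sum>j. b j / r ^ j))"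
proof -
  have r: "r > 0" using a by (simp add: growth_def)
  obtain B where B: "\<And>t. \<bar>a t\<bar> / (rising k t * r ^ t) \<le> B" using growth_bounded[OF a] by blast
  define c where "c n j = a (n - j) / (rising k n * r ^ (n - j))" for n j
  have "(\<lambda>n. \<Sum>j\<le>n. (b j / r ^ j) * c n j) \<longlonglongrightarrow> (\<Sum>j. b j / r ^ j * C)"
  proof (rule tannery_finite_sums[where B = B])
    show "summable (\<lambda>j. \<bar>b j / r ^ j\<bar>)" using b r by simp
    show "\<bar>c n j\<bar> \<le> B" for n j
    proof -
      have "\<bar>c n j\<bar> = \<bar>a (n - j)\<bar> / (rising k n * r ^ (n - j))" using r by (simp add: c_def abs_mult)
      also have "\<dots> \<le> \<bar>a (n - j)\<bar> / (rising k (n - j) * r ^ (n - j))"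
        using r by (intro divide_left_mono mult_right_mono rising_mono) auto
      also have "\<dots> \<le> B" by (rule B)
      finally show ?thesis .
    qed
    show "(\<lambda>n. c n j) \<longlonglongrightarrow> C" for j
    proof -
      have "(\<lambda>n. a (n - j) / (rising k (n - j) * r ^ (n - j))) \<longlonglongrightarrow> C"
        using a unfolding growth_def by (auto intro: filterlim_compose[OF _ filterlim_minus_const_nat_at_top])
      then have "(\<lambda>n. a (n - j) / (rising k (n - j) * r ^ (n - j)) * (rising k (n - j) / rising k n)) \<longlonglongrightarrow> C * 1"
        by (intro tendsto_mult rising_shift)
      moreover have "a (n - j) / (rising k (n - j) * r ^ (n - j)) * (rising k (n - j) / rising k n) = c n j" for n
        using r by (simp add: c_def)
      ultimately show ?thesis by simp
    qed
  qed (auto intro: filterlim_ident)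
  moreover have "(\<Sum>j\<le>n. (b j / r ^ j) * c n j) = (\<Sum>j\<le>n. b j * a (n - j)) / (rising k n * r ^ n)" for n
    unfolding sum_divide_distrib
  proof (rule sum.cong)
    fix j assume "j \<in> {..n}"
    then have "r ^ n = r ^ j * r ^ (n - j)" by (simp flip: power_add)
    then show "b j / r ^ j * c n j = b j * a (n - j) / (rising k n * r ^ n)"
      by (simp add: c_def)
  qed simp
  moreover have "(\<Sum>j. b j / r ^ j * C) = C * (\<Sum>j. b j / r ^ j)"
    using b r by (subst suminf_mult2[symmetric]) (auto simp: mult.commute intro!: summable_rabs_cancel[of "\<lambda>j. b j / r ^ j"])
  ultimately show ?thesis using r by (simp add: growth_def)
qed

text \<open>Poles of orders \<open>k + 1\<close> and \<open>m + 1\<close> at the same point combine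
  to one of order \<open>k + m + 2\<close>.\<close>

lemma growth_convolution_equal:
  assumes a: "growth a k r C" and b: "growth b m r D"
  shows "growth (\<lambda>t. \<Sum>j\<le>t. a j * b (t - j)) (Suc (k + m)) r (C * D)"
proof -
  have r: "r > 0" using a by (simp add: growth_def)
  define x where "x t = a t / (rising k t * r ^ t)" for t
  define y where "y t = b t / (rising m t * r ^ t)" for t
  have x: "x \<longlonglongrightarrow> C" and y: "y \<longlonglongrightarrow> D" using a b by (auto simp: growth_def x_def[abs_def] y_def[abs_def])
  obtain B where B: "\<And>t. \<bar>y t\<bar> \<le> B"
    using growth_bounded[OF b] r by (metis (no_types, lifting) abs_divide abs_mult abs_of_pos rising_pos y_def zero_less_power)
  \<comment> \<open>By \<open>rising_convolution\<close> these weights sum to 1, so the normalized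
    convolution is a weighted mean of the products \<open>x j * y (t - j)\<close>.\<close>
  define w where "w k m t j = rising k j * rising m (t - j) / rising (Suc (k + m)) t" for k m t j
  have w: "w k m t j \<ge> 0" "(\<Sum>j\<le>t. w k m t j) = 1" for k m t j
    using rising_pos[of "Suc (k + m)" t] by (auto simp: w_def rising_convolution simp flip: sum_divide_distrib)
  have w0: "(\<lambda>t. w k m t j) \<longlonglongrightarrow> 0" for k m j
  proof (rule tendsto_sandwich[OF _ _ tendsto_const])
    show "(\<lambda>t. rising k j * (rising m t / rising (Suc (k + m)) t)) \<longlonglongrightarrow> 0"
      by (intro tendsto_mult_right_zero rising_less_ratio) simp
    show "\<forall>\<^sub>F t in sequentially. w k m t j \<le> rising k j * (rising m t / rising (Suc (k + m)) t)"
      by (auto simp: w_def intro!: always_eventually divide_right_mono mult_left_mono rising_mono)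
  qed (simp add: w)
  \<comment> \<open>\<open>x j * y (t - j) - C * D\<close> splits into
    \<open>(x j - C) * y (t - j)\<close> and \<open>C * (y (t - j) - D)\<close>. The second part
    becomes an instance of \<open>toeplitz_null\<close> after reversing the summation, which swaps
    \<open>k\<close> and \<open>m\<close>.\<close>
  have 1: "(\<lambda>t. \<Sum>j\<le>t. w k m t j * ((x j - C) * y (t - j))) \<longlonglongrightarrow> 0"
    by (rule toeplitz_null[OF w w0]) (use x B in \<open>auto intro: LIM_zero\<close>)
  have "(\<lambda>t. \<Sum>j\<le>t. w m k t j * ((y j - D) * 1)) \<longlonglongrightarrow> 0"
    by (rule toeplitz_null[OF w w0, where B = 1]) (use y in \<open>auto intro: LIM_zero\<close>)
  moreover have "(\<Sum>j\<le>t. w m k t j * ((y j - D) * 1)) = (\<Sum>j\<le>t. w k m t j * (y (t - j) - D))" for t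
    by (rule sum.reindex_bij_witness[of _ "\<lambda>j. t - j" "\<lambda>j. t - j"])
       (auto simp: w_def add.commute mult.commute)
  ultimately have 2: "(\<lambda>t. \<Sum>j\<le>t. w k m t j * (y (t - j) - D)) \<longlonglongrightarrow> 0" by simp
  have "(\<lambda>t. (\<Sum>j\<le>t. w k m t j * ((x j - C) * y (t - j))) + C * (\<Sum>j\<le>t. w k m t j * (y (t - j) - D)) + C * D) \<longlonglongrightarrow> 0 + C * 0 + C * D"
    by (intro tendsto_intros 1 2)
  moreover have "(\<Sum>j\<le>t. w k m t j * ((x j - C) * y (t - j))) + C * (\<Sum>j\<le>t. w k m t j * (y (t - j) - D)) + C * D
      = (\<Sum>j\<le>t. a j * b (t - j)) / (rising (Suc (k + m)) t * r ^ t)" for t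
  proof -
    have "C * D = (\<Sum>j\<le>t. w k m t j * (C * D))" using w(2)[of k m t] by (simp flip: sum_distrib_right)
    then have "(\<Sum>j\<le>t. w k m t j * ((x j - C) * y (t - j))) + C * (\<Sum>j\<le>t. w k m t j * (y (t - j) - D)) + C * D
      = (\<Sum>j\<le>t. w k m t j * ((x j - C) * y (t - j))) + (\<Sum>j\<le>t. C * (w k m t j * (y (t - j) - D))) + (\<Sum>j\<le>t. w k m t j * (C * D))"
      by (simp add: sum_distrib_left)
    also have "\<dots> = (\<Sum>j\<le>t. w k m t j * (x j * y (t - j)))"
      unfolding sum.distrib[symmetric] by (intro sum.cong refl) (simp add: algebra_simps)
    also have "\<dots> = (\<Sum>j\<le>t. a j * b (t - j)) / (rising (Suc (k + m)) t * r ^ t)"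
      unfolding sum_divide_distrib
    proof (rule sum.cong)
      fix j assume "j \<in> {..t}"
      then have "r ^ t = r ^ j * r ^ (t - j)" by (simp flip: power_add)
      then show "w k m t j * (x j * y (t - j)) = a j * b (t - j) / (rising (Suc (k + m)) t * r ^ t)"
        using r by (simp add: w_def x_def y_def)
    qed simp
    finally show ?thesis .
  qed
  ultimately show ?thesis using r by (simp add: growth_def)
qed

section \<open>The renewal theorem\<close>

text \<open>The upper limit \<open>a\<close> appears as the limit of the decreasing tail suprema
  \<open>e\<close>, together with a sequence \<open>s\<close> along which it is approached.\<close>

lemma bounded_upper_envelope:
  fixes y :: "nat \<Rightarrow> real"
  assumes bd: "\<And>t. \<bar>y t\<bar> \<le> B"
  obtains e a s where "e \<longlonglongrightarrow> a" "\<And>t. y t \<le> e t" "\<And>t. \<bar>e t\<bar> \<le> B"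
    "filterlim s at_top sequentially" "(\<lambda>n. y (s n)) \<longlonglongrightarrow> a"
proof -
  define e where "e m = Sup (y ` {m..})" for m
  have bdd: "bdd_above (y ` A)" for A
    using bd by (intro bdd_aboveI[of _ B]) (auto simp: abs_le_iff)
  have ye: "y t \<le> e m" if "t \<ge> m" for t m
    unfolding e_def using that by (intro cSup_upper bdd) auto
  have eB: "e m \<le> B" for m
    unfolding e_def using bd by (intro cSup_least) (auto simp: abs_le_iff)
  have eB': "- B \<le> e m" for m
    using bd[of m] ye[of m m] by linarith
  have "decseq e"
  proof (rule decseq_SucI)
    show "e (Suc n) \<le> e n" for n
      unfolding e_def by (intro cSup_subset_mono bdd) auto
  qed
  then obtain a where a: "e \<longlonglongrightarrow> a" using decseq_convergent[of e "- B"] eB' by blast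
  have "\<exists>m\<ge>n. y m > e n - 1 / real (Suc n)" for n
  proof -
    have "e n - 1 / real (Suc n) < Sup (y ` {n..})" by (simp add: e_def)
    then obtain z where "z \<in> y ` {n..}" "e n - 1 / real (Suc n) < z"
      using less_cSupE[of "e n - 1 / real (Suc n)" "y ` {n..}"] by auto
    then show ?thesis by auto
  qed
  then obtain s where s: "\<And>n. s n \<ge> n" "\<And>n. y (s n) > e n - 1 / real (Suc n)" by metis
  have "filterlim s at_top sequentially"
    using s(1) by (auto intro: filterlim_at_top_mono[OF filterlim_ident])
  moreover have "(\<lambda>n. y (s n)) \<longlonglongrightarrow> a"
  proof (rule tendsto_sandwich[OF _ _ _ a])
    have "(\<lambda>n. e n - 1 / real (Suc n)) \<longlonglongrightarrow> a - 0"
      using tendsto_diff[OF a LIMSEQ_inverse_real_of_nat] by (simp only: inverse_eq_divide)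
    then show "(\<lambda>n. e n - 1 / real (Suc n)) \<longlonglongrightarrow> a" by simp
    show "\<forall>\<^sub>F n in sequentially. e n - 1 / real (Suc n) \<le> y (s n)" using s(2) by (simp add: less_imp_le)
    show "\<forall>\<^sub>F n in sequentially. y (s n) \<le> e n" using ye s(1) by simp
  qed
  moreover have "\<bar>e t\<bar> \<le> B" for t using eB[of t] eB'[of t] by (simp add: abs_le_iff)
  ultimately show ?thesis using that a ye by blast
qed

text \<open>The Erdos-Feller-Pollard argument: along a sequence realising the upper limit of a
  solution of the renewal equation, all shifts converge to the upper limit as well, and the
  conserved quantity \<open>\<Sum>i\<le>t. r i * y (t - i)\<close> then determines its value.\<close>

lemma renewal_upper:
  fixes p y r :: "nat \<Rightarrow> real"
  assumes pos: "\<And>j. p j \<ge> 0" and p1: "p 1 > 0" and sums: "p sums 1"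
    and r: "summable (\<lambda>i. \<bar>r i\<bar>)" "(\<Sum>i. r i) > 0"
    and bd: "\<And>t. \<bar>y t\<bar> \<le> 1"
    and rec: "\<And>t. y (Suc t) = (\<Sum>j\<le>Suc t. p j * y (Suc t - j))"
    and cons: "\<And>t. (\<Sum>i\<le>t. r i * y (t - i)) = \<sigma>"
  shows "\<exists>e. e \<longlonglongrightarrow> \<sigma> / (\<Sum>i. r i) \<and> (\<forall>t. y t \<le> e t)"
proof -
  obtain e a s where e: "e \<longlonglongrightarrow> a" "\<And>t. y t \<le> e t" "\<And>t. \<bar>e t\<bar> \<le> 1"
    and s: "filterlim s at_top sequentially" "(\<lambda>n. y (s n)) \<longlonglongrightarrow> a"
    by (rule bounded_upper_envelope[of y 1, OF bd]) (rule that, assumption+)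
  have psum: "summable (\<lambda>j. \<bar>p j\<bar>)" using sums pos by (simp add: sums_iff)
  have step: "(\<lambda>n. y (s n - 1)) \<longlonglongrightarrow> a" 
    if s: "filterlim s at_top sequentially" "(\<lambda>n. y (s n)) \<longlonglongrightarrow> a" for s
  proof -
    have sj: "filterlim (\<lambda>n. s n - j) at_top sequentially" for j
      using s(1) by (rule filterlim_compose[OF filterlim_minus_const_nat_at_top])
    have "(\<lambda>n. \<Sum>j\<le>s n. p j * e (s n - j)) \<longlonglongrightarrow> (\<Sum>j. p j * a)"
    proof (rule tannery_finite_sums[OF psum s(1), where B = 1 and c = "\<lambda>n j. e (s n - j)" and d = "\<lambda>_. a"])
      show "(\<lambda>n. e (s n - j)) \<longlonglongrightarrow> a" for j by (rule filterlim_compose[OF e(1) sj])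
    qed (use e in auto)
    moreover have "(\<Sum>j. p j * a) = a" using sums by (simp add: sums_iff suminf_mult2[symmetric])
    ultimately have "(\<lambda>n. (\<Sum>j\<le>s n. p j * e (s n - j)) - y (s n)) \<longlonglongrightarrow> a - a"
      using s(2) by (intro tendsto_diff) auto
    then have 0: "(\<lambda>n. ((\<Sum>j\<le>s n. p j * e (s n - j)) - y (s n)) / p 1) \<longlonglongrightarrow> 0"
      using p1 by (auto intro: tendsto_divide_zero)
    have "(\<lambda>n. e (s n - 1) - y (s n - 1)) \<longlonglongrightarrow> 0"
    proof (rule tendsto_sandwich[OF _ _ tendsto_const 0])
      show "\<forall>\<^sub>F n in sequentially. 0 \<le> e (s n - 1) - y (s n - 1)" using e(2) by simp
      have "eventually (\<lambda>n. s n \<ge> 1) sequentially" using s(1) by (simp add: filterlim_at_top)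
      then show "\<forall>\<^sub>F n in sequentially. e (s n - 1) - y (s n - 1) \<le> ((\<Sum>j\<le>s n. p j * e (s n - j)) - y (s n)) / p 1"
      proof eventually_elim
        case (elim n)
        then obtain m where m: "s n = Suc m" by (metis Suc_le_D One_nat_def)
        \<comment> \<open>All deficits \<open>e - y\<close> are nonnegative, so the one weighted by
          \<open>p 1\<close> is at most the whole weighted sum, which tends to 0.\<close>
        have "p 1 * (e (s n - 1) - y (s n - 1)) \<le> (\<Sum>j\<le>s n. p j * (e (s n - j) - y (s n - j)))"
          using elim e(2) pos by (intro member_le_sum[of 1 "{..s n}" "\<lambda>j. p j * (e (s n - j) - y (s n - j))"]) auto
        also have "\<dots> = (\<Sum>j\<le>s n. p j * e (s n - j)) - y (s n)"
          unfolding m rec[of m] by (simp add: sum_subtractf right_diff_distrib)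
        finally show ?case using p1 by (simp add: field_simps)
      qed
    qed
    moreover have "(\<lambda>n. e (s n - 1)) \<longlonglongrightarrow> a" by (rule filterlim_compose[OF e(1) sj])
    ultimately have "(\<lambda>n. e (s n - 1) - (e (s n - 1) - y (s n - 1))) \<longlonglongrightarrow> a - 0"
      by (intro tendsto_diff)
    then show ?thesis by simp
  qed
  \<comment> \<open>\<open>p 1 > 0\<close> acts as aperiodicity: unit shifts iterate to every
    shift.\<close>
  have shift: "(\<lambda>n. y (s n - i)) \<longlonglongrightarrow> a" for i
  proof (induction i)
    case (Suc i)
    have "filterlim (\<lambda>n. s n - i) at_top sequentially"
      using s(1) by (rule filterlim_compose[OF filterlim_minus_const_nat_at_top])
    from step[OF this Suc.IH] show ?case by simp
  qed (use s in simp)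
  have "(\<lambda>n. \<Sum>i\<le>s n. r i * y (s n - i)) \<longlonglongrightarrow> (\<Sum>i. r i * a)"
    by (rule tannery_finite_sums[OF r(1) s(1), where B = 1 and c = "\<lambda>n i. y (s n - i)" and d = "\<lambda>_. a"])
       (use bd shift in auto)
  then have "(\<lambda>n. \<sigma>) \<longlonglongrightarrow> (\<Sum>i. r i * a)" by (simp add: cons)
  then have "\<sigma> = (\<Sum>i. r i * a)" by (simp add: LIMSEQ_const_iff)
  also have "\<dots> = (\<Sum>i. r i) * a"
    using summable_rabs_cancel[OF r(1)] by (rule suminf_mult2[symmetric])
  finally have "a = \<sigma> / (\<Sum>i. r i)" using r(2) by (simp add: field_simps)
  then show ?thesis using e by blast
qed

text \<open>\<open>renewal_upper\<close> for \<open>v\<close> and for \<open>- v\<close> squeezes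
  \<open>v\<close> onto the reciprocal of the sum of the tails \<open>r i\<close>, which is the mean
  of the distribution \<open>p\<close>.\<close>

lemma renewal_theorem:
  fixes p v :: "nat \<Rightarrow> real"
  assumes p0: "p 0 = 0" and pos: "\<And>j. p j \<ge> 0" and p1: "p 1 > 0" and sums: "p sums 1"
    and mean: "summable (\<lambda>j. real j * p j)"
    and v0: "v 0 = 1" and rec: "\<And>t. v (Suc t) = (\<Sum>j\<le>Suc t. p j * v (Suc t - j))"
  shows "\<exists>c>0. v \<longlonglongrightarrow> c"
proof -
  define r where "r i = 1 - (\<Sum>j\<le>i. p j)" for i
  have sp: "summable p" and sp1: "suminf p = 1" using sums by (auto simp: sums_iff)
  have partial: "(\<Sum>j\<le>i. p j) \<le> 1" for i
    using sum_le_suminf[OF sp, of "{..i}"] pos sp1 by simp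
  have rpos: "r i \<ge> 0" for i using partial[of i] by (simp add: r_def)
  have tail: "r i = (\<Sum>k. p (k + Suc i))" for i
    using suminf_minus_initial_segment[OF sp, of "Suc i"] by (simp add: r_def sp1 lessThan_Suc_atMost)
  have nr: "real n * r n \<le> (\<Sum>j. real j * p j) - (\<Sum>j\<le>n. real j * p j)" for n
  proof -
    have "real n * r n = (\<Sum>k. real n * p (k + Suc n))"
      unfolding tail using sp by (intro suminf_mult[symmetric] summable_ignore_initial_segment)
    also have "\<dots> \<le> (\<Sum>k. real (k + Suc n) * p (k + Suc n))"
      using sp mean pos
      by (intro suminf_le summable_mult mult_right_mono)
         (auto intro: summable_ignore_initial_segment[OF mean, of "Suc n", simplified] summable_ignore_initial_segment[OF sp, of "Suc n", simplified])
    also have "\<dots> = (\<Sum>j. real j * p j) - (\<Sum>j\<le>n. real j * p j)"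
      using suminf_minus_initial_segment[OF mean, of "Suc n"] by (simp add: lessThan_Suc_atMost)
    finally show ?thesis .
  qed
  \<comment> \<open>Summation by parts; together with \<open>nr\<close> it bounds the partial sums
    of the tails by the mean.\<close>
  have "(\<Sum>i<n. r i) = real n * r n + (\<Sum>j\<le>n. real j * p j)" for n
    by (induction n) (auto simp: r_def algebra_simps)
  then have "(\<Sum>i<n. r i) \<le> (\<Sum>j. real j * p j)" for n using nr[of n] by simp
  then have rs: "summable r" using rpos by (intro summableI_nonneg_bounded[of r]) auto
  have r0: "r 0 = 1" by (simp add: r_def p0)
  have rs_pos: "suminf r > 0" using rs rpos r0 by (intro suminf_pos2[of r 0]) auto
  \<comment> \<open>A conserved quantity: passing to \<open>Suc t\<close> adds
    \<open>v (Suc t)\<close> because \<open>r 0 = 1\<close>, and the decrease of the tails by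
    \<open>p\<close> removes the same amount by the renewal equation.\<close>
  have cons: "(\<Sum>i\<le>t. r i * v (t - i)) = 1" for t
  proof (induction t)
    case 0
    show ?case by (simp add: r0 v0)
  next
    case (Suc t)
    have "(\<Sum>i\<le>Suc t. r i * v (Suc t - i)) = v (Suc t) + (\<Sum>i\<le>t. r (Suc i) * v (t - i))"
      by (subst sum.atMost_Suc_shift) (simp add: r0)
    also have "(\<Sum>i\<le>t. r (Suc i) * v (t - i)) = (\<Sum>i\<le>t. r i * v (t - i)) - (\<Sum>i\<le>t. p (Suc i) * v (t - i))"
      by (simp add: r_def algebra_simps flip: sum_subtractf)
    also have "(\<Sum>i\<le>t. p (Suc i) * v (t - i)) = v (Suc t)"
      unfolding rec by (subst sum.atMost_Suc_shift) (simp add: p0)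
    finally show ?case using Suc.IH by simp
  qed
  have v01: "0 \<le> v t \<and> v t \<le> 1" for t
  proof (induction t rule: less_induct)
    case (less t)
    show ?case
    proof (cases t)
      case (Suc m)
      have IH: "p j * v (Suc m - j) \<le> p j" "0 \<le> p j * v (Suc m - j)" for j
        using less.IH[of "Suc m - j"] Suc pos[of j] p0
        by (cases j; auto intro!: mult_left_le)+
      have "(\<Sum>j\<le>Suc m. p j * v (Suc m - j)) \<le> (\<Sum>j\<le>Suc m. p j)" by (intro sum_mono IH)
      moreover have "0 \<le> (\<Sum>j\<le>Suc m. p j * v (Suc m - j))" by (intro sum_nonneg IH)
      ultimately show ?thesis using partial[of "Suc m"] by (simp add: Suc rec del: sum.atMost_Suc)
    qed (simp add: v0)
  qed
  have rabs: "summable (\<lambda>i. \<bar>r i\<bar>)" using rs rpos by simp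
  obtain e where e: "e \<longlonglongrightarrow> 1 / suminf r" "\<And>t. v t \<le> e t"
    using renewal_upper[OF pos p1 sums rabs rs_pos _ rec cons] v01 by (auto simp: abs_le_iff)
  obtain e' where e': "e' \<longlonglongrightarrow> - 1 / suminf r" "\<And>t. - v t \<le> e' t"
  proof -
    have "- v (Suc t) = (\<Sum>j\<le>Suc t. p j * - v (Suc t - j))" for t
      unfolding rec by (simp add: sum_negf del: sum.atMost_Suc)
    moreover have "(\<Sum>i\<le>t. r i * - v (t - i)) = -1" for t using cons[of t] by (simp add: sum_negf)
    moreover have "\<bar>- v t\<bar> \<le> 1" for t using v01[of t] by simp
    ultimately show ?thesis
      using renewal_upper[OF pos p1 sums rabs rs_pos, of "\<lambda>t. - v t" "-1"] that by metis
  qed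
  have "v \<longlonglongrightarrow> 1 / suminf r"
  proof (rule tendsto_sandwich[OF _ _ _ e(1)])
    show "(\<lambda>t. - e' t) \<longlonglongrightarrow> 1 / suminf r" using tendsto_minus[OF e'(1)] by simp
    show "\<forall>\<^sub>F n in sequentially. - e' n \<le> v n" using e'(2) by (auto simp: minus_le_iff)
  qed (use e(2) in auto)
  then show ?thesis using rs_pos by (intro exI[of _ "1 / suminf r"]) simp
qed

section \<open>Power series near their radius of convergence\<close>

lemma growth_summable:
  assumes a: "growth a k r C" and x: "0 \<le> x" "r * x < 1"
  shows "summable (\<lambda>t. \<bar>a t\<bar> * x ^ t)"
proof -
  have r: "r > 0" using a by (simp add: growth_def)
  obtain B where B: "\<And>t. \<bar>a t\<bar> / (rising k t * r ^ t) \<le> B" using growth_bounded[OF a] by blast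
  show ?thesis
  proof (rule summable_comparison_test')
    show "summable (\<lambda>t. B * (rising k t * (r * x) ^ t))"
      using x r by (intro summable_mult summable_rising) auto
    fix t
    have "\<bar>a t\<bar> \<le> B * (rising k t * r ^ t)"
      using B[of t] r by (simp add: pos_divide_le_eq)
    then have "\<bar>a t\<bar> * x ^ t \<le> B * (rising k t * r ^ t) * x ^ t"
      using x by (intro mult_right_mono) auto
    then show "norm (\<bar>a t\<bar> * x ^ t) \<le> B * (rising k t * (r * x) ^ t)"
      using x by (simp add: power_mult_distrib mult_ac)
  qed
qed

lemma growth_eventually_ge:
  assumes a: "growth a k r C" and C: "C > 0"
  shows "eventually (\<lambda>t. a t \<ge> C / 2 * r ^ t) sequentially"
proof -
  have r: "r > 0" using a by (simp add: growth_def)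
  have "eventually (\<lambda>t. a t / (rising k t * r ^ t) > C / 2) sequentially"
    using a C by (intro order_tendstoD(1)[of _ C]) (auto simp: growth_def)
  then show ?thesis
  proof eventually_elim
    case (elim t)
    then have "a t \<ge> C / 2 * (rising k t * r ^ t)" using r by (simp add: field_simps)
    also have "C / 2 * (rising k t * r ^ t) \<ge> C / 2 * (1 * r ^ t)"
      using C r by (intro mult_left_mono mult_right_mono rising_ge_1) auto
    finally show ?case by simp
  qed
qed

text \<open>At \<open>1 / r\<close> every late term is at least \<open>c\<close>, so a long finite
  block of terms exceeds any bound; by continuity it still does slightly to the left.\<close>

lemma powser_filterlim_at_top:
  fixes b :: "nat \<Rightarrow> real"
  assumes pos: "\<And>t. b t \<ge> 0" and r: "r > 0" and c: "c > 0"
    and ge: "eventually (\<lambda>t. b t \<ge> c * r ^ t) sequentially"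
    and sm: "\<And>x. 0 \<le> x \<Longrightarrow> x < 1 / r \<Longrightarrow> summable (\<lambda>j. b j * x ^ j)"
  shows "filterlim (\<lambda>x. \<Sum>j. b j * x ^ j) at_top (at_left (1 / r))"
  unfolding filterlim_at_top
proof
  fix Z :: real
  obtain J where J: "\<And>j. j \<ge> J \<Longrightarrow> b j \<ge> c * r ^ j"
    using ge by (auto simp: eventually_sequentially)
  obtain n :: nat where n: "real n > Z / c" using reals_Archimedean2 by blast
  define f where "f x = (\<Sum>j=J..<J+n. c * (r * x) ^ j)" for x
  have "f (1 / r) > Z"
    using r n c by (simp add: f_def field_simps)
  moreover have "(f \<longlongrightarrow> f (1 / r)) (at_left (1 / r))"
    unfolding f_def by (intro tendsto_intros)
  ultimately have "eventually (\<lambda>x. f x > Z) (at_left (1 / r))" by (intro order_tendstoD(1))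
  moreover have "eventually (\<lambda>x. x \<in> {0<..<1/r}) (at_left (1 / r))"
    using r by (intro eventually_at_left_real) auto
  ultimately show "eventually (\<lambda>x. Z \<le> (\<Sum>j. b j * x ^ j)) (at_left (1 / r))"
  proof eventually_elim
    case (elim x)
    have "f x \<le> (\<Sum>j=J..<J+n. b j * x ^ j)"
      unfolding f_def
    proof (rule sum_mono)
      fix j assume "j \<in> {J..<J+n}"
      then have "c * r ^ j * x ^ j \<le> b j * x ^ j" using J elim by (intro mult_right_mono) auto
      then show "c * (r * x) ^ j \<le> b j * x ^ j" by (simp add: power_mult_distrib mult_ac)
    qed
    also have "\<dots> \<le> (\<Sum>j. b j * x ^ j)"
      using elim pos by (intro sum_le_suminf sm) auto
    finally show ?case using elim by simp
  qed
qed

text \<open>At the point \<open>x\<close> the numbers \<open>l j * x ^ j\<close> form a probability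
  distribution. The series is a polynomial or diverges at its radius, so \<open>x\<close> lies
  strictly inside the disc of convergence; the margin up to \<open>K\<close> will give a finite
  mean.\<close>

lemma powser_attains_1:
  fixes l :: "nat \<Rightarrow> real"
  assumes pos: "\<And>j. l j \<ge> 0" and l0: "l 0 = 0" and l1: "l 1 > 0"
    and fin: "(\<exists>t0. \<forall>t\<ge>t0. l t = 0) \<or> (\<exists>k r C. C > 0 \<and> growth l k r C)"
  obtains x K where "0 < x" "x < K" "summable (\<lambda>j. l j * K ^ j)" "(\<lambda>j. l j * x ^ j) sums 1"
proof -
  have "\<exists>x1 K. 0 < x1 \<and> x1 < K \<and> summable (\<lambda>j. l j * K ^ j) \<and> (\<Sum>j. l j * x1 ^ j) \<ge> 1"
    using fin
  proof
    assume "\<exists>t0. \<forall>t\<ge>t0. l t = 0"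
    then obtain t0 where t0: "\<And>t. t \<ge> t0 \<Longrightarrow> l t = 0" by blast
    have sm: "summable (\<lambda>j. l j * x ^ j)" for x
      using t0 by (intro summable_finite[of "{..<t0}"]) (auto simp: not_less)
    \<comment> \<open>At \<open>1 / l 1\<close> the linear term alone contributes 1.\<close>
    have "(\<Sum>j\<in>{1}. l j * (1 / l 1) ^ j) \<le> (\<Sum>j. l j * (1 / l 1) ^ j)"
      using pos l1 by (intro sum_le_suminf sm) auto
    then have "1 \<le> (\<Sum>j. l j * (1 / l 1) ^ j)" "0 < 1 / l 1" "1 / l 1 < 1 / l 1 + 1" using l1 by simp_all
    then show ?thesis using sm by blast
  next
    assume "\<exists>k r C. C > 0 \<and> growth l k r C"
    then obtain k r C where C: "C > 0" and g: "growth l k r C" by blast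
    have r: "r > 0" using g by (simp add: growth_def)
    have sm: "summable (\<lambda>j. l j * x ^ j)" if "0 \<le> x" "x < 1 / r" for x
    proof -
      have "r * x < 1" using that r by (simp add: field_simps)
      then show ?thesis using growth_summable[OF g that(1)] pos by simp
    qed
    have "filterlim (\<lambda>x. \<Sum>j. l j * x ^ j) at_top (at_left (1 / r))"
      using C by (intro powser_filterlim_at_top[OF pos r _ growth_eventually_ge[OF g C]] sm) auto
    then have "eventually (\<lambda>x. 1 \<le> (\<Sum>j. l j * x ^ j)) (at_left (1 / r))"
      by (simp add: filterlim_at_top)
    moreover have "eventually (\<lambda>x. x \<in> {0<..<1/r}) (at_left (1 / r))"
      using r by (intro eventually_at_left_real) auto
    ultimately have "eventually (\<lambda>x. 1 \<le> (\<Sum>j. l j * x ^ j) \<and> x \<in> {0<..<1/r}) (at_left (1 / r))"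
      by (rule eventually_conj)
    then obtain x where x: "1 \<le> (\<Sum>j. l j * x ^ j)" "0 < x" "x < 1 / r"
      by (metis (mono_tags, lifting) eventually_happens greaterThanLessThan_iff trivial_limit_at_left_real)
    obtain K where "x < K" "K < 1 / r" using x dense by blast
    then show ?thesis using sm[of K] x by (meson less_imp_le less_trans)
  qed
  then obtain x1 K where x1: "0 < x1" "x1 < K" "summable (\<lambda>j. l j * K ^ j)" "(\<Sum>j. l j * x1 ^ j) \<ge> 1"
    by blast
  define S where "S x = (\<Sum>j. l j * x ^ j)" for x
  have S0: "S 0 = 0" using powser_zero[of l] by (simp add: S_def l0)
  have "isCont S x" if "0 \<le> x" "x \<le> x1" for x
    unfolding S_def using x1 that by (intro isCont_powser[OF x1(3)]) auto
  moreover have "S x1 \<ge> 1" using x1 by (simp add: S_def)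
  ultimately have "\<exists>x\<ge>0. x \<le> x1 \<and> S x = 1"
    using IVT[of S 0 1 x1] S0 x1(1) by auto
  then obtain x where x: "0 \<le> x" "x \<le> x1" "S x = 1" by blast
  have "x \<noteq> 0" using x S0 by auto
  moreover have "summable (\<lambda>j. l j * x ^ j)" using x x1 by (intro powser_inside[OF x1(3)]) auto
  ultimately show ?thesis using x x1 that[of x K] by (auto simp: S_def sums_iff)
qed

section \<open>State elimination\<close>

text \<open>The invariant of state elimination: nonnegativity prevents cancellation of leading
  terms, the growth alternative makes quotients converge, and rationality over \<open>rat\<close>
  makes their limits algebraic.\<close>

definition dominated_fps :: "real fps \<Rightarrow> bool" where
  "dominated_fps F \<longleftrightarrow> fps_rational F \<and> (\<forall>t. F $ t \<ge> 0) \<and>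
     ((\<exists>t0. \<forall>t\<ge>t0. F $ t = 0) \<or> (\<exists>k r C. C > 0 \<and> growth (($) F) k r C))"

section \<open>Closure under sums, products and stars\<close>

lemma dominated_fps_poly:
  assumes "\<And>i. coeff p i \<ge> 0"
  shows "dominated_fps (fps_of_poly (rpoly p))"
proof -
  have "\<forall>t\<ge>Suc (degree p). fps_of_poly (rpoly p) $ t = 0"
    by (auto simp: coeff_eq_0)
  then show ?thesis
    using assms by (auto simp: dominated_fps_def fps_rational_poly)
qed

lemma dominated_fps_const: "dominated_fps (fps_const (real n))"
proof -
  have "dominated_fps (fps_of_poly (rpoly [:of_nat n:]))"
    by (rule dominated_fps_poly) (simp add: coeff_pCons split: nat.split)
  moreover have "rpoly [:of_nat n:] = [:real n:]"
    by (simp add: rpoly_def map_poly_pCons)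
  ultimately show ?thesis by (simp add: fps_of_poly_const)
qed

lemma dominated_fps_const_X: "dominated_fps (fps_const (real n) * fps_X)"
proof -
  have "dominated_fps (fps_of_poly (rpoly [:0, of_nat n:]))"
    by (rule dominated_fps_poly) (simp add: coeff_pCons split: nat.split)
  moreover have "rpoly [:0, of_nat n:] = [:0, real n:]"
    by (simp add: rpoly_def map_poly_pCons)
  moreover have "fps_of_poly [:0, real n:] = fps_const (real n) * fps_X"
    by (simp add: fps_of_poly_pCons fps_of_poly_const)
  ultimately show ?thesis by simp
qed

lemma dominated_fps_0: "dominated_fps 0"
  using dominated_fps_const[of 0] by simp

lemma growth_add_dominant:
  assumes "growth a k r C" "C > 0" "growth b k' r' D" "D > 0"
  shows "\<exists>k r C. C > 0 \<and> growth (\<lambda>t. a t + b t) k r C"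
proof -
  have r: "r > 0" "r' > 0" using assms by (auto simp: growth_def)
  consider "r = r'" "k = k'" | "r < r' \<or> r = r' \<and> k < k'" | "r' < r \<or> r' = r \<and> k' < k" by linarith
  then show ?thesis
  proof cases
    case 1
    then show ?thesis using growth_add[of a k r C b D] assms by (metis add_pos_pos)
  next
    case 2
    then have "growth a k' r' 0" using growth_dominated[OF assms(1)] r by blast
    then show ?thesis using growth_add[OF _ assms(3)] assms by fastforce
  next
    case 3
    then have "growth b k r 0" using growth_dominated[OF assms(3)] r by blast
    then show ?thesis using growth_add[OF assms(1)] assms by fastforce
  qed
qed

lemma dominated_fps_add:
  assumes "dominated_fps F" "dominated_fps G"
  shows "dominated_fps (F + G)"
proof -
  have aux: "\<exists>k r C. C > 0 \<and> growth (\<lambda>t. F $ t + G $ t) k r C"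
    if "\<forall>t\<ge>t0. F $ t = 0" "C > 0" "growth (($) G) k r C" for F G :: "real fps" and t0 k r C
  proof -
    have "eventually (\<lambda>t. G $ t = F $ t + G $ t) sequentially"
      using that(1) by (auto simp: eventually_sequentially)
    then have "growth (\<lambda>t. F $ t + G $ t) k r C" by (rule growth_cong[OF that(3)])
    then show ?thesis using that(2) by blast
  qed
  have plus: "($) (F + G) = (\<lambda>t. F $ t + G $ t)" by (simp add: fun_eq_iff)
  have "(\<exists>t0. \<forall>t\<ge>t0. (F + G) $ t = 0) \<or> (\<exists>k r C. C > 0 \<and> growth (($) (F + G)) k r C)"
  proof -
    consider t0 t1 where "\<forall>t\<ge>t0. F $ t = 0" "\<forall>t\<ge>t1. G $ t = 0"
      | t0 k r C where "\<forall>t\<ge>t0. F $ t = 0" "C > 0" "growth (($) G) k r C"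
      | t0 k r C where "\<forall>t\<ge>t0. G $ t = 0" "C > 0" "growth (($) F) k r C"
      | k r C k' r' C' where "C > 0" "growth (($) F) k r C" "C' > 0" "growth (($) G) k' r' C'"
      using assms unfolding dominated_fps_def by blast
    then show ?thesis
    proof cases
      case 1
      then have "\<forall>t\<ge>max t0 t1. (F + G) $ t = 0" by simp
      then show ?thesis by blast
    next
      case 2
      then show ?thesis unfolding plus using aux[OF 2] by blast
    next
      case 3
      then show ?thesis unfolding plus using aux[OF 3] by (simp only: add.commute) blast
    next
      case 4
      then show ?thesis unfolding plus using growth_add_dominant[OF 4(2,1,4,3)] by blast
    qed
  qed
  then show ?thesis using assms fps_rational_add by (auto simp: dominated_fps_def)
qed

lemma growth_mult_summable:
  assumes F: "growth (($) F) k r C" "C > 0"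
    and G: "\<And>t. G $ t \<ge> 0" "G \<noteq> 0" "summable (\<lambda>j. \<bar>G $ j\<bar> / r ^ j)"
  shows "\<exists>k r C. C > 0 \<and> growth (($) (G * F)) k r C"
proof -
  have r: "r > 0" using F by (simp add: growth_def)
  obtain j where "G $ j \<noteq> 0" using G(2) by (auto simp: fps_eq_iff)
  then have "G $ j / r ^ j > 0" using G(1)[of j] r by simp
  then have "(\<Sum>j. G $ j / r ^ j) > 0"
    using G r by (intro suminf_pos2[where i = j]) auto
  moreover have "growth (\<lambda>t. \<Sum>j\<le>t. G $ j * F $ (t - j)) k r (C * (\<Sum>j. G $ j / r ^ j))"
    by (rule growth_convolution_summable[OF F(1) G(3)])
  moreover have "(\<lambda>t. \<Sum>j\<le>t. G $ j * F $ (t - j)) = ($) (G * F)"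
    by (simp add: fun_eq_iff fps_mult_nth atLeast0AtMost)
  ultimately show ?thesis using F(2) by (metis mult_pos_pos)
qed

lemma dominated_fps_mult:
  assumes "dominated_fps F" "dominated_fps G"
  shows "dominated_fps (F * G)"
proof -
  have nn: "F $ t \<ge> 0" "G $ t \<ge> 0" for t using assms by (auto simp: dominated_fps_def)
  have fin: "summable (\<lambda>j. \<bar>H $ j\<bar> / r ^ j)" if "\<forall>t\<ge>t0. H $ t = 0" for H :: "real fps" and t0 r
    using that by (intro summable_finite[of "{..<t0}"]) (auto simp: not_less)
  have less: "summable (\<lambda>j. \<bar>H $ j\<bar> / r ^ j)" if "growth (($) H) k r' C" "r' < r" for H k r' C and r :: real
  proof -
    have "r' > 0" using that by (simp add: growth_def)
    then have "summable (\<lambda>j. \<bar>H $ j\<bar> * (1 / r) ^ j)"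
      using that by (intro growth_summable[OF that(1)]) auto
    then show ?thesis by (simp add: power_divide)
  qed
  have "(\<exists>t0. \<forall>t\<ge>t0. (F * G) $ t = 0) \<or> (\<exists>k r C. C > 0 \<and> growth (($) (F * G)) k r C)"
  proof (cases "F = 0 \<or> G = 0")
    case True
    then show ?thesis by auto
  next
    case False
    consider t0 t1 where "\<forall>t\<ge>t0. F $ t = 0" "\<forall>t\<ge>t1. G $ t = 0"
      | t0 k r C where "\<forall>t\<ge>t0. F $ t = 0" "C > 0" "growth (($) G) k r C"
      | t0 k r C where "\<forall>t\<ge>t0. G $ t = 0" "C > 0" "growth (($) F) k r C"
      | k r C k' r' C' where "C > 0" "growth (($) F) k r C" "C' > 0" "growth (($) G) k' r' C'"
      using assms unfolding dominated_fps_def by blast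
    then show ?thesis
    proof cases
      case 1
      have "(F * G) $ t = 0" if "t \<ge> t0 + t1" for t
        unfolding fps_mult_nth
      proof (rule sum.neutral, rule ballI)
        fix i
        have "i \<ge> t0 \<or> t - i \<ge> t1" using that by linarith
        then show "F $ i * G $ (t - i) = 0" using 1 by auto
      qed
      then show ?thesis by blast
    next
      case 2
      then show ?thesis using growth_mult_summable[OF 2(3,2) nn(1) _ fin[OF 2(1)]] False by blast
    next
      case 3
      then show ?thesis using growth_mult_summable[OF 3(3,2) nn(2) _ fin[OF 3(1)]] False by (simp add: mult.commute)
    next
      case 4
      \<comment> \<open>For equal rates the pole orders add up; otherwise the series of smaller rate
        converges at the radius of the other one.\<close>
      consider "r = r'" | "r < r'" | "r' < r" by linarith
      then show ?thesis
      proof cases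
        case 1
        have "growth (\<lambda>t. \<Sum>j\<le>t. F $ j * G $ (t - j)) (Suc (k + k')) r (C * C')"
          using 4 1 by (intro growth_convolution_equal) auto
        moreover have "(\<lambda>t. \<Sum>j\<le>t. F $ j * G $ (t - j)) = ($) (F * G)"
          by (simp add: fun_eq_iff fps_mult_nth atLeast0AtMost)
        ultimately show ?thesis using 4 by (metis mult_pos_pos)
      next
        case 2
        then show ?thesis using growth_mult_summable[OF 4(4,3) nn(1) _ less[OF 4(2)]] False by blast
      next
        case 3
        then show ?thesis using growth_mult_summable[OF 4(2,1) nn(2) _ less[OF 4(4)]] False by (simp add: mult.commute)
      qed
    qed
  qed
  moreover have "(F * G) $ t \<ge> 0" for t
    unfolding fps_mult_nth by (intro sum_nonneg mult_nonneg_nonneg nn)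
  ultimately show ?thesis using assms fps_rational_mult by (auto simp: dominated_fps_def)
qed

text \<open>The coefficients of the star satisfy the renewal equation of \<open>L\<close>. Rescaled
  by the root \<open>x\<close> of \<open>L = 1\<close> it becomes a probabilistic one, so
  \<open>T\<close> has the pure rate \<open>(1 / x) ^ t\<close> with \<open>k = 0\<close>. The
  condition on \<open>L $ 1\<close> supplies aperiodicity.\<close>

lemma dominated_fps_star:
  assumes L: "dominated_fps L" and L0: "L $ 0 = 0" and L1: "L = 0 \<or> L $ 1 > 0" and T: "T * (1 - L) = 1"
  shows "dominated_fps T"
proof (cases "L = 0")
  case True
  then show ?thesis using T dominated_fps_const[of 1] by simp
next
  case False
  have nn: "L $ t \<ge> 0" for t using L by (simp add: dominated_fps_def)
  have "T = 1 + L * T" using T by (simp add: algebra_simps)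
  then have Trec: "T $ t = (1 + L * T) $ t" for t by simp
  have T0: "T $ 0 = 1" using Trec[of 0] by (simp add: L0)
  have TSuc: "T $ Suc t = (\<Sum>j\<le>Suc t. L $ j * T $ (Suc t - j))" for t
    using Trec[of "Suc t"] by (simp add: fps_mult_nth atLeast0AtMost del: sum.atMost_Suc)
  have Tnn: "T $ t \<ge> 0" for t
  proof (induction t rule: less_induct)
    case (less t)
    show ?case
    proof (cases t)
      case (Suc m)
      have "0 \<le> L $ j * T $ (Suc m - j)" for j
        using less.IH[of "Suc m - j"] Suc nn[of j] L0 by (cases j) auto
      then show ?thesis by (simp add: Suc TSuc sum_nonneg del: sum.atMost_Suc)
    qed (simp add: T0)
  qed
  have "L $ 1 > 0" using L1 False by simp
  moreover have "(\<exists>t0. \<forall>t\<ge>t0. L $ t = 0) \<or> (\<exists>k r C. C > 0 \<and> growth (($) L) k r C)"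
    using L by (simp add: dominated_fps_def)
  ultimately obtain x K where x: "0 < x" "x < K" "summable (\<lambda>j. L $ j * K ^ j)" "(\<lambda>j. L $ j * x ^ j) sums 1"
    by (rule powser_attains_1[of "($) L", OF nn L0]) (rule that, assumption+)
  \<comment> \<open>The mean is \<open>x\<close> times the derivative of the loop series at
    \<open>x\<close>, which converges because \<open>x < K\<close>.\<close>
  have "summable (\<lambda>n. diffs (($) L) n * x ^ n)"
  proof (rule termdiff_converges)
    show "norm x < K" using x by simp
    show "summable (\<lambda>n. L $ n * y ^ n)" if "norm y < K" for y
      using x that by (intro powser_inside[OF x(3)]) auto
  qed
  then have "summable (\<lambda>n. diffs (($) L) n * x ^ n * x)" by (rule summable_mult2)
  moreover have "diffs (($) L) n * x ^ n * x = real (Suc n) * (L $ Suc n * x ^ Suc n)" for n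
    by (simp add: diffs_def)
  ultimately have "summable (\<lambda>n. real (Suc n) * (L $ Suc n * x ^ Suc n))" by simp
  then have mean: "summable (\<lambda>n. real n * (L $ n * x ^ n))"
    using summable_Suc_iff[of "\<lambda>n. real n * (L $ n * x ^ n)"] by simp
  have "\<exists>c>0. (\<lambda>t. T $ t * x ^ t) \<longlonglongrightarrow> c"
  proof (rule renewal_theorem[where p = "\<lambda>j. L $ j * x ^ j"])
    show "T $ Suc t * x ^ Suc t = (\<Sum>j\<le>Suc t. L $ j * x ^ j * (T $ (Suc t - j) * x ^ (Suc t - j)))" for t
      unfolding TSuc sum_distrib_right
    proof (rule sum.cong)
      fix j assume "j \<in> {..Suc t}"
      then have "x ^ Suc t = x ^ j * x ^ (Suc t - j)" by (simp flip: power_add)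
      then show "L $ j * T $ (Suc t - j) * x ^ Suc t = L $ j * x ^ j * (T $ (Suc t - j) * x ^ (Suc t - j))"
        by (simp only: mult_ac)
    qed simp
  qed (use x nn L0 \<open>L $ 1 > 0\<close> mean T0 in auto)
  then obtain c where c: "c > 0" "(\<lambda>t. T $ t * x ^ t) \<longlonglongrightarrow> c" by blast
  then have "growth (($) T) 0 (1 / x) c"
    using x by (simp add: growth_def power_divide)
  then show ?thesis
    using c Tnn fps_rational_star[OF _ L0 T] L by (auto simp: dominated_fps_def)
qed

text \<open>\<open>kleene M cs d e\<close> is the generating function of the weighted nonempty paths
  from \<open>d\<close> to \<open>e\<close> with all intermediate vertices in \<open>cs\<close>, by state elimination.\<close>

fun kleene :: "('a \<Rightarrow> 'a \<Rightarrow> nat) \<Rightarrow> 'a list \<Rightarrow> 'a \<Rightarrow> 'a \<Rightarrow> real fps" where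
  "kleene M [] d e = fps_const (real (M d e)) * fps_X"
| "kleene M (c # cs) d e =
     kleene M cs d e + kleene M cs d c * inverse (1 - kleene M cs c c) * kleene M cs c e"

lemma kleene_nth_0 [simp]: "kleene M cs d e $ 0 = 0"
  by (induction cs arbitrary: d e) simp_all

lemma kleene_star: "inverse (1 - kleene M cs c c) * (1 - kleene M cs c c) = 1"
  by (rule inverse_mult_eq_1) simp

text \<open>Paths decomposed at their first edge, whereas the recursion splits them at their visits
  to the eliminated state. This is the form that matches a linear recurrence.\<close>

lemma kleene_step:
  assumes "distinct cs"
  shows "kleene M cs d e = fps_const (real (M d e)) * fps_X
    + (\<Sum>f\<in>set cs. fps_const (real (M d f)) * fps_X * kleene M cs f e)"
  using assms
proof (induction cs arbitrary: d e)
  case (Cons c cs)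
  define K where "K = kleene M cs"
  define T where "T = inverse (1 - K c c)"
  define m where "m f = fps_const (real (M d f)) * fps_X" for f
  have T: "T * (1 - K c c) = 1" unfolding T_def K_def by (rule kleene_star)
  have IH: "K d e = m e + (\<Sum>f\<in>set cs. m f * K f e)" for e
    unfolding K_def m_def by (rule Cons.IH) (use Cons.prems in simp)
  \<comment> \<open>The star absorbs one further loop: \<open>1 + K c c * T = T\<close>.\<close>
  have "kleene M (c # cs) c e = (1 + K c c * T) * K c e"
    by (simp add: K_def T_def algebra_simps)
  also have "1 + K c c * T = T * (1 - K c c) + K c c * T" by (simp only: T)
  also have "\<dots> = T" by (simp add: algebra_simps)
  finally have c: "kleene M (c # cs) c e = T * K c e" .
  have f: "kleene M (c # cs) f e = K f e + K f c * T * K c e" for f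
    by (simp add: K_def T_def)
  have cc: "K c e + K c c * T * K c e = T * K c e" using c f[of c] by simp
  have "m e + (\<Sum>f\<in>set (c # cs). m f * kleene M (c # cs) f e)
      = m e + m c * (T * K c e) + (\<Sum>f\<in>set cs. m f * (K f e + K f c * T * K c e))"
    using Cons.prems by (simp add: f cc add.assoc del: kleene.simps)
  also have "\<dots> = (m e + (\<Sum>f\<in>set cs. m f * K f e)) + (m c + (\<Sum>f\<in>set cs. m f * K f c)) * (T * K c e)"
    by (simp add: algebra_simps sum.distrib sum_distrib_left)
  also have "\<dots> = kleene M (c # cs) d e"
    by (simp add: IH[symmetric] f mult.assoc del: kleene.simps)
  finally show ?case by (simp only: m_def)
qed simp

definition transitive_support :: "('a \<Rightarrow> 'a \<Rightarrow> nat) \<Rightarrow> 'a set \<Rightarrow> bool" where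
  "transitive_support M S \<longleftrightarrow> (\<forall>d\<in>S. \<forall>e\<in>S. \<forall>f\<in>S. M d e > 0 \<longrightarrow> M e f > 0 \<longrightarrow> M d f > 0)"

text \<open>A nonzero series has a path, which transitivity shortens to an edge. For
  \<open>d = e\<close> this is the loop that makes the renewal equation at \<open>d\<close>
  aperiodic.\<close>

lemma kleene_nonzero:
  assumes trans: "transitive_support M S"
    and "set cs \<subseteq> S" "d \<in> S" "e \<in> S" "kleene M cs d e \<noteq> 0"
  shows "M d e > 0"
  using assms(2-)
proof (induction cs arbitrary: d e)
  case Nil
  then show ?case by auto
next
  case (Cons c cs)
  have "kleene M cs d e \<noteq> 0 \<or> (kleene M cs d c \<noteq> 0 \<and> kleene M cs c e \<noteq> 0)"
    using Cons.prems by auto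
  then show ?case using Cons.IH Cons.prems(1-3) trans unfolding transitive_support_def by (metis insert_subset list.simps(15))
qed

text \<open>The bound on the coefficient at 1 is carried through the induction so that the loop at
  \<open>c\<close> remains visible in the series that gets starred.\<close>

lemma dominated_fps_kleene:
  assumes trans: "transitive_support M S"
    and "set cs \<subseteq> S" "d \<in> S" "e \<in> S"
  shows "dominated_fps (kleene M cs d e) \<and> kleene M cs d e $ 1 \<ge> real (M d e)"
  using assms(2-)
proof (induction cs arbitrary: d e)
  case Nil
  then show ?case by (simp add: dominated_fps_const_X)
next
  case (Cons c cs)
  define L where "L = kleene M cs c c"
  have IH: "dominated_fps (kleene M cs f g) \<and> kleene M cs f g $ 1 \<ge> real (M f g)" if "f \<in> S" "g \<in> S" for f g
    using Cons that by auto
  have c: "c \<in> S" using Cons.prems by simp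
  have L1: "L = 0 \<or> L $ 1 > 0"
  proof (rule disjCI)
    assume "\<not> L $ 1 > 0"
    then have "\<not> M c c > 0" using IH[OF c c] by (simp add: L_def)
    then show "L = 0" using kleene_nonzero[OF trans, of cs c c] Cons.prems by (auto simp: L_def)
  qed
  have L: "dominated_fps L" "L $ 0 = 0" using IH[OF c c] by (simp_all add: L_def)
  have "inverse (1 - L) * (1 - L) = 1" unfolding L_def by (rule kleene_star)
  then have "dominated_fps (inverse (1 - L))" by (rule dominated_fps_star[OF L L1])
  then have "dominated_fps (kleene M cs d c * inverse (1 - L) * kleene M cs c e)"
    using IH Cons.prems c by (intro dominated_fps_mult) auto
  then show ?case
    using IH[OF Cons.prems(2,3)] dominated_fps_add by (fastforce simp: L_def dominated_fps_def)
qed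

lemma dominated_fps_sum:
  "finite A \<Longrightarrow> (\<And>x. x \<in> A \<Longrightarrow> dominated_fps (f x)) \<Longrightarrow> dominated_fps (sum f A)"
  by (induction A rule: finite_induct) (auto simp: dominated_fps_0 intro: dominated_fps_add)

lemma dominated_fps_linear_system:
  fixes v :: "nat \<Rightarrow> 'a \<Rightarrow> nat"
  assumes S: "finite S"
    and trans: "transitive_support M S"
    and rec: "\<And>t d. d \<in> S \<Longrightarrow> v (Suc t) d = (\<Sum>e\<in>S. M d e * v t e)"
    and d: "d \<in> S"
  shows "dominated_fps (Abs_fps (\<lambda>t. real (v t d)))"
proof -
  obtain cs where cs: "distinct cs" "set cs = S" using finite_distinct_list[OF S] by blast
  define K where "K = kleene M cs"
  define u where "u e = fps_const (real (v 0 e))" for e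
  \<comment> \<open>The sum over all paths from \<open>d\<close>, the empty one included, weighted
    by the initial value at the final vertex.\<close>
  define G where "G d = u d + (\<Sum>e\<in>S. K d e * u e)" for d
  have K: "K d e = fps_const (real (M d e)) * fps_X + (\<Sum>f\<in>S. fps_const (real (M d f)) * fps_X * K f e)" for d e
    unfolding K_def cs(2)[symmetric] by (rule kleene_step[OF cs(1)])
  have G: "G d = u d + fps_X * (\<Sum>f\<in>S. fps_const (real (M d f)) * G f)" for d
  proof -
    have "(\<Sum>e\<in>S. K d e * u e) = (\<Sum>e\<in>S. fps_const (real (M d e)) * fps_X * u e)
        + (\<Sum>e\<in>S. \<Sum>f\<in>S. fps_const (real (M d f)) * fps_X * K f e * u e)"
      by (subst K) (simp add: algebra_simps sum.distrib sum_distrib_left)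
    also have "(\<Sum>e\<in>S. \<Sum>f\<in>S. fps_const (real (M d f)) * fps_X * K f e * u e)
        = (\<Sum>f\<in>S. \<Sum>e\<in>S. fps_const (real (M d f)) * fps_X * K f e * u e)"
      by (rule sum.swap)
    also have "(\<Sum>e\<in>S. fps_const (real (M d e)) * fps_X * u e) + \<dots>
        = fps_X * (\<Sum>f\<in>S. fps_const (real (M d f)) * G f)"
      by (simp add: G_def algebra_simps sum.distrib sum_distrib_left)
    finally show ?thesis by (simp add: G_def[of d])
  qed
  have "G d $ t = real (v t d)" if "d \<in> S" for t d
    using that
  proof (induction t arbitrary: d)
    case 0
    show ?case by (simp add: G[of d] u_def)
  next
    case (Suc t)
    have "G d $ Suc t = (\<Sum>f\<in>S. real (M d f) * G f $ t)"
      by (subst G) (simp add: u_def fps_sum_nth)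
    then show ?case using Suc by (simp add: rec)
  qed
  then have "Abs_fps (\<lambda>t. real (v t d)) = G d" using d by (simp add: fps_eq_iff)
  moreover have "dominated_fps (K e f)" if "e \<in> S" "f \<in> S" for e f
    using dominated_fps_kleene[OF trans, of cs] cs that by (auto simp: K_def)
  ultimately show ?thesis
    using d S by (auto simp: G_def u_def intro!: dominated_fps_add dominated_fps_sum dominated_fps_mult dominated_fps_const)
qed

section \<open>Quotients of linear recurrences\<close>

text \<open>Because the denominator diverges at \<open>x\<close>, any finite set of terms becomes
  negligible, and the remaining terms have quotients close to \<open>l\<close>.\<close>

lemma abel_ratio:
  fixes a b :: "nat \<Rightarrow> real"
  assumes b: "\<And>t. b t \<ge> 0" and lim: "(\<lambda>t. a t / b t) \<longlonglongrightarrow> l" and ev: "eventually (\<lambda>t. b t > 0) sequentially"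
    and x: "x > 0"
    and sma: "\<And>z. 0 \<le> z \<Longrightarrow> z < x \<Longrightarrow> summable (\<lambda>t. \<bar>a t\<bar> * z ^ t)"
    and smb: "\<And>z. 0 \<le> z \<Longrightarrow> z < x \<Longrightarrow> summable (\<lambda>t. b t * z ^ t)"
    and top: "filterlim (\<lambda>z. \<Sum>t. b t * z ^ t) at_top (at_left x)"
  shows "((\<lambda>z. (\<Sum>t. a t * z ^ t) / (\<Sum>t. b t * z ^ t)) \<longlongrightarrow> l) (at_left x)"
proof (rule tendstoI)
  fix e :: real assume e: "e > 0"
  define B where "B z = (\<Sum>t. b t * z ^ t)" for z
  have "eventually (\<lambda>t. \<bar>a t / b t - l\<bar> < e / 2) sequentially"
    using tendstoD[OF lim, of "e/2"] e by (simp add: dist_real_def)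
  then have "eventually (\<lambda>t. \<bar>a t - l * b t\<bar> \<le> e / 2 * b t) sequentially"
    using ev
  proof eventually_elim
    case (elim t)
    have "\<bar>a t - l * b t\<bar> = \<bar>a t / b t - l\<bar> * b t"
      using elim(2) by (simp add: abs_if field_simps)
    also have "\<dots> \<le> e / 2 * b t" using elim by (intro mult_right_mono) auto
    finally show ?case .
  qed
  then obtain T where T: "\<And>t. t \<ge> T \<Longrightarrow> \<bar>a t - l * b t\<bar> \<le> e / 2 * b t"
    by (auto simp: eventually_sequentially)
  define c where "c = (\<Sum>t<T. \<bar>a t - l * b t\<bar> * x ^ t)"
  have c: "c \<ge> 0" using x by (auto simp: c_def intro!: sum_nonneg)
  \<comment> \<open>Above this threshold \<open>B z\<close> is positive and the contribution
    \<open>c\<close> of the early terms is strictly less than \<open>e / 2 * B z\<close>.\<close>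
  have "eventually (\<lambda>z. B z \<ge> 2 * c / e + 1) (at_left x)"
    using top by (simp add: filterlim_at_top B_def)
  moreover have "eventually (\<lambda>z. z \<in> {0<..<x}) (at_left x)"
    using x by (intro eventually_at_left_real) auto
  ultimately show "eventually (\<lambda>z. dist ((\<Sum>t. a t * z ^ t) / (\<Sum>t. b t * z ^ t)) l < e) (at_left x)"
  proof eventually_elim
    case (elim z)
    have z: "0 \<le> z" "z < x" using elim by auto
    have sa: "summable (\<lambda>t. a t * z ^ t)"
      using sma[OF z] z by (intro summable_rabs_cancel[of "\<lambda>t. a t * z ^ t"]) (simp add: abs_mult)
    have B: "B z > 0" using elim(1) c e by (smt (verit) divide_nonneg_pos)
    have "(\<Sum>t. a t * z ^ t) - l * B z = (\<Sum>t. (a t - l * b t) * z ^ t)"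
      unfolding B_def using sa smb[OF z]
      by (simp add: suminf_mult[symmetric] suminf_diff summable_mult algebra_simps)
    have sd: "summable (\<lambda>t. (a t - l * b t) * z ^ t)"
      using summable_diff[OF sa summable_mult[OF smb[OF z], of l]] by (simp add: algebra_simps)
    define f where "f t = (if t < T then \<bar>a t - l * b t\<bar> * x ^ t else 0)" for t
    have sf: "summable f" by (rule summable_finite[of "{..<T}"]) (auto simp: f_def)
    have sf': "suminf f = c" by (subst suminf_finite[of "{..<T}"]) (auto simp: f_def c_def)
    have le: "\<bar>(a t - l * b t) * z ^ t\<bar> \<le> f t + e / 2 * (b t * z ^ t)" for t
    proof (cases "t < T")
      case True
      have "\<bar>(a t - l * b t) * z ^ t\<bar> \<le> \<bar>a t - l * b t\<bar> * x ^ t"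
        using z by (auto simp: abs_mult intro!: mult_left_mono power_mono)
      moreover have "0 \<le> e / 2 * (b t * z ^ t)" using e z b by simp
      ultimately show ?thesis using True by (simp add: f_def)
    next
      case False
      then have "\<bar>a t - l * b t\<bar> * z ^ t \<le> e / 2 * b t * z ^ t"
        using z T by (intro mult_right_mono) auto
      then show ?thesis using False z by (simp add: f_def abs_mult mult.assoc)
    qed
    have sg: "summable (\<lambda>t. f t + e / 2 * (b t * z ^ t))"
      by (intro summable_add sf summable_mult smb z)
    have sabs: "summable (\<lambda>t. \<bar>(a t - l * b t) * z ^ t\<bar>)"
      by (rule summable_comparison_test'[OF sg, of 0]) (use le in simp)
    have "\<bar>\<Sum>t. (a t - l * b t) * z ^ t\<bar> \<le> (\<Sum>t. \<bar>(a t - l * b t) * z ^ t\<bar>)"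
      by (rule summable_rabs[OF sabs])
    also have "\<dots> \<le> (\<Sum>t. f t + e / 2 * (b t * z ^ t))"
      by (intro suminf_le le sabs sg)
    also have "\<dots> = c + e / 2 * B z"
      unfolding B_def sf'[symmetric]
      using suminf_add[OF sf summable_mult[OF smb[OF z], of "e/2"]] suminf_mult[OF smb[OF z], of "e/2"] by simp
    also have "\<dots> < e * B z"
    proof -
      have "c < e / 2 * B z" using elim(1) e c by (simp add: field_simps)
      then show ?thesis by simp
    qed
    finally have "\<bar>(\<Sum>t. a t * z ^ t) - l * B z\<bar> < e * B z"
      using \<open>(\<Sum>t. a t * z ^ t) - l * B z = _\<close> by simp
    then have "\<bar>((\<Sum>t. a t * z ^ t) - l * B z) / B z\<bar> < e"
      using B by (simp add: field_simps)
    then show ?case using B by (simp add: dist_real_def B_def diff_divide_distrib)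
  qed
qed

text \<open>For images of equal length the left ends are squeezed between multiples of powers of an
  integer; this pins down a rate otherwise known only to be algebraic.\<close>

lemma growth_rate_unique:
  assumes g: "growth b k r C" "C > 0" and m: "m > 0" and c: "c > 0"
    and le: "eventually (\<lambda>t. c * m ^ t \<le> b t \<and> b t \<le> d * m ^ t) sequentially"
  shows "r = m"
proof (rule ccontr)
  have r: "r > 0" using g by (simp add: growth_def)
  assume "r \<noteq> m"
  then consider "r < m" | "m < r" by linarith
  then show False
  proof cases
    case 1
    then have "growth b 0 m 0" using growth_dominated[OF g(1) m] by blast
    then have "(\<lambda>t. b t / m ^ t) \<longlonglongrightarrow> 0" by (simp add: growth_def)
    moreover have "eventually (\<lambda>t. c \<le> b t / m ^ t) sequentially"
      using le by eventually_elim (use m in \<open>simp add: field_simps\<close>)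
    ultimately have "c \<le> 0" by (intro tendsto_lowerbound) auto
    then show False using c by simp
  next
    case 2
    have "growth (\<lambda>t. d * m ^ t) 0 m d" using m by (simp add: growth_def)
    then have "growth (\<lambda>t. d * m ^ t) k r 0"
    proof (rule growth_dominated)
    qed (use 2 r in auto)
    then have "(\<lambda>t. d * m ^ t / (rising k t * r ^ t)) \<longlonglongrightarrow> 0" by (simp add: growth_def)
    moreover have "(\<lambda>t. b t / (rising k t * r ^ t)) \<longlonglongrightarrow> C" using g by (simp add: growth_def)
    moreover have "eventually (\<lambda>t. b t / (rising k t * r ^ t) \<le> d * m ^ t / (rising k t * r ^ t)) sequentially"
      using le by eventually_elim (use r in \<open>auto intro!: divide_right_mono\<close>)
    ultimately have "C \<le> 0" by (intro tendsto_le) auto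
    then show False using g by simp
  qed
qed

text \<open>Domination by \<open>b\<close> excludes a faster rate, so \<open>a\<close> has a limit
  on the scale of \<open>b\<close>, possibly 0.\<close>

lemma growth_ratio_convergent:
  assumes a: "(\<exists>t0. \<forall>t\<ge>t0. a t = 0) \<or> (\<exists>k r C. C > 0 \<and> growth a k r C)"
    and b: "growth b k r C" "C > 0" and le: "eventually (\<lambda>t. \<bar>a t\<bar> \<le> K * b t) sequentially"
  obtains l where "growth a k r (l * C)"
  using a
proof
  have r: "r > 0" using b by (simp add: growth_def)
  {
    assume "\<exists>t0. \<forall>t\<ge>t0. a t = 0"
    then obtain t0 where "\<forall>t\<ge>t0. a t = 0" by blast
    then have "eventually (\<lambda>t. 0 = a t) sequentially" by (auto simp: eventually_sequentially)
    then have "growth a k r 0"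
      by (rule growth_cong[rotated]) (use r in \<open>simp add: growth_def\<close>)
    then show thesis using that[of 0] by simp
  }
  assume "\<exists>k r C. C > 0 \<and> growth a k r C"
  then obtain k' r' C' where C': "C' > 0" and g: "growth a k' r' C'" by blast
  have r': "r' > 0" using g by (simp add: growth_def)
  consider "k = k'" "r = r'" | "r' < r \<or> (r' = r \<and> k' < k)" | "r < r' \<or> (r = r' \<and> k < k')" by linarith
  then show thesis
  proof cases
    case 1
    then show thesis using that[of "C' / C"] g b by simp
  next
    case 2
    then have "growth a k r 0" using growth_dominated[OF g r] by blast
    then show thesis using that[of 0] by simp
  next
    case 3
    then have "growth b k' r' 0" using growth_dominated[OF b(1) r'] by blast
    then have "(\<lambda>t. K * (b t / (rising k' t * r' ^ t))) \<longlonglongrightarrow> K * 0"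
      unfolding growth_def by (intro tendsto_mult_left) auto
    moreover have "(\<lambda>t. a t / (rising k' t * r' ^ t)) \<longlonglongrightarrow> C'" using g by (simp add: growth_def)
    moreover have "eventually (\<lambda>t. a t / (rising k' t * r' ^ t) \<le> K * (b t / (rising k' t * r' ^ t))) sequentially"
      using le
    proof eventually_elim
      case (elim t)
      then have "a t \<le> K * b t" by linarith
      then have "a t / (rising k' t * r' ^ t) \<le> K * b t / (rising k' t * r' ^ t)"
        using r' by (intro divide_right_mono) auto
      then show ?case by simp
    qed
    ultimately have "C' \<le> K * 0" by (intro tendsto_le) auto
    then show thesis using C' by simp
  qed
qed

text \<open>The two growth constants are not identified individually. Their quotient
  \<open>l\<close> is the limit at \<open>x = 1 / r\<close> of a quotient of rational functions over
  \<open>rat\<close>, hence the value of a reduced one, and thus lies in the field generated by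
  \<open>x\<close>.\<close>

lemma dominated_fps_ratio:
  assumes F: "dominated_fps F" and G: "dominated_fps G"
    and G0: "\<not> (\<exists>t0. \<forall>t\<ge>t0. G $ t = 0)" and le: "eventually (\<lambda>t. F $ t \<le> K * G $ t) sequentially"
  obtains l where "(\<lambda>t. F $ t / G $ t) \<longlonglongrightarrow> l" "algebraic l"
    "\<And>m c d. m > 0 \<Longrightarrow> m \<in> \<rat> \<Longrightarrow> c > 0 \<Longrightarrow>
       eventually (\<lambda>t. c * m ^ t \<le> G $ t \<and> G $ t \<le> d * m ^ t) sequentially \<Longrightarrow> l \<in> \<rat>"
proof -
  have nn: "F $ t \<ge> 0" "G $ t \<ge> 0" for t using F G by (auto simp: dominated_fps_def)
  obtain k r C where C: "C > 0" and g: "growth (($) G) k r C"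
    using G G0 unfolding dominated_fps_def by blast
  have r: "r > 0" using g by (simp add: growth_def)
  have le': "eventually (\<lambda>t. \<bar>F $ t\<bar> \<le> K * G $ t) sequentially" using le nn by simp
  have aF: "(\<exists>t0. \<forall>t\<ge>t0. F $ t = 0) \<or> (\<exists>k r C. C > 0 \<and> growth (($) F) k r C)"
    using F by (simp add: dominated_fps_def)
  obtain l where l: "growth (($) F) k r (l * C)"
    by (rule growth_ratio_convergent[of "($) F", OF aF g C le']) (rule that)
  have Gge: "eventually (\<lambda>t. G $ t \<ge> C / 2 * r ^ t) sequentially"
    by (rule growth_eventually_ge[OF g C])
  have Gpos: "eventually (\<lambda>t. G $ t > 0) sequentially"
    using Gge
  proof eventually_elim
    case (elim t)
    have "0 < C / 2 * r ^ t" using C r by simp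
    then show ?case using elim by linarith
  qed
  have lim: "(\<lambda>t. F $ t / G $ t) \<longlonglongrightarrow> l"
  proof -
    have "(\<lambda>t. (F $ t / (rising k t * r ^ t)) / (G $ t / (rising k t * r ^ t))) \<longlonglongrightarrow> l * C / C"
      using l g C by (intro tendsto_divide) (auto simp: growth_def)
    then show ?thesis using r C by simp
  qed
  define x where "x = 1 / r"
  have x: "x > 0" using r by (simp add: x_def)
  have sF: "summable (\<lambda>t. \<bar>F $ t\<bar> * z ^ t)" and sG: "summable (\<lambda>t. \<bar>G $ t\<bar> * z ^ t)" if "0 \<le> z" "z < x" for z
  proof -
    have "r * z < 1" using that r by (simp add: x_def field_simps)
    then show "summable (\<lambda>t. \<bar>F $ t\<bar> * z ^ t)" "summable (\<lambda>t. \<bar>G $ t\<bar> * z ^ t)"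
      using growth_summable[OF l] growth_summable[OF g] that by auto
  qed
  have sG': "summable (\<lambda>t. G $ t * z ^ t)" if "0 \<le> z" "z < x" for z
    using sG[OF that] nn by simp
  have top: "filterlim (\<lambda>z. \<Sum>t. G $ t * z ^ t) at_top (at_left x)"
    unfolding x_def
    by (rule powser_filterlim_at_top[OF nn(2) r _ Gge]) (use C sG' in \<open>auto simp: x_def\<close>)
  have abel: "((\<lambda>z. (\<Sum>t. F $ t * z ^ t) / (\<Sum>t. G $ t * z ^ t)) \<longlongrightarrow> l) (at_left x)"
    by (rule abel_ratio[OF nn(2) lim Gpos x sF sG' top])
  have radius: "ereal (norm z) < fps_conv_radius H"
    if z: "0 \<le> z" "z < x" and H: "\<And>z. 0 \<le> z \<Longrightarrow> z < x \<Longrightarrow> summable (\<lambda>t. \<bar>H $ t\<bar> * z ^ t)" for z and H :: "real fps"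
  proof -
    obtain y where y: "z < y" "y < x" using z dense by blast
    have "summable (\<lambda>t. H $ t * y ^ t)"
      using H[of y] y z by (intro summable_rabs_cancel[of "\<lambda>t. H $ t * y ^ t"]) (simp add: abs_mult)
    then have "conv_radius (($) H) \<ge> norm y" by (rule conv_radius_geI)
    moreover have "ereal (norm z) < ereal (norm y)" using y z by simp
    ultimately show ?thesis unfolding fps_conv_radius_def by (rule order.strict_trans2[rotated])
  qed
  have eval: "poly q z * (\<Sum>t. H $ t * z ^ t) = poly p z"
    if "fps_of_poly q * H = fps_of_poly p" "0 \<le> z" "z < x"
       "\<And>z. 0 \<le> z \<Longrightarrow> z < x \<Longrightarrow> summable (\<lambda>t. \<bar>H $ t\<bar> * z ^ t)" for p q :: "real poly" and H z
  proof -
    have "eval_fps (fps_of_poly q * H) z = eval_fps (fps_of_poly q) z * eval_fps H z"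
      using radius[OF that(2-4)] by (intro eval_fps_mult) auto
    then show ?thesis by (simp add: that(1) eval_fps_def[of H])
  qed
  obtain p1 q1 where 1: "q1 \<noteq> 0" "fps_of_poly (rpoly q1) * F = fps_of_poly (rpoly p1)"
    using F by (auto simp: dominated_fps_def fps_rational_def)
  obtain p2 q2 where 2: "q2 \<noteq> 0" "fps_of_poly (rpoly q2) * G = fps_of_poly (rpoly p2)"
    using G by (auto simp: dominated_fps_def fps_rational_def)
  have "G \<noteq> 0" using G0 by auto
  then have "p2 \<noteq> 0" using 2 by (metis fps_of_poly_0 fps_of_poly_eq_iff mult_eq_0_iff rpoly_0 rpoly_eq_0_iff)
  have ev: "eventually (\<lambda>z. z \<in> {0<..<x}) (at_left x)"
    using x by (intro eventually_at_left_real) auto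
  have evG: "eventually (\<lambda>z. (\<Sum>t. G $ t * z ^ t) \<ge> 1) (at_left x)"
    using top by (simp add: filterlim_at_top)
  have "p2 * q1 \<noteq> 0" using 1 \<open>p2 \<noteq> 0\<close> by simp
  moreover have "eventually (\<lambda>z. (\<Sum>t. F $ t * z ^ t) / (\<Sum>t. G $ t * z ^ t) * poly (rpoly (p2 * q1)) z
      = poly (rpoly (p1 * q2)) z) (at_left x)"
    using ev evG
  proof eventually_elim
    case (elim z)
    have e1: "poly (rpoly q1) z * (\<Sum>t. F $ t * z ^ t) = poly (rpoly p1) z"
      using elim sF by (intro eval[OF 1(2)]) auto
    have e2: "poly (rpoly q2) z * (\<Sum>t. G $ t * z ^ t) = poly (rpoly p2) z"
      using elim sG by (intro eval[OF 2(2)]) auto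
    show ?case using elim(2) by (simp add: rpoly_mult e1[symmetric] e2[symmetric])
  qed
  ultimately obtain U V where UV: "poly (rpoly V) x \<noteq> 0" "l = poly (rpoly U) x / poly (rpoly V) x"
    by (rule rational_function_limit[OF _ abel]) (rule that, assumption+)
  \<comment> \<open>\<open>q2 * G = p2\<close> stays bounded near \<open>x\<close> while
    \<open>G\<close> diverges.\<close>
  have "poly (rpoly q2) x = 0"
  proof (rule tendsto_unique[OF trivial_limit_at_left_real])
    show "(poly (rpoly q2) \<longlongrightarrow> poly (rpoly q2) x) (at_left x)" by (intro tendsto_intros)
    have p2: "((\<lambda>z. poly (rpoly p2) z) \<longlongrightarrow> poly (rpoly p2) x) (at_left x)"
      by (intro tendsto_intros)
    have "((\<lambda>z. poly (rpoly p2) z / (\<Sum>t. G $ t * z ^ t)) \<longlongrightarrow> 0) (at_left x)"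
      by (rule tendsto_divide_0[OF p2 filterlim_at_top_imp_at_infinity[OF top]])
    moreover have "eventually (\<lambda>z. poly (rpoly p2) z / (\<Sum>t. G $ t * z ^ t) = poly (rpoly q2) z) (at_left x)"
      using ev evG
    proof eventually_elim
      case (elim z)
      have "poly (rpoly q2) z * (\<Sum>t. G $ t * z ^ t) = poly (rpoly p2) z"
        using elim sG by (intro eval[OF 2(2)]) auto
      then show ?case using elim(2) by (simp add: field_simps)
    qed
    ultimately show "(poly (rpoly q2) \<longlongrightarrow> 0) (at_left x)" by (rule Lim_transform_eventually)
  qed
  then have "algebraic x" using 2(1) by (auto simp: algebraic_rpoly_iff)
  then have "algebraic l" using UV algebraic_rational_function by simp
  moreover have "l \<in> \<rat>" if "m > 0" "m \<in> \<rat>" "c > 0"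
    "eventually (\<lambda>t. c * m ^ t \<le> G $ t \<and> G $ t \<le> d * m ^ t) sequentially" for m c d
  proof -
    have "r = m" by (rule growth_rate_unique[OF g C that(1,3,4)])
    then have "x \<in> \<rat>" using that(2) by (simp add: x_def)
    then obtain y where "x = of_rat y" by (meson Rats_cases)
    then show ?thesis by (simp add: UV(2) poly_rpoly_of_rat flip: of_rat_divide)
  qed
  ultimately show ?thesis using that lim by blast
qed

text \<open>Pigeonhole principle for a deterministic sequence, used both for supports of matrix
  powers and for the data attached to iterated images of letters.\<close>

lemma eventually_periodic_power:
  fixes X :: "nat \<Rightarrow> 'b"
  assumes fin: "finite (range X)" and det: "\<And>i j. X i = X j \<Longrightarrow> X (Suc i) = X (Suc j)"
  obtains q where "q \<ge> 1" "\<And>k. k \<ge> 1 \<Longrightarrow> X (k * q) = X q"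
proof -
  have "\<not> inj X" using fin finite_imageD by blast
  then obtain i' j' where "i' \<noteq> j'" "X i' = X j'" by (auto simp: inj_def)
  then have *: "min i' j' < max i' j'" "X (min i' j') = X (max i' j')" by (auto simp: min_def max_def)
  obtain d where d: "0 < d" "min i' j' + d = max i' j'" using less_imp_add_positive[OF *(1)] by blast
  define i where "i = min i' j'"
  have ij: "0 < d" "X i = X (i + d)" using * d by (simp_all add: i_def)
  have shift: "X (i + n) = X (i + d + n)" for n
  proof (induction n)
    case (Suc n)
    then show ?case using det[of "i + n" "i + d + n"] by simp
  qed (use ij in simp)
  have per: "X (n + k * d) = X n" if "n \<ge> i" for n k
  proof (induction k)
    case (Suc k)
    have "X (n + Suc k * d) = X (i + d + (n - i + k * d))"
      using that by (intro arg_cong[where f = X]) simp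
    also have "\<dots> = X (i + (n - i + k * d))" by (rule shift[symmetric])
    also have "\<dots> = X (n + k * d)" using that by simp
    finally show ?case using Suc by simp
  qed simp
  \<comment> \<open>A multiple of the period \<open>d\<close> beyond the preperiod \<open>i\<close>:
    its positive multiples differ from it by multiples of \<open>d\<close>.\<close>
  define q where "q = Suc i * d"
  have q: "q \<ge> Suc i * 1" unfolding q_def using ij by (intro mult_le_mono) auto
  moreover have "X (k * q) = X q" if "k \<ge> 1" for k
  proof -
    have "k * q = q + ((k - 1) * Suc i) * d"
      using that by (cases k) (simp_all add: q_def algebra_simps)
    then show ?thesis using per[of q "(k - 1) * Suc i"] q by simp
  qed
  ultimately show ?thesis using that[of q] by simp
qed

section \<open>Powers of nonnegative matrices\<close>

fun mpow :: "('a \<Rightarrow> 'a \<Rightarrow> nat) \<Rightarrow> 'a set \<Rightarrow> nat \<Rightarrow> 'a \<Rightarrow> 'a \<Rightarrow> nat" where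
  "mpow M S 0 d e = of_bool (d = e)"
| "mpow M S (Suc n) d e = (\<Sum>f\<in>S. M d f * mpow M S n f e)"

lemma mpow_add:
  assumes "finite S" "d \<in> S"
  shows "mpow M S (m + n) d e = (\<Sum>f\<in>S. mpow M S m d f * mpow M S n f e)"
  using assms(2)
proof (induction m arbitrary: d)
  case 0
  then show ?case using assms(1) by (simp add: of_bool_def if_distrib[of "\<lambda>x. x * _"] cong: if_cong)
next
  case (Suc m)
  have "mpow M S (Suc m + n) d e = (\<Sum>g\<in>S. \<Sum>f\<in>S. M d g * (mpow M S m g f * mpow M S n f e))"
    by (simp add: Suc.IH sum_distrib_left)
  also have "\<dots> = (\<Sum>f\<in>S. \<Sum>g\<in>S. M d g * (mpow M S m g f * mpow M S n f e))" by (rule sum.swap)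
  finally show ?case by (simp add: sum_distrib_right mult.assoc)
qed

lemma linear_recurrence_mpow:
  assumes S: "finite S" and rec: "\<And>t d. d \<in> S \<Longrightarrow> v (Suc t) d = (\<Sum>e\<in>S. M d e * v t e)"
    and d: "d \<in> S"
  shows "v (t + n) d = (\<Sum>e\<in>S. mpow M S n d e * v t e)"
  using d
proof (induction n arbitrary: d)
  case 0
  then show ?case using S by (simp add: of_bool_def if_distrib[of "\<lambda>x. x * _"] cong: if_cong)
next
  case (Suc n)
  have "v (t + Suc n) d = (\<Sum>f\<in>S. M d f * (\<Sum>e\<in>S. mpow M S n f e * v t e))"
    using Suc by (simp add: rec)
  also have "\<dots> = (\<Sum>f\<in>S. \<Sum>e\<in>S. M d f * (mpow M S n f e * v t e))" by (simp add: sum_distrib_left)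
  also have "\<dots> = (\<Sum>e\<in>S. \<Sum>f\<in>S. M d f * (mpow M S n f e * v t e))" by (rule sum.swap)
  finally show ?case by (simp add: sum_distrib_right mult.assoc)
qed

text \<open>The support of a power determines that of the next, so some power has the same support
  as its square; this makes the support transitive.\<close>

lemma transitive_mpow:
  assumes S: "finite S"
  obtains q where "q \<ge> 1" "transitive_support (mpow M S q) S"
proof -
  define X where "X n = {(d, e). d \<in> S \<and> e \<in> S \<and> mpow M S n d e > 0}" for n
  have X: "X (Suc n) = {(d, e). d \<in> S \<and> e \<in> S \<and> (\<exists>f\<in>S. M d f > 0 \<and> (f, e) \<in> X n)}" for n
    using S by (auto simp: X_def sum_eq_0_iff simp flip: neq0_conv)
  have "range X \<subseteq> Pow (S \<times> S)" by (auto simp: X_def)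
  then have "finite (range X)" using S by (meson finite_Pow_iff finite_SigmaI finite_subset)
  then obtain q where q: "q \<ge> 1" "\<And>k. k \<ge> 1 \<Longrightarrow> X (k * q) = X q"
    by (rule eventually_periodic_power[of X]) (auto simp: X)
  have "transitive_support (mpow M S q) S"
    unfolding transitive_support_def
  proof (intro ballI impI)
    fix d e f assume *: "d \<in> S" "e \<in> S" "f \<in> S" "mpow M S q d e > 0" "mpow M S q e f > 0"
    have "mpow M S q d e * mpow M S q e f \<le> (\<Sum>e\<in>S. mpow M S q d e * mpow M S q e f)"
      using * S by (intro member_le_sum) auto
    then have "mpow M S (q + q) d f > 0" using * mpow_add[OF S *(1), of M q q f] by (metis gr0I le_zero_eq nat_0_less_mult_iff)
    then have "(d, f) \<in> X (2 * q)" using * by (simp add: X_def mult_2)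
    also have "X (2 * q) = X q" using q(2)[of 2] by simp
    finally show "mpow M S q d f > 0" by (simp add: X_def)
  qed
  then show ?thesis using that q by blast
qed

lemma linear_system_subsequences:
  fixes v :: "nat \<Rightarrow> 'a \<Rightarrow> nat"
  assumes S: "finite S" and rec: "\<And>t d. d \<in> S \<Longrightarrow> v (Suc t) d = (\<Sum>e\<in>S. M d e * v t e)"
  obtains q where "q \<ge> 1" "\<And>r d. d \<in> S \<Longrightarrow> dominated_fps (Abs_fps (\<lambda>t. real (v (q * t + r) d)))"
proof -
  obtain q where q: "q \<ge> 1" "transitive_support (mpow M S q) S" using transitive_mpow[OF S] .
  have "dominated_fps (Abs_fps (\<lambda>t. real (v (q * t + r) d)))" if "d \<in> S" for r d
  proof (rule dominated_fps_linear_system[OF S q(2), of "\<lambda>t. v (q * t + r)"])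
    show "v (q * Suc t + r) d = (\<Sum>e\<in>S. mpow M S q d e * v (q * t + r) e)" if "d \<in> S" for t d
      using linear_recurrence_mpow[where v = v and M = M, OF S rec that, of "q * t + r" q] by (simp add: algebra_simps)
  qed (rule that)
  then show ?thesis using that q by blast
qed

section \<open>Words and blocks\<close>

lemma hext_Nil [simp]: "hext h [] = []"
  by (simp add: hext_def)

lemma hext_append: "hext h (u @ v) = hext h u @ hext h v"
  by (simp add: hext_def)

lemma hext_single [simp]: "hext h [c] = h c"
  by (simp add: hext_def)

lemma hext_pow_Nil [simp]: "(hext h ^^ n) [] = []"
  by (induction n) simp_all

lemma hext_pow_append: "(hext h ^^ n) (u @ v) = (hext h ^^ n) u @ (hext h ^^ n) v"
  by (induction n) (simp_all add: hext_append)

lemma hext_pow_Cons: "(hext h ^^ n) (c # v) = (hext h ^^ n) [c] @ (hext h ^^ n) v"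
  using hext_pow_append[of n h "[c]" v] by simp

lemma hext_pow_Suc_single: "(hext h ^^ Suc n) [c] = (hext h ^^ n) (h c)"
  by (simp add: funpow_Suc_right del: funpow.simps)

lemma hext_pow_add: "(hext h ^^ (m + n)) u = (hext h ^^ m) ((hext h ^^ n) u)"
  by (simp add: funpow_add)

lemma set_hext_pow:
  assumes "\<And>c. c \<in> A \<Longrightarrow> set (h c) \<subseteq> A" "set u \<subseteq> A"
  shows "set ((hext h ^^ n) u) \<subseteq> A"
  by (induction n) (use assms in \<open>fastforce simp: hext_def\<close>)+

lemma hext_of_pow: "hext (\<lambda>c. (hext h ^^ q) [c]) = hext h ^^ q"
proof
  fix u show "hext (\<lambda>c. (hext h ^^ q) [c]) u = (hext h ^^ q) u"
  proof (induction u)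
    case (Cons c u)
    have "hext (\<lambda>c. (hext h ^^ q) [c]) (c # u) = (hext h ^^ q) [c] @ hext (\<lambda>c. (hext h ^^ q) [c]) u"
      by (simp add: hext_def)
    then show ?case using Cons hext_pow_Cons[of q h c u] by simp
  qed simp
qed

lemma hext_of_pow_pow: "hext (\<lambda>c. (hext h ^^ q) [c]) ^^ n = hext h ^^ (q * n)"
  by (simp add: hext_of_pow funpow_mult)

lemma length_hext_pow_le:
  assumes "\<And>c. c \<in> A \<Longrightarrow> set (h c) \<subseteq> A" "set u \<subseteq> A" "\<And>c. c \<in> A \<Longrightarrow> length (h c) \<le> B"
  shows "length ((hext h ^^ n) u) \<le> B ^ n * length u"
proof (induction n)
  case (Suc n)
  have one: "length (hext h v) \<le> B * length v" if "set v \<subseteq> A" for v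
    using that
  proof (induction v)
    case (Cons c v)
    then show ?case using assms(3)[of c] by (simp add: hext_def)
  qed simp
  have "length ((hext h ^^ Suc n) u) \<le> B * length ((hext h ^^ n) u)"
    using one[OF set_hext_pow[OF assms(1,2), where n = n]] by simp
  also have "\<dots> \<le> B * (B ^ n * length u)" by (intro mult_le_mono Suc) simp
  finally show ?case by simp
qed simp

lemma length_hext_pow_uniform:
  assumes "\<And>c. c \<in> A \<Longrightarrow> set (h c) \<subseteq> A" "set u \<subseteq> A" "\<And>c. c \<in> A \<Longrightarrow> length (h c) = m"
  shows "length ((hext h ^^ n) u) = m ^ n * length u"
proof (induction n)
  case (Suc n)
  have one: "length (hext h v) = m * length v" if "set v \<subseteq> A" for v
    using that
  proof (induction v)
    case (Cons c v)
    then show ?case using assms(3)[of c] by (simp add: hext_def)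
  qed simp
  show ?case using one[OF set_hext_pow[OF assms(1,2), where n = n]] Suc by simp
qed simp

section \<open>Reading iterated images along \<open>x\<close>\<close>

definition reads :: "(nat \<Rightarrow> nat) \<Rightarrow> nat list \<Rightarrow> nat list \<Rightarrow> nat \<Rightarrow> bool" where
  "reads \<tau> x u s \<longleftrightarrow> (\<forall>i<length u. \<tau> (u ! i) = x ! ((s + i) mod length x))"

lemma reads_Nil [simp]: "reads \<tau> x [] s"
  by (simp add: reads_def)

lemma reads_append: "reads \<tau> x (u @ v) s \<longleftrightarrow> reads \<tau> x u s \<and> reads \<tau> x v (s + length u)"
proof
  assume L: "reads \<tau> x (u @ v) s"
  show "reads \<tau> x u s \<and> reads \<tau> x v (s + length u)"
    unfolding reads_def
  proof (intro conjI allI impI)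
    fix i assume "i < length u"
    then show "\<tau> (u ! i) = x ! ((s + i) mod length x)"
      using L[unfolded reads_def, rule_format, of i] by (simp add: nth_append)
  next
    fix i assume "i < length v"
    then show "\<tau> (v ! i) = x ! ((s + length u + i) mod length x)"
      using L[unfolded reads_def, rule_format, of "length u + i"] by (simp add: nth_append add.assoc)
  qed
next
  assume R: "reads \<tau> x u s \<and> reads \<tau> x v (s + length u)"
  show "reads \<tau> x (u @ v) s"
    unfolding reads_def
  proof (intro allI impI)
    fix i assume i: "i < length (u @ v)"
    show "\<tau> ((u @ v) ! i) = x ! ((s + i) mod length x)"
    proof (cases "i < length u")
      case True
      then show ?thesis using R by (auto simp: reads_def nth_append)
    next
      case False
      then have "\<tau> (v ! (i - length u)) = x ! ((s + length u + (i - length u)) mod length x)"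
        using R i unfolding reads_def by (metis add_less_imp_less_left le_add_diff_inverse length_append not_less)
      then show ?thesis using False by (simp add: nth_append)
    qed
  qed
qed

lemma reads_cong: "s mod length x = t mod length x \<Longrightarrow> reads \<tau> x u s = reads \<tau> x u t"
  unfolding reads_def by (metis mod_add_cong)

text \<open>The next image of a letter is a concatenation of current images, and its readability
  depends on the phases at which the pieces start. Recording lengths modulo \<open>length x\<close>
  along with readability therefore makes the evolution deterministic.\<close>

lemma stabilizing_power:
  fixes \<tau> :: "nat \<Rightarrow> nat" and x :: "nat list"
  assumes A: "finite A" "\<And>c. c \<in> A \<Longrightarrow> set (h c) \<subseteq> A" and x: "x \<noteq> []"
  obtains q where "q \<ge> 1"
    "\<And>c k. c \<in> A \<Longrightarrow> k \<ge> 1 \<Longrightarrow> length ((hext h ^^ (q * k)) [c]) mod length x = length ((hext h ^^ q) [c]) mod length x"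
    "\<And>c k s. c \<in> A \<Longrightarrow> k \<ge> 1 \<Longrightarrow> reads \<tau> x ((hext h ^^ (q * k)) [c]) s = reads \<tau> x ((hext h ^^ q) [c]) s"
proof -
  define p where "p = length x"
  have p: "p > 0" using x by (simp add: p_def)
  define Y where "Y n = {(c, l). c \<in> A \<and> l = length ((hext h ^^ n) [c]) mod p}" for n
  define Z where "Z n = {(c, s). c \<in> A \<and> s < p \<and> reads \<tau> x ((hext h ^^ n) [c]) s}" for n
  define X where "X n = (Y n, Z n)" for n
  have X: "length ((hext h ^^ i) [c]) mod p = length ((hext h ^^ j) [c]) mod p"
       "reads \<tau> x ((hext h ^^ i) [c]) s = reads \<tau> x ((hext h ^^ j) [c]) s"
    if "X i = X j" "c \<in> A" for i j c s
  proof -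
    have eq: "Y i = Y j" "Z i = Z j" using that(1) by (simp_all add: X_def)
    have "(c, length ((hext h ^^ i) [c]) mod p) \<in> Y i" using that(2) by (simp add: Y_def)
    then have "(c, length ((hext h ^^ i) [c]) mod p) \<in> Y j" by (simp only: eq)
    then show "length ((hext h ^^ i) [c]) mod p = length ((hext h ^^ j) [c]) mod p" by (simp add: Y_def)
    have "reads \<tau> x ((hext h ^^ n) [c]) s \<longleftrightarrow> (c, s mod p) \<in> Z n" for n
      using that(2) p reads_cong[of "s mod p" x s] by (auto simp: Z_def p_def)
    then show "reads \<tau> x ((hext h ^^ i) [c]) s = reads \<tau> x ((hext h ^^ j) [c]) s" using eq by simp
  qed
  have words: "length ((hext h ^^ i) u) mod p = length ((hext h ^^ j) u) mod p \<and>
       (\<forall>s. reads \<tau> x ((hext h ^^ i) u) s = reads \<tau> x ((hext h ^^ j) u) s)"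
    if "X i = X j" "set u \<subseteq> A" for i j u
    using that(2)
  proof (induction u)
    case (Cons c u)
    then have c: "c \<in> A" and IH: "length ((hext h ^^ i) u) mod p = length ((hext h ^^ j) u) mod p"
      "\<And>s. reads \<tau> x ((hext h ^^ i) u) s = reads \<tau> x ((hext h ^^ j) u) s" by auto
    have "reads \<tau> x ((hext h ^^ i) (c # u)) s = reads \<tau> x ((hext h ^^ j) (c # u)) s" for s
    proof -
      have "reads \<tau> x ((hext h ^^ i) u) (s + length ((hext h ^^ i) [c])) = reads \<tau> x ((hext h ^^ i) u) (s + length ((hext h ^^ j) [c]))"
        using X(1)[OF that(1) c] unfolding p_def by (intro reads_cong mod_add_cong) auto
      then show ?thesis
        unfolding hext_pow_Cons[of _ h c u] reads_append using X(2)[OF that(1) c] IH(2) by simp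
    qed
    moreover have "length ((hext h ^^ i) (c # u)) mod p = length ((hext h ^^ j) (c # u)) mod p"
      unfolding hext_pow_Cons[of _ h c u] length_append by (rule mod_add_cong[OF X(1)[OF that(1) c] IH(1)])
    ultimately show ?case by blast
  qed simp
  have det: "X (Suc i) = X (Suc j)" if "X i = X j" for i j
    using words[OF that A(2)] unfolding X_def Y_def Z_def hext_pow_Suc_single by auto
  have "range X \<subseteq> Pow (A \<times> {..<p}) \<times> Pow (A \<times> {..<p})" using p by (auto simp: X_def Y_def Z_def)
  then have "finite (range X)" by (rule finite_subset) (use A in simp)
  then obtain q where q: "q \<ge> 1" "\<And>k. k \<ge> 1 \<Longrightarrow> X (k * q) = X q"
    by (rule eventually_periodic_power[of X]) (erule det, rule that, assumption+)
  show ?thesis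
  proof (rule that[OF q(1)])
    fix c k assume "c \<in> A" "(k::nat) \<ge> 1"
    then show "length ((hext h ^^ (q * k)) [c]) mod length x = length ((hext h ^^ q) [c]) mod length x"
      using X(1)[OF q(2)] by (simp add: p_def mult.commute)
  next
    fix c k s assume "c \<in> A" "(k::nat) \<ge> 1"
    then show "reads \<tau> x ((hext h ^^ (q * k)) [c]) s = reads \<tau> x ((hext h ^^ q) [c]) s"
      using X(2)[OF q(2)] by (simp add: mult.commute)
  qed
qed

lemma pure_morphic_word_pow:
  assumes W: "pure_morphic_word A h a W" and q: "q \<ge> 1"
  shows "pure_morphic_word A (\<lambda>c. (hext h ^^ q) [c]) a W"
proof -
  have A: "finite A" "a \<in> A" "\<And>c. c \<in> A \<Longrightarrow> set (h c) \<subseteq> A"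
    using W by (auto simp: pure_morphic_word_def prolongable_def)
  obtain y where y: "h a = a # y" "y \<noteq> []" "\<And>n. (hext h ^^ n) y \<noteq> []"
    using W by (auto simp: pure_morphic_word_def prolongable_def)
  have "\<exists>z. (hext h ^^ Suc n) [a] = a # y @ z" for n
  proof (induction n)
    case (Suc n)
    then obtain z where z: "(hext h ^^ Suc n) [a] = a # y @ z" by blast
    have "(hext h ^^ Suc (Suc n)) [a] = hext h (a # y @ z)" using z by simp
    also have "\<dots> = a # y @ hext h (y @ z)" by (simp add: hext_def y)
    finally show ?case by blast
  qed (simp add: y hext_def)
  then obtain z where z: "(hext h ^^ q) [a] = a # y @ z" using q by (metis Suc_le_D One_nat_def)
  have "set ((hext h ^^ q) [c]) \<subseteq> A" if "c \<in> A" for c using set_hext_pow[OF A(3)] that by simp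
  moreover have "(hext (\<lambda>c. (hext h ^^ q) [c]) ^^ n) (y @ z) \<noteq> []" for n
    using y(3) by (simp add: hext_of_pow_pow hext_pow_append)
  ultimately have "prolongable A (\<lambda>c. (hext h ^^ q) [c]) a"
    using A y z unfolding prolongable_def by auto
  then show ?thesis using W by (simp add: pure_morphic_word_def hext_of_pow_pow)
qed

section \<open>Mismatches, runs and maximal blocks\<close>

definition mism :: "nat list \<Rightarrow> (nat \<Rightarrow> nat) \<Rightarrow> nat \<Rightarrow> nat \<Rightarrow> bool" where
  "mism x w \<phi> m \<longleftrightarrow> w m \<noteq> x ! ((m + \<phi>) mod length x)"

text \<open>\<open>P\<close> and \<open>Q\<close> are the mismatches themselves: the run fills the
  positions from \<open>Suc P\<close> to \<open>Q - 1\<close> and may be empty.\<close>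

definition run :: "nat list \<Rightarrow> (nat \<Rightarrow> nat) \<Rightarrow> nat \<Rightarrow> nat \<Rightarrow> nat \<Rightarrow> bool" where
  "run x w \<phi> P Q \<longleftrightarrow> P < Q \<and> mism x w \<phi> P \<and> mism x w \<phi> Q \<and> (\<forall>m. P < m \<longrightarrow> m < Q \<longrightarrow> \<not> mism x w \<phi> m)"

lemma length_concat_replicate: "length (concat (replicate n x)) = n * length x"
  by (induction n) auto

lemma nth_concat_replicate: "t < n * length x \<Longrightarrow> concat (replicate n x) ! t = x ! (t mod length x)"
proof (induction n arbitrary: t)
  case (Suc n)
  show ?case
  proof (cases "t < length x")
    case False
    then have "concat (replicate (Suc n) x) ! t = x ! ((t - length x) mod length x)"
      using Suc by (simp add: nth_append)
    then show ?thesis using False by (simp add: le_mod_geq)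
  qed (simp add: nth_append)
qed simp

lemma nth_x_block:
  assumes "proper_suffix_of x' x" "proper_prefix_of x'' x"
    and t: "t < length x' + n * length x + length x''"
  shows "(x' @ concat (replicate n x) @ x'') ! t = x ! ((t + (length x - length x')) mod length x)"
proof -
  obtain v where v: "x = v @ x'" using assms(1) unfolding proper_suffix_of_def by blast
  obtain u where u: "x = x'' @ u" using assms(2) unfolding proper_prefix_of_def by blast
  have lv: "length v = length x - length x'" using arg_cong[OF v, of length] by simp
  define z where "z = (x' @ concat (replicate n x) @ x'') @ u"
  \<comment> \<open>Completing the partial copies at both ends embeds the block in a power of
    \<open>x\<close>.\<close>
  have eq: "concat (replicate (n + 2) x) = v @ z"
  proof -
    have "replicate (n + 2) x = x # replicate n x @ [x]"
      by (simp add: replicate_append_same)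
    then have "concat (replicate (n + 2) x) = x @ concat (replicate n x) @ x" by simp
    also have "\<dots> = (v @ x') @ concat (replicate n x) @ (x'' @ u)"
      by (simp only: v[symmetric] u[symmetric])
    finally show ?thesis by (simp add: z_def)
  qed
  have "concat (replicate (n + 2) x) ! (t + length v) = z ! t"
    unfolding eq by (simp add: nth_append)
  also have "\<dots> = (x' @ concat (replicate n x) @ x'') ! t"
    unfolding z_def using t by (subst nth_append) (simp add: length_concat_replicate)
  finally have "(x' @ concat (replicate n x) @ x'') ! t = concat (replicate (n + 2) x) ! (t + length v)"
    by (rule sym)
  also have "\<dots> = x ! ((t + length v) mod length x)"
  proof (rule nth_concat_replicate)
    have "length x'' \<le> length x" "length v + length x' = length x"
      using arg_cong[OF u, of length] arg_cong[OF v, of length] by simp_all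
    then show "t + length v < (n + 2) * length x" using t by simp
  qed
  finally show ?thesis by (simp add: lv)
qed

lemma nth_factor: "t < Suc j - i \<Longrightarrow> factor w i j ! t = w (i + t)"
  by (simp add: factor_def del: upt_Suc)

lemma length_factor: "length (factor w i j) = Suc j - i"
  by (simp add: factor_def del: upt_Suc)

lemma max_block_imp_run:
  assumes x: "x \<noteq> []" and mb: "max_block x w i j" and i: "i > 0"
  obtains \<phi> where "run x w \<phi> (i - 1) (Suc j)"
proof -
  define p where "p = length x"
  have p: "p > 0" using x by (simp add: p_def)
  obtain x' x'' n where ij: "i \<le> j" and x': "proper_suffix_of x' x" and x'': "proper_prefix_of x'' x"
    and f: "factor w i j = x' @ concat (replicate n x) @ x''"
    and pre: "\<not> is_prefix_of (x'' @ [w (Suc j)]) x" and suf: "\<not> is_suffix_of (w (i - 1) # x') x"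
    using mb i by (auto simp: max_block_def)
  obtain v u where v: "v \<noteq> []" "x = v @ x'" and u: "u \<noteq> []" "x = x'' @ u"
    using x' x'' by (auto simp: proper_suffix_of_def proper_prefix_of_def)
  have lv: "length v = p - length x'" "length v + length x' = p"
    using arg_cong[OF v(2), of length] by (simp_all add: p_def)
  have len: "Suc j - i = length x' + n * p + length x''"
    using arg_cong[OF f, of length] by (simp add: length_factor length_concat_replicate p_def)
  \<comment> \<open>\<open>i * (p - 1)\<close> plays the role of \<open>- i\<close> modulo
    \<open>p\<close>, so position \<open>i\<close> is compared with index \<open>length v\<close>
    modulo \<open>p\<close>, where the suffix \<open>x'\<close> starts.\<close>
  define \<phi> where "\<phi> = length v + i * (p - 1)"
  have \<phi>: "(i + t + \<phi>) mod p = (t + length v) mod p" for t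
  proof -
    have "i + i * (p - 1) = i * p" using p by (cases p) auto
    then have "i + t + \<phi> = t + length v + i * p" by (simp add: \<phi>_def)
    then show ?thesis by (simp only: mod_mult_self1)
  qed
  have "\<not> mism x w \<phi> m" if "i - 1 < m" "m < Suc j" for m
  proof -
    define t where "t = m - i"
    have t: "m = i + t" "t < Suc j - i" using that i by (auto simp: t_def)
    have "w m = (x' @ concat (replicate n x) @ x'') ! t" using t nth_factor[of t j i w] f by simp
    also have "\<dots> = x ! ((t + (p - length x')) mod p)"
      unfolding p_def using t len by (intro nth_x_block x' x'') (simp add: p_def)
    finally show ?thesis using \<phi>[of t] t by (simp add: mism_def lv flip: p_def)
  qed
  moreover have "mism x w \<phi> (Suc j)"
  proof -
    have "Suc j = i + (length x' + n * p + length x'')" using len ij by simp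
    then have "(Suc j + \<phi>) mod p = (length x' + n * p + length x'' + length v) mod p" using \<phi> by metis
    also have "length x' + n * p + length x'' + length v = length x'' + (n + 1) * p" using lv by simp
    also have "(length x'' + (n + 1) * p) mod p = length x'' mod p" by (rule mod_mult_self1)
    also have "\<dots> = length x''" using u(1) arg_cong[OF u(2), of length] by (simp add: p_def)
    finally have idx: "(Suc j + \<phi>) mod length x = length x''" by (simp add: p_def)
    show ?thesis
    proof (rule ccontr)
      assume "\<not> ?thesis"
      then have "w (Suc j) = x ! length x''" unfolding mism_def idx by simp
      also have "\<dots> = hd u" using u by (metis append_Nil2 hd_conv_nth nth_append_length_plus add_0_right)
      finally have "x = (x'' @ [w (Suc j)]) @ tl u" using u by simp
      then show False using pre by (auto simp: is_prefix_of_def)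
    qed
  qed
  moreover have "mism x w \<phi> (i - 1)"
  proof -
    have "i - 1 + \<phi> = (length v - 1) + i * p"
    proof -
      have "i + i * (p - 1) = i * p" using p by (cases p) auto
      moreover have "length v \<ge> 1" using v by (cases v) auto
      ultimately show ?thesis using i unfolding \<phi>_def by linarith
    qed
    then have "(i - 1 + \<phi>) mod p = (length v - 1) mod p" by (simp only: mod_mult_self1)
    also have "\<dots> = length v - 1" using lv(2) p by (intro mod_less) linarith
    finally have idx: "(i - 1 + \<phi>) mod length x = length v - 1" by (simp add: p_def)
    show ?thesis
    proof (rule ccontr)
      assume "\<not> ?thesis"
      then have "w (i - 1) = x ! (length v - 1)" unfolding mism_def idx by simp
      also have "\<dots> = last v" using v by (simp add: nth_append last_conv_nth)
      finally have "x = butlast v @ (w (i - 1) # x')" using v by simp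
      then show False using suf by (auto simp: is_suffix_of_def)
    qed
  qed
  ultimately have "run x w \<phi> (i - 1) (Suc j)" using ij by (auto simp: run_def)
  then show ?thesis using that by blast
qed

text \<open>The length condition leaves room for the incomplete copy \<open>x'\<close> and at least
  one full copy of \<open>x\<close>.\<close>

lemma run_imp_max_block:
  assumes x: "x \<noteq> []" and r: "run x w \<phi> P Q" and long: "P + 2 * length x < Q"
  shows "max_block x w (Suc P) (Q - 1)"
proof -
  define p where "p = length x"
  have p: "p > 0" using x by (simp add: p_def)
  define i where "i = Suc P"
  define e where "e = (i + \<phi>) mod p"
  have e: "e < p" using p by (simp add: e_def)
  \<comment> \<open>At phase 0 the suffix has to be empty, since the whole of \<open>x\<close> is
    not a proper suffix.\<close>
  define x' where "x' = (if e = 0 then [] else drop e x)"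
  define L where "L = Q - i"
  have L: "L \<ge> 2 * p" using long by (simp add: L_def i_def p_def)
  have lx': "length x' = (if e = 0 then 0 else p - e)" "length x' < p" using p by (auto simp: x'_def p_def)
  define n where "n = (L - length x') div p"
  define k where "k = (L - length x') mod p"
  have k: "k < p" using p by (simp add: k_def)
  define x'' where "x'' = take k x"
  have lx'': "length x'' = k" "length x'' < p" using k by (simp_all add: x''_def p_def)
  have sum: "L = length x' + n * p + length x''"
    using L lx' by (simp add: n_def lx'' k_def)
  have n: "n \<ge> 1" using L lx'(2) p unfolding n_def by (simp add: div_greater_zero_iff Suc_le_eq)
  have x': "proper_suffix_of x' x"
  proof (cases "e = 0")
    case True
    then show ?thesis using x by (simp add: x'_def proper_suffix_of_def)
  next
    case False
    then have "x = take e x @ x'" "take e x \<noteq> []" using x by (auto simp: x'_def)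
    then show ?thesis unfolding proper_suffix_of_def by blast
  qed
  have x'': "proper_prefix_of x'' x"
  proof -
    have "x = x'' @ drop k x" "drop k x \<noteq> []"
      using k by (simp_all add: x''_def p_def)
    then show ?thesis unfolding proper_prefix_of_def by blast
  qed
  have phase: "(t + (p - length x')) mod p = (i + t + \<phi>) mod p" for t
  proof -
    have "(p - length x') mod p = (i + \<phi>) mod p" using lx' e by (auto simp: e_def)
    then have "(t + (p - length x')) mod p = (t + (i + \<phi>)) mod p" by (rule mod_add_cong[OF refl])
    then show ?thesis by (simp add: algebra_simps)
  qed
  have Q: "Suc (Q - 1) = Q" "Q = i + L" using long by (auto simp: L_def i_def)
  have "factor w i (Q - 1) = x' @ concat (replicate n x) @ x''"
  proof (rule nth_equalityI)
    show "length (factor w i (Q - 1)) = length (x' @ concat (replicate n x) @ x'')"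
      using sum Q by (simp add: length_factor length_concat_replicate flip: p_def)
    fix t assume "t < length (factor w i (Q - 1))"
    then have t: "t < L" using Q by (simp add: length_factor)
    have "(x' @ concat (replicate n x) @ x'') ! t = x ! ((t + (p - length x')) mod p)"
      unfolding p_def using t sum by (intro nth_x_block x' x'') (simp add: p_def)
    also have "\<dots> = w (i + t)"
      using r t Q unfolding phase by (auto simp: run_def mism_def i_def p_def)
    finally show "factor w i (Q - 1) ! t = (x' @ concat (replicate n x) @ x'') ! t"
      using t Q by (simp add: nth_factor)
  qed
  moreover have "\<not> is_prefix_of (x'' @ [w (Suc (Q - 1))]) x"
  proof
    assume "is_prefix_of (x'' @ [w (Suc (Q - 1))]) x"
    then obtain z where "x = x'' @ [w Q] @ z" using Q by (auto simp: is_prefix_of_def)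
    then have "x ! length x'' = w Q" by (metis append_Cons nth_append_length)
    moreover have "(Q + \<phi>) mod p = length x''"
    proof -
      have "(Q + \<phi>) mod p = (L + (p - length x')) mod p" using phase[of L] Q by simp
      also have "L + (p - length x') = length x'' + (n + 1) * p" using sum lx'(2) by simp
      also have "\<dots> mod p = length x'' mod p" by (rule mod_mult_self1)
      also have "\<dots> = length x''" using lx''(2) by simp
      finally show ?thesis .
    qed
    ultimately show False using r by (simp add: run_def mism_def p_def)
  qed
  moreover have "\<not> is_suffix_of (w (i - 1) # x') x"
  proof
    assume "is_suffix_of (w (i - 1) # x') x"
    then obtain z where z: "x = z @ w P # x'" by (auto simp: is_suffix_of_def i_def)
    then have "x ! length z = w P" by (metis nth_append_length)
    moreover have "(P + \<phi>) mod p = length z"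
    proof -
      have lz: "p = length z + 1 + length x'" using arg_cong[OF z, of length] by (simp add: p_def)
      have "(P + \<phi> + 1) mod p = (length z + 1) mod p" using phase[of 0] lz by (simp add: i_def)
      \<comment> \<open>Adding \<open>p - 1\<close> cancels the \<open>+ 1\<close> modulo
        \<open>p\<close>, avoiding truncated subtraction.\<close>
      then have "(P + \<phi> + 1 + (p - 1)) mod p = (length z + 1 + (p - 1)) mod p" by (rule mod_add_cong) simp
      then have "(P + \<phi>) mod p = length z mod p" using p by simp
      then show ?thesis using lz by simp
    qed
    ultimately show False using r by (simp add: run_def mism_def p_def)
  qed
  moreover have "i \<le> Q - 1" using long p unfolding i_def p_def by linarith
  ultimately show ?thesis using x' x'' n unfolding max_block_def i_def[symmetric] by blast
qed

section \<open>Runs in a morphic word\<close>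

text \<open>\<open>g\<close> is the stabilizing power. Stability starts at level 1: a letter itself
  may behave differently from its images.\<close>

locale stable_morphic_word =
  fixes A :: "nat set" and g :: "nat \<Rightarrow> nat list" and a :: nat and W \<tau> :: "nat \<Rightarrow> nat" and x :: "nat list"
  assumes pure: "pure_morphic_word A g a W" and x: "x \<noteq> []"
    and stable_length: "\<And>c n. c \<in> A \<Longrightarrow> n \<ge> 1 \<Longrightarrow>
       length ((hext g ^^ n) [c]) mod length x = length (g c) mod length x"
    and stable_reads: "\<And>c n s. c \<in> A \<Longrightarrow> n \<ge> 1 \<Longrightarrow> reads \<tau> x ((hext g ^^ n) [c]) s = reads \<tau> x (g c) s"
    and aperiodic: "\<And>m \<phi>. \<exists>n\<ge>m. mism x (\<tau> \<circ> W) \<phi> n"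
begin

section \<open>Image prefixes and ancestors of positions\<close>

abbreviation G :: "nat \<Rightarrow> nat list \<Rightarrow> nat list" where
  "G n u \<equiv> (hext g ^^ n) u"

abbreviation "p \<equiv> length x"

lemma p: "p > 0"
  using x by simp

lemma A: "finite A" "a \<in> A" "c \<in> A \<Longrightarrow> set (g c) \<subseteq> A"
  using pure by (auto simp: pure_morphic_word_def prolongable_def)

lemma G_1 [simp]: "G (Suc 0) u = hext g u"
  by simp

lemma G_Suc: "G (Suc n) [c] = G n (g c)"
  by (rule hext_pow_Suc_single)

lemma set_G: "set u \<subseteq> A \<Longrightarrow> set (G n u) \<subseteq> A"
  by (rule set_hext_pow[OF A(3)])

definition y :: "nat list" where "y = tl (g a)"

lemma y: "g a = a # y" "G n y \<noteq> []" "set y \<subseteq> A"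
proof -
  obtain z where z: "g a = a # z" "\<And>n. G n z \<noteq> []"
    using pure by (auto simp: pure_morphic_word_def prolongable_def)
  then have [simp]: "y = z" by (simp add: y_def)
  show "g a = a # y" "G n y \<noteq> []" using z by simp_all
  show "set y \<subseteq> A" using A(3)[OF A(2)] z by simp
qed

definition "N n = length (G n [a])"

lemma G_Suc_a: "G (Suc n) [a] = G n [a] @ G n y"
  using hext_pow_Cons[of n g a y] by (simp only: G_Suc y(1))

lemma N_Suc: "N (Suc n) = N n + length (G n y)"
  by (simp only: N_def G_Suc_a length_append)

lemma N_0 [simp]: "N 0 = 1"
  by (simp add: N_def)

lemma strict_mono_N: "strict_mono N"
  using y(2) by (intro strict_monoI_Suc) (simp add: N_Suc del: funpow.simps)

lemma N_gt: "n < N n"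
proof (induction n)
  case (Suc n)
  have "N n < N (Suc n)" using strict_mono_N by (rule strict_monoD) simp
  then show ?case using Suc by simp
qed simp

lemma N_mono: "m \<le> n \<Longrightarrow> N m \<le> N n"
  using strict_mono_N by (simp add: strict_mono_less_eq)

lemma W_nth: "i < N n \<Longrightarrow> W i = G n [a] ! i"
  using pure by (simp add: pure_morphic_word_def N_def)

definition pre :: "nat \<Rightarrow> nat list" where "pre k = map W [0..<k]"

lemma length_pre [simp]: "length (pre k) = k"
  by (simp add: pre_def)

lemma pre_Suc: "pre (Suc k) = pre k @ [W k]"
  by (simp add: pre_def)

lemma pre_N: "pre (N n) = G n [a]"
  by (rule nth_equalityI) (auto simp: pre_def N_def W_nth)

lemma pre_prefix:
  assumes "k \<le> l"
  shows "\<exists>z. pre l = pre k @ z"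
proof -
  have "[0..<l] = [0..<k] @ [k..<l]" using upt_add_eq_append[of 0 k "l - k"] assms by simp
  then have "pre l = pre k @ map W [k..<l]" by (simp only: pre_def map_append)
  then show ?thesis by blast
qed

text \<open>As \<open>W\<close> is fixed by \<open>g\<close>, this is the position at which the
  \<open>n\<close>-fold image of the letter \<open>W k\<close> starts.\<close>

definition "pos n k = length (G n (pre k))"

lemma pos_0 [simp]: "pos n 0 = 0"
  by (simp add: pos_def pre_def)

lemma pos_0_left [simp]: "pos 0 k = k"
  by (simp add: pos_def)

lemma pos_Suc: "pos n (Suc k) = pos n k + length (G n [W k])"
  by (simp add: pos_def pre_Suc hext_pow_append)

lemma pos_mono: "k \<le> l \<Longrightarrow> pos n k \<le> pos n l"
  by (rule lift_Suc_mono_le[of "pos n"]) (simp_all add: pos_Suc)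

text \<open>Every prefix is contained in some \<open>pre (N k)\<close>, and the images of these are
  again prefixes of \<open>W\<close>.\<close>

lemma pre_pos: "pre (pos n k) = G n (pre k)"
proof -
  have "k \<le> N k" using N_gt[of k] by simp
  then obtain z where z: "pre (N k) = pre k @ z" using pre_prefix by blast
  have "G n (pre (N k)) = G n (pre k) @ G n z" by (simp add: z hext_pow_append)
  moreover have "G n (pre (N k)) = pre (N (n + k))" by (simp add: pre_N funpow_add)
  ultimately have eq: "pre (N (n + k)) = G n (pre k) @ G n z" by simp
  have len: "pos n k \<le> N (n + k)" using arg_cong[OF eq, of length] by (simp add: pos_def)
  have "pre (pos n k) = take (pos n k) (pre (N (n + k)))"
    using len by (simp add: pre_def take_map)
  also have "\<dots> = G n (pre k)" by (simp add: eq pos_def)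
  finally show ?thesis .
qed

lemma pos_pos: "pos n (pos m k) = pos (n + m) k"
  by (simp add: pos_def[of n] pre_pos pos_def[of "n + m"] funpow_add)

lemma pos_N: "pos n (N m) = N (n + m)"
  unfolding pos_def pre_N by (simp add: N_def funpow_add)

lemma pos_1_right: "pos n (Suc 0) = N n"
  using pos_N[of n 0] by simp

lemma W_in_A: "W k \<in> A"
proof -
  have "W k = G k [a] ! k" "k < length (G k [a])" using N_gt[of k] W_nth by (auto simp: N_def)
  then have "W k \<in> set (G k [a])" by simp
  then show ?thesis using set_G[of "[a]" k] A(2) by auto
qed

lemma W_pos:
  assumes "i < length (G n [W k])"
  shows "W (pos n k + i) = G n [W k] ! i"
proof -
  have lt: "pos n k + i < pos n (Suc k)" using assms by (simp add: pos_Suc)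
  then have "W (pos n k + i) = pre (pos n (Suc k)) ! (pos n k + i)" by (simp add: pre_def)
  also have "\<dots> = (G n (pre k) @ G n [W k]) ! (pos n k + i)"
    by (simp only: pre_pos pre_Suc hext_pow_append)
  finally show ?thesis by (simp add: pos_def)
qed

lemma pos_gt: "\<exists>k. m < pos n (Suc k)"
proof -
  have "m < N (n + m)" using N_gt[of "n + m"] by simp
  also have "N (n + m) = pos n (N m)" by (simp add: pos_N)
  also have "\<dots> \<le> pos n (Suc (N m))" by (intro pos_mono) simp
  finally show ?thesis by blast
qed

text \<open>\<open>anc n m\<close> is the index of the letter of \<open>W\<close> whose \<open>n\<close>-fold image covers position \<open>m\<close>.\<close>

definition "anc n m = (LEAST k. m < pos n (Suc k))"

lemma anc: "pos n (anc n m) \<le> m" "m < pos n (Suc (anc n m))"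
proof -
  show "m < pos n (Suc (anc n m))" unfolding anc_def using pos_gt by (rule LeastI_ex)
  show "pos n (anc n m) \<le> m"
  proof (cases "anc n m")
    case (Suc k)
    then have "\<not> m < pos n (Suc k)" using not_less_Least[of k "\<lambda>k. m < pos n (Suc k)"] by (simp add: anc_def)
    then show ?thesis using Suc by simp
  qed simp
qed

lemma anc_unique: "pos n k \<le> m \<Longrightarrow> m < pos n (Suc k) \<Longrightarrow> anc n m = k"
proof (rule ccontr)
  assume *: "pos n k \<le> m" "m < pos n (Suc k)" "anc n m \<noteq> k"
  then consider "Suc (anc n m) \<le> k" | "Suc k \<le> anc n m" by linarith
  then show False
  proof cases
    case 1
    then show False using pos_mono[OF 1, of n] anc(2)[of m n] * by linarith
  next
    case 2
    then show False using pos_mono[OF 2, of n] anc(1)[of n m] * by linarith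
  qed
qed

lemma anc_mono: "l \<le> m \<Longrightarrow> anc n l \<le> anc n m"
proof (rule ccontr)
  assume *: "l \<le> m" "\<not> anc n l \<le> anc n m"
  then have "pos n (Suc (anc n m)) \<le> pos n (anc n l)" by (intro pos_mono) simp
  then show False using anc(1)[of n l] anc(2)[of m n] * by linarith
qed

lemma anc_0 [simp]: "anc 0 m = m"
  by (rule anc_unique) simp_all

lemma anc_Suc: "anc (Suc n) m = anc 1 (anc n m)"
proof (rule anc_unique)
  have "pos (Suc n) (anc 1 (anc n m)) = pos n (pos 1 (anc 1 (anc n m)))" by (simp add: pos_pos)
  also have "\<dots> \<le> pos n (anc n m)" by (intro pos_mono anc)
  also have "\<dots> \<le> m" by (rule anc)
  finally show "pos (Suc n) (anc 1 (anc n m)) \<le> m" .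
  have "m < pos n (Suc (anc n m))" by (rule anc)
  also have "\<dots> \<le> pos n (pos 1 (Suc (anc 1 (anc n m))))" using anc(2)[of "anc n m" 1] by (intro pos_mono) simp
  also have "\<dots> = pos (Suc n) (Suc (anc 1 (anc n m)))" by (simp add: pos_pos)
  finally show "m < pos (Suc n) (Suc (anc 1 (anc n m)))" .
qed

lemma anc_eq_0: "m < N n \<Longrightarrow> anc n m = 0"
  by (rule anc_unique) (simp_all add: pos_1_right)

section \<open>Mismatches inside images of letters\<close>

abbreviation "w \<equiv> \<tau> \<circ> W"

definition "Mis n c s = {i. i < length (G n [c]) \<and> \<tau> (G n [c] ! i) \<noteq> x ! ((s + i) mod p)}"

lemma finite_Mis [simp]: "finite (Mis n c s)"
  by (simp add: Mis_def)

lemma Mis_less: "i \<in> Mis n c s \<Longrightarrow> i < length (G n [c])"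
  by (simp add: Mis_def)

lemma Mis_empty_iff: "Mis n c s = {} \<longleftrightarrow> reads \<tau> x (G n [c]) s"
  by (auto simp: Mis_def reads_def)

lemma Mis_empty_stable: "c \<in> A \<Longrightarrow> n \<ge> 1 \<Longrightarrow> Mis n c s = {} \<longleftrightarrow> reads \<tau> x (g c) s"
  by (simp add: Mis_empty_iff stable_reads)

lemma Mis_cong:
  assumes "s mod p = t mod p"
  shows "Mis n c s = Mis n c t"
proof -
  have "(s + i) mod p = (t + i) mod p" for i by (rule mod_add_cong[OF assms refl])
  then show ?thesis by (simp add: Mis_def)
qed

lemma mism_pos_iff:
  assumes "i < length (G n [W k])"
  shows "mism x w \<phi> (pos n k + i) \<longleftrightarrow> i \<in> Mis n (W k) (pos n k + \<phi>)"
  unfolding mism_def Mis_def comp_def W_pos[OF assms] using assms by (simp add: add_ac)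

lemma stable_length_word:
  assumes "set u \<subseteq> A" "n \<ge> 1"
  shows "length (G n u) mod p = length (hext g u) mod p"
  using assms(1)
proof (induction u)
  case (Cons c u)
  then have "length (G n [c]) mod p = length (g c) mod p" "length (G n u) mod p = length (hext g u) mod p"
    using stable_length assms(2) by simp_all
  then have "(length (G n [c]) + length (G n u)) mod p = (length (g c) + length (hext g u)) mod p"
    by (rule mod_add_cong)
  then show ?case unfolding hext_pow_Cons[of n g c u] by (simp add: hext_def)
qed simp

lemma stable_reads_word:
  assumes "set u \<subseteq> A" "n \<ge> 1"
  shows "reads \<tau> x (G n u) s = reads \<tau> x (hext g u) s"
  using assms(1)
proof (induction u arbitrary: s)
  case (Cons c u)
  have len: "(s + length (G n [c])) mod p = (s + length (g c)) mod p"
    using Cons.prems assms(2) stable_length[of c n] by (intro mod_add_cong) simp_all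
  have "reads \<tau> x (G n (c # u)) s \<longleftrightarrow> reads \<tau> x (G n [c]) s \<and> reads \<tau> x (G n u) (s + length (G n [c]))"
    unfolding hext_pow_Cons[of n g c u] by (rule reads_append)
  also have "\<dots> \<longleftrightarrow> reads \<tau> x (g c) s \<and> reads \<tau> x (hext g u) (s + length (g c))"
    using Cons assms(2) stable_reads[of c n] reads_cong[OF len] by simp
  also have "\<dots> \<longleftrightarrow> reads \<tau> x (hext g (c # u)) s" by (simp add: hext_def reads_append)
  finally show ?case .
qed simp

text \<open>The phase at the start of letter \<open>i\<close> of \<open>g c\<close>, when the image of \<open>c\<close> starts at phase \<open>s\<close>.\<close>

definition "ph s c i = (s + length (hext g (take i (g c)))) mod p"

lemma ph_less: "ph s c i < p"
  using p by (simp add: ph_def)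

lemma g_nth_in_A: "c \<in> A \<Longrightarrow> i < length (g c) \<Longrightarrow> g c ! i \<in> A"
  using A(3)[of c] nth_mem by blast

lemma pre_child: "i \<le> length (g (W k)) \<Longrightarrow> pre (pos 1 k + i) = pre (pos 1 k) @ take i (g (W k))"
proof (induction i)
  case (Suc i)
  then have "pre (pos 1 k + Suc i) = pre (pos 1 k) @ take i (g (W k)) @ [W (pos 1 k + i)]"
    by (simp add: pre_Suc)
  moreover have "W (pos 1 k + i) = g (W k) ! i" using Suc.prems W_pos[of i 1 k] by simp
  ultimately show ?case using Suc.prems by (simp add: take_Suc_conv_app_nth)
qed simp

lemma W_child: "i < length (g (W k)) \<Longrightarrow> W (pos 1 k + i) = g (W k) ! i"
  using W_pos[of i 1 k] by simp

lemma pos_child: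
  assumes "i \<le> length (g (W k))"
  shows "pos n (pos 1 k + i) = pos (Suc n) k + length (G n (take i (g (W k))))"
proof -
  have "pos n (pos 1 k + i) = pos n (pos 1 k) + length (G n (take i (g (W k))))"
    by (simp only: pos_def[of n] pre_child[OF assms] hext_pow_append length_append)
  then show ?thesis using pos_pos[of n 1 k] by simp
qed

text \<open>By stability the offset of a child has the same residue at every level from 1 on; this
  is why one finite type describes runs of all these levels.\<close>

lemma phase_child:
  assumes "i \<le> length (g (W k))" "n \<ge> 1" and s: "(pos (Suc n) k + \<phi>) mod p = s mod p"
  shows "(pos n (pos 1 k + i) + \<phi>) mod p = ph s (W k) i"
proof -
  have "set (take i (g (W k))) \<subseteq> A" using A(3)[OF W_in_A] set_take_subset by fastforce
  then have "length (G n (take i (g (W k)))) mod p = length (hext g (take i (g (W k)))) mod p"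
    using assms(2) by (rule stable_length_word)
  then have "(pos (Suc n) k + \<phi> + length (G n (take i (g (W k))))) mod p = (s + length (hext g (take i (g (W k))))) mod p"
    by (rule mod_add_cong[OF s])
  then show ?thesis unfolding pos_child[OF assms(1)] ph_def by (simp add: add_ac)
qed

lemma mism_child_iff:
  assumes "i < length (g (W k))" "n \<ge> 1" "(pos (Suc n) k + \<phi>) mod p = s mod p" "j < length (G n [g (W k) ! i])"
  shows "mism x w \<phi> (pos n (pos 1 k + i) + j) \<longleftrightarrow> j \<in> Mis n (g (W k) ! i) (ph s (W k) i)"
proof -
  have "(pos n (pos 1 k + i) + \<phi>) mod p = ph s (W k) i mod p"
    using phase_child[of i k n \<phi> s] assms ph_less[of s "W k" i] by simp
  then have "Mis n (W (pos 1 k + i)) (pos n (pos 1 k + i) + \<phi>) = Mis n (g (W k) ! i) (ph s (W k) i)"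
    unfolding W_child[OF assms(1)] by (rule Mis_cong)
  moreover have "j < length (G n [W (pos 1 k + i)])" unfolding W_child[OF assms(1)] by (rule assms(4))
  ultimately show ?thesis using mism_pos_iff by simp
qed

text \<open>A run that starts in the image of child \<open>i\<close> of \<open>c\<close> and ends in
  that of child \<open>j\<close>. Testing the children on \<open>g\<close> alone decides this for
  every level from 1 on.\<close>

definition "valid c i j s \<longleftrightarrow> c \<in> A \<and> s < p \<and> i < j \<and> j < length (g c) \<and>
     \<not> reads \<tau> x (g (g c ! i)) (ph s c i) \<and> \<not> reads \<tau> x (g (g c ! j)) (ph s c j) \<and>
     (\<forall>l. i < l \<and> l < j \<longrightarrow> reads \<tau> x (g (g c ! l)) (ph s c l))"

definition "left_end c i s k n = pos n (pos 1 k + i) + Max (Mis n (g c ! i) (ph s c i))"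

definition "right_end c j s k n = pos n (pos 1 k + j) + Min (Mis n (g c ! j) (ph s c j))"

lemma valid_run:
  assumes v: "valid c i j s" and k: "W k = c" and n: "n \<ge> 1" and s: "(pos (Suc n) k + \<phi>) mod p = s"
  shows "run x w \<phi> (left_end c i s k n) (right_end c j s k n)"
proof -
  have c: "c \<in> A" and ij: "i < j" "j < length (g c)" using v by (auto simp: valid_def)
  have s': "(pos (Suc n) k + \<phi>) mod p = s mod p" using v s by (simp add: valid_def)
  define d where "d l = g c ! l" for l
  have dA: "d l \<in> A" if "l < length (g c)" for l using g_nth_in_A[OF c that] by (simp add: d_def)
  have mi: "mism x w \<phi> (pos n (pos 1 k + l) + m) \<longleftrightarrow> m \<in> Mis n (d l) (ph s c l)"
    if "l < length (g c)" "m < length (G n [d l])" for l m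
    using mism_child_iff[of l k n \<phi> s m] that n s' k by (simp add: d_def)
  have em: "Mis n (d l) (ph s c l) = {}" if "i < l" "l < j" for l
    using v Mis_empty_stable[OF dA n] ij that by (auto simp: valid_def d_def)
  have nei: "Mis n (d i) (ph s c i) \<noteq> {}" and nej: "Mis n (d j) (ph s c j) \<noteq> {}"
    using v Mis_empty_stable[OF dA n] ij by (auto simp: valid_def d_def)
  define P where "P = left_end c i s k n"
  define Q where "Q = right_end c j s k n"
  define mP where "mP = Max (Mis n (d i) (ph s c i))"
  define mQ where "mQ = Min (Mis n (d j) (ph s c j))"
  have P: "P = pos n (pos 1 k + i) + mP" by (simp add: P_def left_end_def mP_def d_def)
  have Q: "Q = pos n (pos 1 k + j) + mQ" by (simp add: Q_def right_end_def mQ_def d_def)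
  have mP: "mP \<in> Mis n (d i) (ph s c i)" unfolding mP_def using nei by (intro Max_in) simp_all
  have mQ: "mQ \<in> Mis n (d j) (ph s c j)" unfolding mQ_def using nej by (intro Min_in) simp_all
  have Wl: "W (pos 1 k + l) = d l" if "l < length (g c)" for l
    using W_child[of l k] that k by (simp add: d_def)
  have posS: "pos n (Suc (pos 1 k + l)) = pos n (pos 1 k + l) + length (G n [d l])" if "l < length (g c)" for l
    using pos_Suc[of n "pos 1 k + l"] Wl[OF that] by simp
  have PP: "P < pos n (Suc (pos 1 k + i))" using posS[of i] ij Mis_less[OF mP] P by simp
  also have "\<dots> \<le> pos n (pos 1 k + j)" using ij by (intro pos_mono) simp
  also have "\<dots> \<le> Q" by (simp add: Q)
  finally have "P < Q" .
  moreover have "mism x w \<phi> P" unfolding P using mi[of i mP] mP Mis_less[OF mP] ij by simp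
  moreover have "mism x w \<phi> Q" unfolding Q using mi[of j mQ] mQ Mis_less[OF mQ] ij by simp
  moreover have "\<not> mism x w \<phi> m" if m: "P < m" "m < Q" for m
  proof -
    define \<kappa> where "\<kappa> = anc n m"
    have \<kappa>: "pos n \<kappa> \<le> m" "m < pos n (Suc \<kappa>)" unfolding \<kappa>_def by (rule anc)+
    have "pos 1 k + i \<le> \<kappa>"
    proof (rule ccontr)
      assume "\<not> ?thesis"
      then have "pos n (Suc \<kappa>) \<le> pos n (pos 1 k + i)" by (intro pos_mono) simp
      then show False using \<kappa> m P by simp
    qed
    moreover have "\<kappa> \<le> pos 1 k + j"
    proof (rule ccontr)
      assume "\<not> ?thesis"
      then have "pos n (Suc (pos 1 k + j)) \<le> pos n \<kappa>" by (intro pos_mono) simp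
      then show False using \<kappa> m posS[of j] ij Mis_less[OF mQ] Q by simp
    qed
    moreover define l where "l = \<kappa> - pos 1 k"
    ultimately have l: "\<kappa> = pos 1 k + l" "i \<le> l" "l \<le> j" by (linarith+)
    then have ll: "l < length (g c)" using ij by simp
    define t where "t = m - pos n (pos 1 k + l)"
    have t: "m = pos n (pos 1 k + l) + t" using \<kappa> l by (simp add: t_def)
    have tl: "t < length (G n [d l])" using \<kappa> l posS[OF ll] t by simp
    have "t \<notin> Mis n (d l) (ph s c l)"
    proof
      assume tm: "t \<in> Mis n (d l) (ph s c l)"
      consider "l = i" | "l = j" | "i < l" "l < j" using l by linarith
      then show False
      proof cases
        case 1
        then have "t \<le> mP" unfolding mP_def using tm by (intro Max_ge) simp_all
        then show False using 1 m t P by simp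
      next
        case 2
        then have "mQ \<le> t" unfolding mQ_def using tm by (intro Min_le) simp_all
        then show False using 2 m t Q by simp
      next
        case 3
        then show False using em tm by blast
      qed
    qed
    then show ?thesis using mi[OF ll tl] t by simp
  qed
  ultimately show ?thesis by (simp add: run_def P_def Q_def)
qed

text \<open>The hypotheses on \<open>anc\<close> say that the ends separate at level
  \<open>n\<close>: they lie below one letter at level \<open>Suc n\<close>, but below different
  children of it. Nothing between them mismatches, so they are the last and the first mismatch of
  these children.\<close>

lemma run_valid:
  assumes r: "run x w \<phi> P Q" and n: "n \<ge> 1" and lt: "anc n P < anc n Q" and eq: "anc (Suc n) P = anc (Suc n) Q"
  obtains c i j s k where "valid c i j s" "W k = c" "P = left_end c i s k n" "Q = right_end c j s k n"
proof -
  define k where "k = anc (Suc n) P"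
  define c where "c = W k"
  define s where "s = (pos (Suc n) k + \<phi>) mod p"
  have c: "c \<in> A" by (simp add: c_def W_in_A)
  have s: "(pos (Suc n) k + \<phi>) mod p = s mod p" by (simp add: s_def)
  have child: "\<exists>i<length (g c). anc n R = pos 1 k + i" if "anc (Suc n) R = k" for R
  proof -
    have "anc 1 (anc n R) = k" using that by (simp only: anc_Suc[of n R])
    moreover have "pos 1 (anc 1 (anc n R)) \<le> anc n R" "anc n R < pos 1 (Suc (anc 1 (anc n R)))" by (rule anc)+
    ultimately have "pos 1 k \<le> anc n R" "anc n R < pos 1 (Suc k)" by (simp_all only:)
    then show ?thesis by (intro exI[of _ "anc n R - pos 1 k"]) (simp add: pos_Suc c_def)
  qed
  obtain i where i: "i < length (g c)" "anc n P = pos 1 k + i" using child[of P] by (auto simp: k_def)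
  obtain j where j: "j < length (g c)" "anc n Q = pos 1 k + j" using child[of Q] eq by (auto simp: k_def)
  have ij: "i < j" using lt i j by simp
  define d where "d l = g c ! l" for l
  have dA: "d l \<in> A" if "l < length (g c)" for l using g_nth_in_A[OF c that] by (simp add: d_def)
  have mi: "mism x w \<phi> (pos n (pos 1 k + l) + m) \<longleftrightarrow> m \<in> Mis n (d l) (ph s c l)"
    if "l < length (g c)" "m < length (G n [d l])" for l m
    using mism_child_iff[of l k n \<phi> s m] that n s by (simp add: d_def c_def)
  have Wl: "W (pos 1 k + l) = d l" if "l < length (g c)" for l
    using W_child[of l k] that by (simp add: d_def c_def)
  have posS: "pos n (Suc (pos 1 k + l)) = pos n (pos 1 k + l) + length (G n [d l])" if "l < length (g c)" for l
    using pos_Suc[of n "pos 1 k + l"] Wl[OF that] by simp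
  define mP where "mP = P - pos n (pos 1 k + i)"
  define mQ where "mQ = Q - pos n (pos 1 k + j)"
  have P: "P = pos n (pos 1 k + i) + mP" "mP < length (G n [d i])"
    using anc(1)[of n P] anc(2)[of P n] i posS[OF i(1)] by (auto simp: mP_def)
  have Q: "Q = pos n (pos 1 k + j) + mQ" "mQ < length (G n [d j])"
    using anc(1)[of n Q] anc(2)[of Q n] j posS[OF j(1)] by (auto simp: mQ_def)
  have mP: "mP \<in> Mis n (d i) (ph s c i)" using mi[OF i(1) P(2)] r P(1) by (simp add: run_def)
  have mQ: "mQ \<in> Mis n (d j) (ph s c j)" using mi[OF j(1) Q(2)] r Q(1) by (simp add: run_def)
  have between: "\<not> mism x w \<phi> m" if "P < m" "m < Q" for m using r that by (simp add: run_def)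
  have le: "pos n (pos 1 k + l) + length (G n [d l]) \<le> pos n (pos 1 k + l')" if "l < l'" "l < length (g c)" for l l'
    using posS[OF that(2)] pos_mono[of "Suc (pos 1 k + l)" "pos 1 k + l'" n] that by simp
  have "Max (Mis n (d i) (ph s c i)) = mP"
  proof (rule Max_eqI)
    fix t assume t: "t \<in> Mis n (d i) (ph s c i)"
    show "t \<le> mP"
    proof (rule ccontr)
      assume "\<not> ?thesis"
      then have "P < pos n (pos 1 k + i) + t" "pos n (pos 1 k + i) + t < Q"
        using P(1) Mis_less[OF t] le[OF ij i(1)] Q(1) by auto
      then show False using between mi[OF i(1) Mis_less[OF t]] t by blast
    qed
  qed (use mP in simp_all)
  then have PL: "P = left_end c i s k n" using P(1) by (simp add: left_end_def d_def)
  have "Min (Mis n (d j) (ph s c j)) = mQ"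
  proof (rule Min_eqI)
    fix t assume t: "t \<in> Mis n (d j) (ph s c j)"
    show "mQ \<le> t"
    proof (rule ccontr)
      assume "\<not> ?thesis"
      then have "P < pos n (pos 1 k + j) + t" "pos n (pos 1 k + j) + t < Q"
        using P le[OF ij i(1)] Q(1) by auto
      then show False using between mi[OF j(1) Mis_less[OF t]] t by blast
    qed
  qed (use mQ in simp_all)
  then have QR: "Q = right_end c j s k n" using Q(1) by (simp add: right_end_def d_def)
  have em: "Mis n (d l) (ph s c l) = {}" if l: "i < l" "l < j" for l
  proof (rule ccontr)
    have ll: "l < length (g c)" using l j by simp
    assume "Mis n (d l) (ph s c l) \<noteq> {}"
    then obtain t where t: "t \<in> Mis n (d l) (ph s c l)" by blast
    then have "P < pos n (pos 1 k + l) + t" "pos n (pos 1 k + l) + t < Q"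
      using P le[OF l(1) i(1)] Q(1) le[OF l(2) ll] Mis_less[OF t] by auto
    then show False using between mi[OF ll Mis_less[OF t]] t by blast
  qed
  have "reads \<tau> x (g (d l)) (ph s c l)" if l: "i < l" "l < j" for l
    using Mis_empty_stable[OF dA n, of l "ph s c l"] em[OF l] l j(1) by simp
  moreover have "\<not> reads \<tau> x (g (d i)) (ph s c i)" using Mis_empty_stable[OF dA[OF i(1)] n] mP by blast
  moreover have "\<not> reads \<tau> x (g (d j)) (ph s c j)" using Mis_empty_stable[OF dA[OF j(1)] n] mQ by blast
  moreover have "s < p" using p by (simp add: s_def)
  ultimately have "valid c i j s" using c ij j(1) by (simp add: valid_def d_def)
  then show ?thesis using that PL QR c_def by blast
qed

text \<open>At level 0 the ends have different ancestors; at level \<open>Q\<close> both lie in the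
  image of the first letter. The level sought precedes the least one at which the ancestors
  agree.\<close>

lemma run_level:
  assumes "run x w \<phi> P Q"
  obtains n where "anc n P < anc n Q" "anc (Suc n) P = anc (Suc n) Q"
proof -
  have PQ: "P < Q" using assms by (simp add: run_def)
  define n0 where "n0 = (LEAST n. anc n P = anc n Q)"
  have "Q < N Q" "P < N Q" using N_gt[of Q] PQ by auto
  then have "anc Q P = anc Q Q" by (simp add: anc_eq_0)
  then have n0: "anc n0 P = anc n0 Q" unfolding n0_def by (rule LeastI)
  have "n0 \<noteq> 0" using n0 PQ by (metis anc_0 less_irrefl)
  then obtain n where n: "n0 = Suc n" by (cases n0) auto
  have "anc n P \<noteq> anc n Q" using not_less_Least[of n "\<lambda>n. anc n P = anc n Q"] n by (simp add: n0_def)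
  then have "anc n P < anc n Q" using anc_mono[of P Q n] PQ by simp
  then show ?thesis using that n0 n by blast
qed

lemma length_bound: "\<exists>B\<ge>1. \<forall>c\<in>A. length (g c) \<le> B"
  using A(1) by (intro exI[of _ "Max (insert 1 ((\<lambda>c. length (g c)) ` A))"]) auto

text \<open>If a run that starts before the image of \<open>y\<close> covers \<open>p\<close> consecutive images of \<open>y\<close>, then
  it covers all of them, contradicting aperiodicity.\<close>

lemma run_linear_bound: "\<exists>K. \<forall>\<phi> P Q. run x w \<phi> P Q \<longrightarrow> Q \<le> K * (P + 1)"
proof -
  obtain B where B: "B \<ge> 1" "\<And>c. c \<in> A \<Longrightarrow> length (g c) \<le> B" using length_bound by blast
  have "Q \<le> B ^ (p + 1) * (P + 1)" if r: "run x w \<phi> P Q" for \<phi> P Q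
  proof -
    \<comment> \<open>\<open>P\<close> lies before position \<open>N (Suc n)\<close>, where
      \<open>G (Suc n) y\<close> starts, and minimality gives \<open>N n \<le> P + 1\<close>. The
      \<open>p + 1\<close> levels up to \<open>N (Suc n + p)\<close> cost the factor
      \<open>B ^ (p + 1)\<close>.\<close>
    define n where "n = (LEAST n. P < N (Suc n))"
    have "P < N (Suc P)" using N_gt[of "Suc P"] by simp
    then have n: "P < N (Suc n)" unfolding n_def by (rule LeastI)
    have Nn: "N n \<le> P + 1"
    proof (cases n)
      case (Suc m)
      then have "\<not> P < N (Suc m)" using not_less_Least[of m "\<lambda>n. P < N (Suc n)"] by (simp add: n_def)
      then show ?thesis using Suc by simp
    qed simp
    have "Q < N (Suc n + p)"
    proof (rule ccontr)
      assume "\<not> ?thesis"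
      then have ok: "\<not> mism x w \<phi> m" if "N (Suc n) \<le> m" "m < N (Suc n + p)" for m
        using r that n by (auto simp: run_def)
      define l where "l = length (hext g y)"
      have block: "G (Suc n + j) y ! i = W (N (Suc n + j) + i)" if "i < length (G (Suc n + j) y)" for i j
      proof -
        have "N (Suc n + j) + i < N (Suc (Suc n + j))" using that by (simp only: N_Suc)
        then have "W (N (Suc n + j) + i) = (G (Suc n + j) [a] @ G (Suc n + j) y) ! (N (Suc n + j) + i)"
          by (simp only: W_nth G_Suc_a)
        then show ?thesis by (simp add: N_def del: funpow.simps)
      qed
      have ph: "(N (Suc n + j) + \<phi>) mod p = (N (Suc n) + \<phi> + j * l) mod p" for j
      proof (induction j)
        case (Suc j)
        have "length (G (Suc n + j) y) mod p = l mod p"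
          unfolding l_def by (rule stable_length_word[OF y(3)]) simp
        then have "(N (Suc n + j) + \<phi> + length (G (Suc n + j) y)) mod p = (N (Suc n) + \<phi> + j * l + l) mod p"
          by (rule mod_add_cong[OF Suc])
        moreover have "N (Suc n + Suc j) = N (Suc n + j) + length (G (Suc n + j) y)"
          using N_Suc[of "Suc n + j"] by (simp only: add_Suc_right)
        ultimately show ?case by (simp add: algebra_simps del: funpow.simps)
      qed simp
      have rd: "reads \<tau> x (G (Suc n + j) y) (N (Suc n + j) + \<phi>) \<longleftrightarrow> reads \<tau> x (hext g y) (N (Suc n) + \<phi> + j * l)" for j
        using stable_reads_word[OF y(3), of "Suc n + j"] reads_cong[OF ph[of j]] by simp
      have "reads \<tau> x (hext g y) (N (Suc n) + \<phi> + j * l)" if "j < p" for j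
      proof -
        have "reads \<tau> x (G (Suc n + j) y) (N (Suc n + j) + \<phi>)"
          unfolding reads_def
        proof (intro allI impI)
          fix i assume i: "i < length (G (Suc n + j) y)"
          have "N (Suc n) \<le> N (Suc n + j) + i" using N_mono[of "Suc n" "Suc n + j"] by simp
          moreover have "N (Suc n + j) + i < N (Suc (Suc n + j))" using i by (simp only: N_Suc)
          moreover have "N (Suc (Suc n + j)) \<le> N (Suc n + p)" using that by (intro N_mono) simp
          ultimately have "\<not> mism x w \<phi> (N (Suc n + j) + i)" by (intro ok) simp_all
          then show "\<tau> (G (Suc n + j) y ! i) = x ! ((N (Suc n + j) + \<phi> + i) mod p)"
            by (simp only: block[OF i]) (simp add: mism_def add_ac)
        qed
        then show ?thesis using rd by simp
      qed
      \<comment> \<open>The phase advances by the same residue \<open>l\<close> at each image, so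
        \<open>p\<close> consecutive images already meet every phase that can occur.\<close>
      then have all: "reads \<tau> x (hext g y) (N (Suc n) + \<phi> + j * l)" for j
      proof -
        assume *: "\<And>j. j < p \<Longrightarrow> reads \<tau> x (hext g y) (N (Suc n) + \<phi> + j * l)"
        have "(j * l) mod p = ((j mod p) * l) mod p" by (simp add: mod_mult_left_eq)
        then have "(N (Suc n) + \<phi> + j * l) mod p = (N (Suc n) + \<phi> + (j mod p) * l) mod p"
          by (rule mod_add_cong[OF refl])
        then have "reads \<tau> x (hext g y) (N (Suc n) + \<phi> + j * l) = reads \<tau> x (hext g y) (N (Suc n) + \<phi> + (j mod p) * l)"
          by (rule reads_cong)
        then show ?thesis using *[OF mod_less_divisor[OF p], of j] by simp
      qed
      have "\<not> mism x w \<phi> m" if "m \<ge> N (Suc n)" for m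
      proof -
        define e where "e = (LEAST e. m < N (Suc n + Suc e))"
        have "m < N (Suc n + Suc m)" using N_gt[of "Suc n + Suc m"] by simp
        then have e1: "m < N (Suc n + Suc e)" unfolding e_def by (rule LeastI)
        have e2: "N (Suc n + e) \<le> m"
        proof (cases e)
          case (Suc e')
          then show ?thesis using not_less_Least[of e' "\<lambda>e. m < N (Suc n + Suc e)"] by (simp add: e_def)
        qed (use that in simp)
        define i where "i = m - N (Suc n + e)"
        have m: "m = N (Suc n + e) + i" using e2 by (simp add: i_def)
        have i: "i < length (G (Suc n + e) y)" using e1 m N_Suc[of "Suc n + e"] by (simp only: add_Suc_right)
        have "reads \<tau> x (G (Suc n + e) y) (N (Suc n + e) + \<phi>)" using all rd by simp
        then have "\<tau> (G (Suc n + e) y ! i) = x ! ((N (Suc n + e) + \<phi> + i) mod p)"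
          using i unfolding reads_def by blast
        then show ?thesis by (simp only: block[OF i]) (simp add: mism_def m add_ac)
      qed
      then show False using aperiodic[of "N (Suc n)" \<phi>] by blast
    qed
    also have "N (Suc n + p) = length (G (p + 1) (G n [a]))"
      unfolding N_def hext_pow_add[symmetric] by (simp only: add_ac add_Suc_right add_0_right plus_1_eq_Suc add_Suc)
    also have "\<dots> \<le> B ^ (p + 1) * length (G n [a])"
      using A(2) by (intro length_hext_pow_le[OF A(3) set_G B(2)]) simp_all
    also have "\<dots> \<le> B ^ (p + 1) * (P + 1)" using Nn by (intro mult_le_mono) (simp_all add: N_def)
    finally show ?thesis by simp
  qed
  then show ?thesis by blast
qed

end

section \<open>Linear recurrences for the ends of runs\<close>

abbreviation uniform_on :: "nat set \<Rightarrow> (nat \<Rightarrow> nat list) \<Rightarrow> bool" where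
  "uniform_on A h \<equiv> \<exists>m. \<forall>c\<in>A. length (h c) = m"

lemma hext_pow_split_nth:
  assumes "i < length u"
  shows "length ((hext h ^^ n) (take (Suc i) u)) = length ((hext h ^^ n) (take i u)) + length ((hext h ^^ n) [u ! i])"
    and "t < length ((hext h ^^ n) [u ! i]) \<Longrightarrow> length ((hext h ^^ n) (take i u)) + t < length ((hext h ^^ n) u) \<and>
      (hext h ^^ n) u ! (length ((hext h ^^ n) (take i u)) + t) = (hext h ^^ n) [u ! i] ! t"
proof -
  have "take (Suc i) u = take i u @ [u ! i]" using assms by (rule take_Suc_conv_app_nth)
  then show "length ((hext h ^^ n) (take (Suc i) u)) = length ((hext h ^^ n) (take i u)) + length ((hext h ^^ n) [u ! i])"
    by (simp only: hext_pow_append length_append)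
  have "u = take i u @ [u ! i] @ drop (Suc i) u" using id_take_nth_drop[OF assms] by simp
  then have eq: "(hext h ^^ n) u = (hext h ^^ n) (take i u) @ (hext h ^^ n) [u ! i] @ (hext h ^^ n) (drop (Suc i) u)"
    by (metis hext_pow_append)
  assume t: "t < length ((hext h ^^ n) [u ! i])"
  show "length ((hext h ^^ n) (take i u)) + t < length ((hext h ^^ n) u) \<and>
      (hext h ^^ n) u ! (length ((hext h ^^ n) (take i u)) + t) = (hext h ^^ n) [u ! i] ! t"
    unfolding eq using t by (simp add: nth_append)
qed

lemma hext_pow_index:
  assumes "m < length ((hext h ^^ n) u)"
  obtains i t where "i < length u" "t < length ((hext h ^^ n) [u ! i])" "m = length ((hext h ^^ n) (take i u)) + t"
  using assms
proof (induction u arbitrary: m thesis)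
  case (Cons c u)
  show ?case
  proof (cases "m < length ((hext h ^^ n) [c])")
    case True
    then show ?thesis using Cons.prems(1)[of 0 m] by simp
  next
    case False
    define m' where "m' = m - length ((hext h ^^ n) [c])"
    have m: "m = length ((hext h ^^ n) [c]) + m'" using False by (simp add: m'_def)
    have "m' < length ((hext h ^^ n) u)" using Cons.prems(2) m by (simp add: hext_pow_Cons[of n h c u])
    then obtain i t where it: "i < length u" "t < length ((hext h ^^ n) [u ! i])" "m' = length ((hext h ^^ n) (take i u)) + t"
      using Cons.IH by blast
    have "m = length ((hext h ^^ n) (take (Suc i) (c # u))) + t"
      using m it(3) by (simp add: hext_pow_Cons[of n h c "take i u"])
    then show ?thesis using Cons.prems(1)[of "Suc i" t] it by simp
  qed
qed simp

context stable_morphic_word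
begin

section \<open>First and last mismatches under iteration\<close>

lemma Mis_Suc:
  assumes c: "c \<in> A" and n: "n \<ge> 1"
  shows "m \<in> Mis (Suc n) c s \<longleftrightarrow>
    (\<exists>i<length (g c). \<exists>t\<in>Mis n (g c ! i) (ph s c i). m = length (G n (take i (g c))) + t)"
proof -
  have phase: "(s + (length (G n (take i (g c))) + t)) mod p = (ph s c i + t) mod p" for i t
  proof -
    have "set (take i (g c)) \<subseteq> A" using A(3)[OF c] set_take_subset by fastforce
    then have "length (G n (take i (g c))) mod p = length (hext g (take i (g c))) mod p"
      using n by (rule stable_length_word)
    then have "(s + length (G n (take i (g c)))) mod p = (s + length (hext g (take i (g c)))) mod p"
      by (rule mod_add_cong[OF refl])
    then have "(s + length (G n (take i (g c)))) mod p = ph s c i mod p" by (simp add: ph_def)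
    then have "(s + length (G n (take i (g c))) + t) mod p = (ph s c i + t) mod p"
      by (rule mod_add_cong[OF _ refl])
    then show ?thesis by (simp add: add.assoc)
  qed
  show ?thesis
  proof
    assume m: "m \<in> Mis (Suc n) c s"
    then have ml: "m < length (G n (g c))" by (simp add: Mis_def G_Suc del: funpow.simps)
    obtain i t where it: "i < length (g c)" "t < length (G n [g c ! i])" "m = length (G n (take i (g c))) + t"
      by (rule hext_pow_index[OF ml]) (rule that, assumption+)
    have "G n (g c) ! m = G n [g c ! i] ! t" using hext_pow_split_nth(2)[OF it(1,2)] it(3) by simp
    then have "t \<in> Mis n (g c ! i) (ph s c i)"
      using m it(2) phase[of i t] it(3) by (simp add: Mis_def G_Suc del: funpow.simps)
    then show "\<exists>i<length (g c). \<exists>t\<in>Mis n (g c ! i) (ph s c i). m = length (G n (take i (g c))) + t"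
      using it by blast
  next
    assume "\<exists>i<length (g c). \<exists>t\<in>Mis n (g c ! i) (ph s c i). m = length (G n (take i (g c))) + t"
    then obtain i t where it: "i < length (g c)" "t \<in> Mis n (g c ! i) (ph s c i)" "m = length (G n (take i (g c))) + t"
      by blast
    have "length (G n (take i (g c))) + t < length (G n (g c)) \<and> G n (g c) ! (length (G n (take i (g c))) + t) = G n [g c ! i] ! t"
      by (rule hext_pow_split_nth(2)[OF it(1) Mis_less[OF it(2)]])
    then show "m \<in> Mis (Suc n) c s"
      using it phase[of i t] by (simp add: Mis_def G_Suc del: funpow.simps)
  qed
qed

lemma length_take_mono: "i \<le> j \<Longrightarrow> length (G n (take i u)) \<le> length (G n (take j u))"
proof -
  assume "i \<le> j"
  then have "take j u = take i u @ take (j - i) (drop i u)" by (simp flip: take_add)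
  then show ?thesis by (simp add: hext_pow_append)
qed

definition "bad c s = {i. i < length (g c) \<and> \<not> reads \<tau> x (g (g c ! i)) (ph s c i)}"

lemma finite_bad [simp]: "finite (bad c s)"
  by (simp add: bad_def)

lemma bad_iff:
  assumes "c \<in> A" "n \<ge> 1" "i < length (g c)"
  shows "i \<in> bad c s \<longleftrightarrow> Mis n (g c ! i) (ph s c i) \<noteq> {}"
  using Mis_empty_stable[OF g_nth_in_A[OF assms(1,3)] assms(2)] assms(3) by (simp add: bad_def)

lemma Mis_Suc_less:
  assumes "t \<in> Mis n (g c ! i) s" "i < j" "i < length (g c)"
  shows "length (G n (take i (g c))) + t < length (G n (take j (g c)))"
proof -
  have "length (G n (take i (g c))) + t < length (G n (take (Suc i) (g c)))"
    using Mis_less[OF assms(1)] hext_pow_split_nth(1)[OF assms(3)] by simp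
  also have "\<dots> \<le> length (G n (take j (g c)))" using assms(2) by (intro length_take_mono) simp
  finally show ?thesis .
qed

text \<open>The set of children with a mismatch is the same at all levels from 1 on. The last
  mismatch hence always lies in the same child, which gives a recursion with constant
  coefficients.\<close>

lemma Max_Mis_Suc:
  assumes c: "c \<in> A" and n: "n \<ge> 1" and ne: "bad c s \<noteq> {}"
  defines "i \<equiv> Max (bad c s)"
  shows "Max (Mis (Suc n) c s) = length (G n (take i (g c))) + Max (Mis n (g c ! i) (ph s c i))"
proof (rule Max_eqI)
  have i: "i \<in> bad c s" unfolding i_def using ne by (intro Max_in) simp_all
  then have il: "i < length (g c)" by (simp add: bad_def)
  have "Mis n (g c ! i) (ph s c i) \<noteq> {}" using bad_iff[OF c n il] i by simp
  then have "Max (Mis n (g c ! i) (ph s c i)) \<in> Mis n (g c ! i) (ph s c i)" by (intro Max_in) simp_all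
  then show "length (G n (take i (g c))) + Max (Mis n (g c ! i) (ph s c i)) \<in> Mis (Suc n) c s"
    unfolding Mis_Suc[OF c n] using il by blast
  fix m assume "m \<in> Mis (Suc n) c s"
  then obtain j t where j: "j < length (g c)" and t: "t \<in> Mis n (g c ! j) (ph s c j)"
    and m: "m = length (G n (take j (g c))) + t" unfolding Mis_Suc[OF c n] by blast
  have "j \<in> bad c s" using bad_iff[OF c n j] t by blast
  then have "j \<le> i" unfolding i_def by simp
  then consider "j = i" | "j < i" by linarith
  then show "m \<le> length (G n (take i (g c))) + Max (Mis n (g c ! i) (ph s c i))"
  proof cases
    case 1
    then show ?thesis using t m by simp
  next
    case 2
    then show ?thesis using Mis_Suc_less[OF t 2 j] m by simp
  qed
qed simp

lemma Min_Mis_Suc: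
  assumes c: "c \<in> A" and n: "n \<ge> 1" and ne: "bad c s \<noteq> {}"
  defines "i \<equiv> Min (bad c s)"
  shows "Min (Mis (Suc n) c s) = length (G n (take i (g c))) + Min (Mis n (g c ! i) (ph s c i))"
proof (rule Min_eqI)
  have i: "i \<in> bad c s" unfolding i_def using ne by (intro Min_in) simp_all
  then have il: "i < length (g c)" by (simp add: bad_def)
  have "Mis n (g c ! i) (ph s c i) \<noteq> {}" using bad_iff[OF c n il] i by simp
  then have mi: "Min (Mis n (g c ! i) (ph s c i)) \<in> Mis n (g c ! i) (ph s c i)" by (intro Min_in) simp_all
  then show "length (G n (take i (g c))) + Min (Mis n (g c ! i) (ph s c i)) \<in> Mis (Suc n) c s"
    unfolding Mis_Suc[OF c n] using il by blast
  fix m assume "m \<in> Mis (Suc n) c s"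
  then obtain j t where j: "j < length (g c)" and t: "t \<in> Mis n (g c ! j) (ph s c j)"
    and m: "m = length (G n (take j (g c))) + t" unfolding Mis_Suc[OF c n] by blast
  have "j \<in> bad c s" using bad_iff[OF c n j] t by blast
  then have "i \<le> j" unfolding i_def by simp
  then consider "j = i" | "i < j" by linarith
  then show "length (G n (take i (g c))) + Min (Mis n (g c ! i) (ph s c i)) \<le> m"
  proof cases
    case 1
    then show ?thesis using t m by simp
  next
    case 2
    then show ?thesis using Mis_Suc_less[OF mi 2 il] m by simp
  qed
qed simp

lemma Mis_Suc_empty: "c \<in> A \<Longrightarrow> n \<ge> 1 \<Longrightarrow> Mis (Suc n) c s = {} \<longleftrightarrow> bad c s = {}"
proof -
  assume c: "c \<in> A" and n: "n \<ge> 1"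
  have "Mis (Suc n) c s \<noteq> {} \<longleftrightarrow> (\<exists>i<length (g c). Mis n (g c ! i) (ph s c i) \<noteq> {})"
    using Mis_Suc[OF c n] by blast
  also have "\<dots> \<longleftrightarrow> (\<exists>i<length (g c). i \<in> bad c s)" using bad_iff[OF c n] by blast
  also have "\<dots> \<longleftrightarrow> bad c s \<noteq> {}" by (auto simp: bad_def)
  finally show ?thesis by blast
qed

text \<open>The state vector: image lengths, and the last (\<open>True\<close>) and first (\<open>False\<close>) mismatch
  positions in the images of letters, which are \<open>0\<close> by convention if there is no mismatch.\<close>

definition states :: "(nat + bool \<times> nat \<times> nat) set" where
  "states = Inl ` A \<union> Inr ` (UNIV \<times> A \<times> {..<p})"

definition state_vec :: "nat \<Rightarrow> nat + bool \<times> nat \<times> nat \<Rightarrow> nat" where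
  "state_vec n e = (case e of Inl c \<Rightarrow> length (G n [c])
     | Inr (b, c, s) \<Rightarrow> if Mis n c s = {} then 0 else if b then Max (Mis n c s) else Min (Mis n c s))"

lemma finite_states: "finite states"
  using A(1) by (simp add: states_def)

text \<open>Coefficients are natural numbers because state elimination relies on nonnegativity;
  level 0 is left out because stability starts at level 1.\<close>

definition linear_comb :: "(nat \<Rightarrow> nat) \<Rightarrow> bool" where
  "linear_comb f \<longleftrightarrow> (\<exists>\<alpha>. \<forall>n\<ge>1. f n = (\<Sum>e\<in>states. \<alpha> e * state_vec n e))"

lemma linear_comb_0: "linear_comb (\<lambda>n. 0)"
  unfolding linear_comb_def by (rule exI[of _ "\<lambda>_. 0"]) simp

lemma linear_comb_add: "linear_comb f \<Longrightarrow> linear_comb f' \<Longrightarrow> linear_comb (\<lambda>n. f n + f' n)"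
proof -
  assume "linear_comb f" "linear_comb f'"
  then obtain \<alpha> \<beta> where "\<And>n. n \<ge> 1 \<Longrightarrow> f n = (\<Sum>e\<in>states. \<alpha> e * state_vec n e)"
    "\<And>n. n \<ge> 1 \<Longrightarrow> f' n = (\<Sum>e\<in>states. \<beta> e * state_vec n e)" unfolding linear_comb_def by blast
  then show ?thesis unfolding linear_comb_def
    by (intro exI[of _ "\<lambda>e. \<alpha> e + \<beta> e"]) (simp add: algebra_simps sum.distrib)
qed

lemma linear_comb_cong: "linear_comb f \<Longrightarrow> (\<And>n. n \<ge> 1 \<Longrightarrow> f' n = f n) \<Longrightarrow> linear_comb f'"
  unfolding linear_comb_def by simp

lemma linear_comb_state: "e \<in> states \<Longrightarrow> linear_comb (\<lambda>n. state_vec n e)"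
  unfolding linear_comb_def
  by (rule exI[of _ "\<lambda>e'. of_bool (e' = e)"])
     (simp add: finite_states of_bool_def if_distrib[of "\<lambda>x. x * _"] cong: if_cong)

lemma linear_comb_length: "set u \<subseteq> A \<Longrightarrow> linear_comb (\<lambda>n. length (G n u))"
proof (induction u)
  case Nil
  then show ?case by (simp add: linear_comb_0)
next
  case (Cons c u)
  have "linear_comb (\<lambda>n. state_vec n (Inl c))" using Cons.prems by (intro linear_comb_state) (simp add: states_def)
  then have "linear_comb (\<lambda>n. state_vec n (Inl c) + length (G n u))" using Cons by (intro linear_comb_add) simp_all
  then show ?case by (rule linear_comb_cong) (simp add: state_vec_def hext_pow_Cons[of _ g c u])
qed

lemma linear_comb_state_Suc:
  assumes "e \<in> states"
  shows "linear_comb (\<lambda>n. state_vec (Suc n) e)"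
proof (cases e)
  case (Inl c)
  then have "c \<in> A" using assms by (auto simp: states_def)
  then have "linear_comb (\<lambda>n. length (G n (g c)))" by (intro linear_comb_length A)
  then show ?thesis by (rule linear_comb_cong) (simp add: Inl state_vec_def G_Suc del: funpow.simps)
next
  case (Inr e')
  obtain b c s where e': "e' = (b, c, s)" by (cases e') auto
  have c: "c \<in> A" using assms by (auto simp: states_def Inr e')
  show ?thesis
  proof (cases "bad c s = {}")
    case True
    show ?thesis
      by (rule linear_comb_cong[OF linear_comb_0]) (simp add: Inr e' state_vec_def Mis_Suc_empty[OF c] True del: funpow.simps)
  next
    case False
    define i where "i = (if b then Max (bad c s) else Min (bad c s))"
    have "i \<in> bad c s" using False Max_in[of "bad c s"] Min_in[of "bad c s"] by (simp add: i_def)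
    then have i: "i \<in> bad c s" "i < length (g c)" by (simp_all add: bad_def)
    define e2 where "e2 = (Inr (b, g c ! i, ph s c i) :: nat + bool \<times> nat \<times> nat)"
    have "e2 \<in> states" using g_nth_in_A[OF c i(2)] ph_less by (simp add: e2_def states_def)
    moreover have "set (take i (g c)) \<subseteq> A" using A(3)[OF c] set_take_subset by fastforce
    ultimately have "linear_comb (\<lambda>n. length (G n (take i (g c))) + state_vec n e2)"
      by (intro linear_comb_add linear_comb_state linear_comb_length)
    then show ?thesis
    proof (rule linear_comb_cong)
      fix n :: nat assume n: "n \<ge> 1"
      have "Mis (Suc n) c s \<noteq> {}" using Mis_Suc_empty[OF c n] False by simp
      moreover have "Mis n (g c ! i) (ph s c i) \<noteq> {}" using bad_iff[OF c n i(2)] i(1) by simp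
      ultimately show "state_vec (Suc n) e = length (G n (take i (g c))) + state_vec n e2"
        using Max_Mis_Suc[OF c n False] Min_Mis_Suc[OF c n False]
        by (cases b) (simp_all add: state_vec_def Inr e' e2_def i_def del: funpow.simps)
    qed
  qed
qed

lemma linear_comb_subsequences:
  obtains q where "q \<ge> 1" "\<And>f r. linear_comb f \<Longrightarrow> dominated_fps (Abs_fps (\<lambda>t. real (f (Suc (q * t + r)))))"
proof -
  have "\<forall>e\<in>states. \<exists>\<alpha>. \<forall>n\<ge>1. state_vec (Suc n) e = (\<Sum>e'\<in>states. \<alpha> e' * state_vec n e')"
    using linear_comb_state_Suc by (simp add: linear_comb_def)
  then obtain M where M: "\<And>e n. e \<in> states \<Longrightarrow> n \<ge> 1 \<Longrightarrow> state_vec (Suc n) e = (\<Sum>e'\<in>states. M e e' * state_vec n e')"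
    by (metis (no_types))
  obtain q where q: "q \<ge> 1" "\<And>r e. e \<in> states \<Longrightarrow> dominated_fps (Abs_fps (\<lambda>t. real (state_vec (Suc (q * t + r)) e)))"
  \<comment> \<open>Shifting the level by one makes the recurrence valid from time 0.\<close>
  proof (rule linear_system_subsequences[OF finite_states, of "\<lambda>n. state_vec (Suc n)" M])
    show "state_vec (Suc (Suc t)) d = (\<Sum>e\<in>states. M d e * state_vec (Suc t) e)" if "d \<in> states" for t d
      using M[OF that, of "Suc t"] by simp
  qed (rule that, assumption+)
  have "dominated_fps (Abs_fps (\<lambda>t. real (f (Suc (q * t + r)))))" if f: "linear_comb f" for f r
  proof -
    obtain \<alpha> where \<alpha>: "\<And>n. n \<ge> 1 \<Longrightarrow> f n = (\<Sum>e\<in>states. \<alpha> e * state_vec n e)"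
      using f unfolding linear_comb_def by blast
    have "Abs_fps (\<lambda>t. real (f (Suc (q * t + r)))) =
        (\<Sum>e\<in>states. fps_const (real (\<alpha> e)) * Abs_fps (\<lambda>t. real (state_vec (Suc (q * t + r)) e)))"
      by (simp add: fps_eq_iff fps_sum_nth \<alpha>)
    also have "dominated_fps \<dots>"
      by (intro dominated_fps_sum dominated_fps_mult dominated_fps_const q(2) finite_states)
    finally show ?thesis .
  qed
  then show ?thesis using that q by blast
qed

section \<open>Asymptotics of the ends of runs\<close>

lemma set_pre: "set (pre k) \<subseteq> A"
  using W_in_A by (auto simp: pre_def)

lemma valid_nonempty:
  assumes "valid c i j s" "n \<ge> 1"
  shows "Mis n (g c ! i) (ph s c i) \<noteq> {}" "Mis n (g c ! j) (ph s c j) \<noteq> {}"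
proof -
  have "c \<in> A" "i < length (g c)" "j < length (g c)" using assms(1) by (auto simp: valid_def)
  then show "Mis n (g c ! i) (ph s c i) \<noteq> {}" "Mis n (g c ! j) (ph s c j) \<noteq> {}"
    using assms(1) Mis_empty_stable[OF g_nth_in_A assms(2)] by (auto simp: valid_def)
qed

text \<open>For fixed \<open>k\<close> the image of a child starts at the length of the image of a
  fixed finite prefix of \<open>W\<close>; the extremal mismatch is one further state.\<close>

lemma linear_comb_ends:
  assumes v: "valid c i j s"
  shows "linear_comb (left_end c i s k)" "linear_comb (right_end c j s k)"
proof -
  have ij: "c \<in> A" "i < length (g c)" "j < length (g c)" using v by (auto simp: valid_def)
  have st: "Inr (b, g c ! l, ph s c l) \<in> states" if "l < length (g c)" for b l
    using g_nth_in_A[OF ij(1) that] ph_less by (simp add: states_def)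
  have "linear_comb (\<lambda>n. length (G n (pre (pos 1 k + i))) + state_vec n (Inr (True, g c ! i, ph s c i)))"
    by (intro linear_comb_add linear_comb_length linear_comb_state st ij set_pre)
  then show "linear_comb (left_end c i s k)"
    by (rule linear_comb_cong) (simp add: left_end_def state_vec_def valid_nonempty[OF v] pos_def)
  have "linear_comb (\<lambda>n. length (G n (pre (pos 1 k + j))) + state_vec n (Inr (False, g c ! j, ph s c j)))"
    by (intro linear_comb_add linear_comb_length linear_comb_state st ij set_pre)
  then show "linear_comb (right_end c j s k)"
    by (rule linear_comb_cong) (simp add: right_end_def state_vec_def valid_nonempty[OF v] pos_def)
qed

lemma valid_run_exists:
  assumes v: "valid c i j s" and k: "W k = c" and n: "n \<ge> 1"
  shows "\<exists>\<phi>. run x w \<phi> (left_end c i s k n) (right_end c j s k n)"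
proof -
  define m where "m = pos (Suc n) k"
  \<comment> \<open>The phase \<open>s - m\<close> modulo \<open>p\<close>, written without
    subtraction.\<close>
  have "m + (s + m * (p - 1)) = s + m * p" using p by (cases p) auto
  then have "(m + (s + m * (p - 1))) mod p = s mod p" by (simp only: mod_mult_self1)
  also have "\<dots> = s" using v by (simp add: valid_def)
  finally show ?thesis using valid_run[OF v k n] unfolding m_def by blast
qed

text \<open>Since \<open>j > i\<close>, the right end lies beyond the image of the first letter of
  \<open>W\<close>, which provides the lower bound \<open>N n\<close>.\<close>

lemma right_end_bounds:
  assumes v: "valid c i j s" and k: "W k = c" and n: "n \<ge> 1"
  shows "N n \<le> right_end c j s k n" "right_end c j s k n < pos (Suc n) (Suc k)"
proof -
  have ij: "c \<in> A" "i < j" "j < length (g c)" using v by (auto simp: valid_def)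
  have "N n = pos n (Suc 0)" by (simp add: pos_1_right)
  also have "\<dots> \<le> pos n (pos 1 k + j)" using ij by (intro pos_mono) simp
  finally show "N n \<le> right_end c j s k n" by (simp add: right_end_def)
  have "Min (Mis n (g c ! j) (ph s c j)) \<in> Mis n (g c ! j) (ph s c j)"
    using valid_nonempty[OF v n] by (intro Min_in) simp_all
  then have "right_end c j s k n < pos n (pos 1 k + j) + length (G n [W (pos 1 k + j)])"
    using Mis_less W_child[of j k] ij k by (simp add: right_end_def)
  also have "\<dots> = pos n (Suc (pos 1 k + j))" by (simp add: pos_Suc)
  also have "\<dots> \<le> pos n (pos 1 (Suc k))"
    using ij k by (intro pos_mono) (simp add: pos_Suc)
  also have "\<dots> = pos (Suc n) (Suc k)" using pos_pos[of n 1 "Suc k"] by simp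
  finally show "right_end c j s k n < pos (Suc n) (Suc k)" .
qed

lemma left_end_linear_bound:
  obtains K where "K \<ge> 1" "\<And>c i j s k n. valid c i j s \<Longrightarrow> W k = c \<Longrightarrow> n \<ge> 1 \<Longrightarrow>
    right_end c j s k n \<le> K * (left_end c i s k n + 1)"
proof -
  obtain K where K: "\<And>\<phi> P Q. run x w \<phi> P Q \<Longrightarrow> Q \<le> K * (P + 1)" using run_linear_bound by blast
  have "right_end c j s k n \<le> (K + 1) * (left_end c i s k n + 1)"
    if "valid c i j s" "W k = c" "n \<ge> 1" for c i j s k n
  proof -
    obtain \<phi> where "run x w \<phi> (left_end c i s k n) (right_end c j s k n)"
      using valid_run_exists[OF \<open>valid c i j s\<close> \<open>W k = c\<close> \<open>n \<ge> 1\<close>] by blast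
    then have "right_end c j s k n \<le> K * (left_end c i s k n + 1)" by (rule K)
    then show ?thesis by simp
  qed
  then show ?thesis using that[of "K + 1"] by simp
qed

text \<open>Only the right end is bounded below directly, by \<open>N n\<close>; the linear bound
  transfers this to the left end.\<close>

lemma left_end_at_top:
  assumes v: "valid c i j s" and k: "W k = c" and q: "q \<ge> 1"
  shows "filterlim (\<lambda>t. real (left_end c i s k (Suc (q * t + r)))) at_top sequentially"
proof -
  obtain K where K: "K \<ge> 1" "\<And>c i j s k n. valid c i j s \<Longrightarrow> W k = c \<Longrightarrow> n \<ge> 1 \<Longrightarrow>
    right_end c j s k n \<le> K * (left_end c i s k n + 1)" by (rule left_end_linear_bound) (rule that, assumption+)
  show ?thesis
  proof (rule filterlim_at_top_mono)
    show "filterlim (\<lambda>t. real t / real K - 1) at_top sequentially"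
      using K(1) by real_asymp
    show "\<forall>\<^sub>F t in sequentially. real t / real K - 1 \<le> real (left_end c i s k (Suc (q * t + r)))"
    proof (intro always_eventually allI)
      fix t
      define n where "n = Suc (q * t + r)"
      have "t \<le> q * t" using q by simp
      then have "t \<le> n" unfolding n_def by linarith
      also have "n \<le> N n" using N_gt[of n] by simp
      also have "N n \<le> right_end c j s k n" using right_end_bounds[OF v k] by (simp add: n_def)
      also have "\<dots> \<le> K * (left_end c i s k n + 1)" using K(2)[OF v k] by (simp add: n_def)
      finally have "real t \<le> real (K * (left_end c i s k n + 1))" by (simp only: of_nat_le_iff)
      then have "real t / real K \<le> real (left_end c i s k n) + 1"
        using K(1) by (simp add: field_simps)
      then show "real t / real K - 1 \<le> real (left_end c i s k (Suc (q * t + r)))" by (simp add: n_def)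
    qed
  qed
qed

lemma end_ratio_limit:
  obtains q where "q \<ge> 1"
    "\<And>c i j s k r. valid c i j s \<Longrightarrow> W k = c \<Longrightarrow> \<exists>l.
       (\<lambda>t. real (right_end c j s k (Suc (q * t + r))) / real (left_end c i s k (Suc (q * t + r)))) \<longlonglongrightarrow> l \<and>
       algebraic l \<and> (uniform_on A g \<longrightarrow> l \<in> \<rat>)"
proof -
  obtain q where q: "q \<ge> 1"
    "\<And>f r. linear_comb f \<Longrightarrow> dominated_fps (Abs_fps (\<lambda>t. real (f (Suc (q * t + r)))))"
    by (rule linear_comb_subsequences) (rule that, assumption+)
  obtain K where K: "K \<ge> 1" "\<And>c i j s k n. valid c i j s \<Longrightarrow> W k = c \<Longrightarrow> n \<ge> 1 \<Longrightarrow>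
    right_end c j s k n \<le> K * (left_end c i s k n + 1)" by (rule left_end_linear_bound) (rule that, assumption+)
  have "\<exists>l. (\<lambda>t. real (right_end c j s k (Suc (q * t + r))) / real (left_end c i s k (Suc (q * t + r)))) \<longlonglongrightarrow> l \<and>
       algebraic l \<and> (uniform_on A g \<longrightarrow> l \<in> \<rat>)"
    if v: "valid c i j s" and k: "W k = c" for c i j s k r
  proof -
    define n where "n t = Suc (q * t + r)" for t
    define F where "F = Abs_fps (\<lambda>t. real (right_end c j s k (n t)))"
    define E where "E = Abs_fps (\<lambda>t. real (left_end c i s k (n t)))"
    have dF: "dominated_fps F" and dE: "dominated_fps E"
      unfolding F_def E_def n_def by (intro q(2) linear_comb_ends[OF v])+
    have top: "filterlim (\<lambda>t. real (left_end c i s k (n t))) at_top sequentially"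
      unfolding n_def by (rule left_end_at_top[OF v k q(1)])
    then have ge1: "eventually (\<lambda>t. real (left_end c i s k (n t)) \<ge> 1) sequentially"
      unfolding filterlim_at_top by blast
    have bound: "eventually (\<lambda>t. real (right_end c j s k (n t)) \<le> 2 * real K * real (left_end c i s k (n t))) sequentially"
      using ge1
    proof eventually_elim
      case (elim t)
      have "right_end c j s k (n t) \<le> K * (left_end c i s k (n t) + 1)"
        using K(2)[OF v k] by (simp add: n_def)
      also have "\<dots> \<le> K * (2 * left_end c i s k (n t))" using elim by (intro mult_le_mono) simp_all
      finally have "real (right_end c j s k (n t)) \<le> real (K * (2 * left_end c i s k (n t)))"
        by (simp only: of_nat_le_iff)
      then show ?case by simp
    qed
    have E0: "\<not> (\<exists>t0. \<forall>t\<ge>t0. E $ t = 0)"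
    proof
      assume "\<exists>t0. \<forall>t\<ge>t0. E $ t = 0"
      then obtain t0 where t0: "\<And>t. t \<ge> t0 \<Longrightarrow> E $ t = 0" by blast
      obtain t1 where t1: "\<And>t. t \<ge> t1 \<Longrightarrow> real (left_end c i s k (n t)) \<ge> 1"
        using ge1 by (auto simp: eventually_sequentially)
      show False using t0[of "max t0 t1"] t1[of "max t0 t1"] by (simp add: E_def)
    qed
    have FE: "eventually (\<lambda>t. F $ t \<le> 2 * real K * E $ t) sequentially"
      using bound by (simp add: F_def E_def)
    obtain l where l: "(\<lambda>t. F $ t / E $ t) \<longlonglongrightarrow> l" "algebraic l"
      and rat: "\<And>m c d. m > 0 \<Longrightarrow> m \<in> \<rat> \<Longrightarrow> c > 0 \<Longrightarrow>
       eventually (\<lambda>t. c * m ^ t \<le> E $ t \<and> E $ t \<le> d * m ^ t) sequentially \<Longrightarrow> l \<in> \<rat>"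
      by (rule dominated_fps_ratio[OF dF dE E0 FE]) (rule that, assumption+)
    have "l \<in> \<rat>" if unif: "uniform_on A g"
    proof -
      obtain m where m: "\<And>c. c \<in> A \<Longrightarrow> length (g c) = m" using unif by blast
      have len: "length (G n u) = m ^ n * length u" if "set u \<subseteq> A" for n u
        by (rule length_hext_pow_uniform[OF A(3) that m])
      have Nm: "N n = m ^ n" for n using len[of "[a]" n] A(2) by (simp add: N_def)
      have m0: "m > 0" using N_gt[of 1] Nm[of 1] by simp
      show ?thesis
      proof (rule rat)
        \<comment> \<open>One step of the subsequence is \<open>q\<close> levels, hence the rate
          \<open>m ^ q\<close>. The lower bound comes from \<open>N n = m ^ n\<close> through the
          linear bound on the right end, the upper one from the end of the image of the letter at
          \<open>k\<close>.\<close>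
        show "real m ^ q > 0" "real m ^ q \<in> \<rat>" "real m ^ Suc r / (2 * real K) > 0"
          using m0 K(1) by simp_all
        show "eventually (\<lambda>t. real m ^ Suc r / (2 * real K) * (real m ^ q) ^ t \<le> E $ t \<and>
            E $ t \<le> real m ^ Suc (Suc r) * real (Suc k) * (real m ^ q) ^ t) sequentially"
          using bound
        proof eventually_elim
          case (elim t)
          have pw: "real m ^ n t = real m ^ Suc r * (real m ^ q) ^ t"
            by (simp add: n_def power_add power_mult)
          have nt: "n t \<ge> 1" by (simp add: n_def)
          have Et: "E $ t = real (left_end c i s k (n t))" by (simp add: E_def)
          have "m ^ n t \<le> right_end c j s k (n t)"
            using right_end_bounds(1)[OF v k nt] by (simp only: Nm)
          then have "real (m ^ n t) \<le> real (right_end c j s k (n t))" by (simp only: of_nat_le_iff)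
          then have "real m ^ n t \<le> 2 * real K * E $ t" using elim unfolding Et of_nat_power by linarith
          then have 1: "real m ^ Suc r / (2 * real K) * (real m ^ q) ^ t \<le> E $ t"
            using K(1) by (simp add: pw field_simps)
          have "left_end c i s k (n t) < right_end c j s k (n t)"
            using valid_run_exists[OF v k nt] by (auto simp: run_def)
          also have "\<dots> < pos (Suc (n t)) (Suc k)"
            by (rule right_end_bounds(2)[OF v k nt])
          also have "\<dots> = m ^ Suc (n t) * Suc k"
            using len[OF set_pre, of "Suc (n t)" "Suc k"] by (simp only: pos_def length_pre)
          finally have "real (left_end c i s k (n t)) < real (m ^ Suc (n t) * Suc k)"
            by (simp only: of_nat_less_iff)
          then have "E $ t \<le> real m * real m ^ n t * real (Suc k)"
            unfolding Et by (simp only: of_nat_mult of_nat_power power_Suc less_imp_le)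
          then have "E $ t \<le> real m ^ Suc (Suc r) * real (Suc k) * (real m ^ q) ^ t"
            by (simp only: pw power_Suc mult_ac)
          then show ?case using 1 by blast
        qed
      qed
    qed
    then show ?thesis using l by (auto simp: F_def E_def n_def)
  qed
  then show ?thesis using that q by blast
qed

section \<open>Run types and the limit superior\<close>

definition run_types :: "(nat \<times> nat \<times> nat \<times> nat) set" where
  "run_types = {(c, i, j, s). valid c i j s \<and> c \<in> range W}"

lemma finite_run_types: "finite run_types"
proof -
  obtain B where B: "\<And>c. c \<in> A \<Longrightarrow> length (g c) \<le> B" using length_bound by blast
  have "i < B" "j < B" if "valid c i j s" for c i j s
    using that B[of c] by (auto simp: valid_def)
  then have "run_types \<subseteq> A \<times> {..<B} \<times> {..<B} \<times> {..<p}"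
    by (auto simp: run_types_def valid_def)
  then show ?thesis by (rule finite_subset) (use A(1) in simp)
qed

definition "occ c = (LEAST k. W k = c)"

lemma W_occ: "c \<in> range W \<Longrightarrow> W (occ c) = c"
  unfolding occ_def by (rule LeastI_ex) auto

lemma occ_le: "W k = c \<Longrightarrow> occ c \<le> k"
  unfolding occ_def by (rule Least_le)

definition type_left :: "nat \<times> nat \<times> nat \<times> nat \<Rightarrow> nat \<Rightarrow> nat" where
  "type_left T n = (case T of (c, i, j, s) \<Rightarrow> left_end c i s (occ c) n)"

definition type_right :: "nat \<times> nat \<times> nat \<times> nat \<Rightarrow> nat \<Rightarrow> nat" where
  "type_right T n = (case T of (c, i, j, s) \<Rightarrow> right_end c j s (occ c) n)"

lemma type_run:
  "T \<in> run_types \<Longrightarrow> n \<ge> 1 \<Longrightarrow> \<exists>\<phi>. run x w \<phi> (type_left T n) (type_right T n)"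
  by (auto simp: run_types_def type_left_def type_right_def intro!: valid_run_exists W_occ)

text \<open>Among the runs of one type and level, the one at the first occurrence of the letter starts
  first; all have the same length, so this one has the largest ratio.\<close>

lemma run_type:
  assumes r: "run x w \<phi> P Q" and n: "n \<ge> 1" and lt: "anc n P < anc n Q" and eq: "anc (Suc n) P = anc (Suc n) Q"
  obtains T where "T \<in> run_types" "type_left T n \<le> P" "Q + type_left T n = P + type_right T n"
proof -
  obtain c i j s k where v: "valid c i j s" and k: "W k = c" and P: "P = left_end c i s k n" and Q: "Q = right_end c j s k n"
    by (rule run_valid[OF r n lt eq]) (rule that, assumption+)
  have c: "c \<in> range W" using k by auto
  have ij: "i < length (g c)" "j < length (g c)" using v by (auto simp: valid_def)
  have child: "pos n (pos 1 k' + l) = pos (Suc n) k' + length (G n (take l (g c)))" if "W k' = c" "l < length (g c)" for k' l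
    using pos_child[of l k' n] that by simp
  have le: "pos (Suc n) (occ c) \<le> pos (Suc n) k" by (intro pos_mono occ_le k)
  show ?thesis
  proof (rule that[of "(c, i, j, s)"])
    show "(c, i, j, s) \<in> run_types" using v c by (simp add: run_types_def)
    show "type_left (c, i, j, s) n \<le> P"
      using le by (simp add: type_left_def P left_end_def child[OF W_occ[OF c] ij(1)] child[OF k ij(1)] del: One_nat_def)
    show "Q + type_left (c, i, j, s) n = P + type_right (c, i, j, s) n"
      by (simp add: type_left_def type_right_def P Q left_end_def right_end_def
          child[OF W_occ[OF c] ij(1)] child[OF k ij(1)] child[OF W_occ[OF c] ij(2)] child[OF k ij(2)] del: One_nat_def)
  qed
qed

text \<open>The block lies strictly between the two mismatches, hence the shifts by one.\<close>

definition type_ratio :: "nat \<times> nat \<times> nat \<times> nat \<Rightarrow> nat \<Rightarrow> real" where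
  "type_ratio T n = (real (type_right T n) - 1) / (real (type_left T n) + 1)"

lemma type_limits:
  obtains q l where "q \<ge> 1"
    "\<And>T r. T \<in> run_types \<Longrightarrow> (\<lambda>t. type_ratio T (Suc (q * t + r))) \<longlonglongrightarrow> l T r"
    "\<And>T r. T \<in> run_types \<Longrightarrow> filterlim (\<lambda>t. real (type_left T (Suc (q * t + r)))) at_top sequentially"
    "\<And>T r. T \<in> run_types \<Longrightarrow> algebraic (l T r)"
    "\<And>T r. T \<in> run_types \<Longrightarrow> uniform_on A g \<Longrightarrow> l T r \<in> \<rat>"
proof -
  obtain q where q: "q \<ge> 1"
    "\<And>c i j s k r. valid c i j s \<Longrightarrow> W k = c \<Longrightarrow> \<exists>l.
       (\<lambda>t. real (right_end c j s k (Suc (q * t + r))) / real (left_end c i s k (Suc (q * t + r)))) \<longlonglongrightarrow> l \<and>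
       algebraic l \<and> (uniform_on A g \<longrightarrow> l \<in> \<rat>)"
    by (rule end_ratio_limit) (rule that, assumption+)
  have top: "filterlim (\<lambda>t. real (type_left T (Suc (q * t + r)))) at_top sequentially" if "T \<in> run_types" for T r
    using that by (auto simp: run_types_def type_left_def intro!: left_end_at_top W_occ q(1))
  have "\<exists>l. (\<lambda>t. type_ratio T (Suc (q * t + r))) \<longlonglongrightarrow> l \<and>
       algebraic l \<and> (uniform_on A g \<longrightarrow> l \<in> \<rat>)" if T: "T \<in> run_types" for T r
  proof -
    obtain c i j s where Teq: "T = (c, i, j, s)" by (cases T) auto
    have "valid c i j s" "W (occ c) = c" using T W_occ by (auto simp: Teq run_types_def)
    from q(2)[OF this, of r] obtain l where
      l: "(\<lambda>t. real (type_right T (Suc (q * t + r))) / real (type_left T (Suc (q * t + r)))) \<longlonglongrightarrow> l"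
      and alg: "algebraic l" "uniform_on A g \<longrightarrow> l \<in> \<rat>"
      by (auto simp: Teq type_left_def type_right_def)
    define L where "L t = real (type_left T (Suc (q * t + r)))" for t
    define R where "R t = real (type_right T (Suc (q * t + r)))" for t
    have L: "filterlim L at_top sequentially" unfolding L_def by (rule top[OF T])
    have inv: "(\<lambda>t. 1 / L t) \<longlonglongrightarrow> 0"
      using tendsto_inverse_0_at_top[OF L] by (simp add: inverse_eq_divide)
    have "(\<lambda>t. (R t / L t - 1 / L t) / (1 + 1 / L t)) \<longlonglongrightarrow> (l - 0) / (1 + 0)"
      using l by (intro tendsto_intros inv) (simp_all add: L_def R_def)
    moreover have "eventually (\<lambda>t. (R t / L t - 1 / L t) / (1 + 1 / L t) = type_ratio T (Suc (q * t + r))) sequentially"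
      using filterlim_at_top_dense[THEN iffD1, OF L, rule_format, of 0]
    proof eventually_elim
      case (elim t)
      then have "(R t / L t - 1 / L t) / (1 + 1 / L t) = (R t - 1) / (L t + 1)"
        by (simp add: field_simps)
      then show ?case by (simp add: type_ratio_def L_def R_def)
    qed
    ultimately have "(\<lambda>t. type_ratio T (Suc (q * t + r))) \<longlonglongrightarrow> (l - 0) / (1 + 0)"
      by (rule Lim_transform_eventually)
    then show ?thesis using alg by auto
  qed
  then obtain l where "\<And>T r. T \<in> run_types \<Longrightarrow> (\<lambda>t. type_ratio T (Suc (q * t + r))) \<longlonglongrightarrow> l T r \<and>
       algebraic (l T r) \<and> (uniform_on A g \<longrightarrow> l T r \<in> \<rat>)"
    by metis
  then show ?thesis using that[of q l] q(1) top by blast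
qed

text \<open>Runs born at level 0 escape the stable range, but they fit into the image of one letter,
  so their length is bounded.\<close>

lemma short_birth_bound:
  assumes "anc 0 P < anc 0 Q" "anc (Suc 0) P = anc (Suc 0) Q" "\<And>c. c \<in> A \<Longrightarrow> length (g c) \<le> B"
  shows "Q \<le> P + B"
proof -
  define k where "k = anc (Suc 0) P"
  have "pos (Suc 0) k \<le> P" unfolding k_def by (rule anc)
  moreover have "Q < pos (Suc 0) (Suc k)" unfolding k_def assms(2) by (rule anc)
  moreover have "pos (Suc 0) (Suc k) = pos (Suc 0) k + length (g (W k))" by (simp add: pos_Suc)
  ultimately show ?thesis using assms(3)[OF W_in_A[of k]] by linarith
qed

text \<open>From above, each late block is either of bounded length or dominated by the run of its
  type at the first occurrence. From below, if the maximum exceeds 1, the runs realizing it grow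
  linearly with their position; they are eventually long enough to be maximal blocks.\<close>

lemma block_limsup:
  fixes I J :: "nat \<Rightarrow> nat"
  assumes I: "strict_mono I" and IJ: "\<And>k. I k \<le> J k"
    and blocks: "\<And>k. I k > 0 \<Longrightarrow> \<exists>\<phi>. run x w \<phi> (I k - 1) (Suc (J k))"
    and runs: "\<And>\<phi> P Q. run x w \<phi> P Q \<Longrightarrow> P + 2 * p < Q \<Longrightarrow> \<exists>k. I k = Suc P \<and> J k = Q - 1"
  shows "\<exists>M. limsup (\<lambda>k. ereal (real (J k) / real (I k))) = ereal M \<and> algebraic M \<and>
    (uniform_on A g \<longrightarrow> M \<in> \<rat>)"
proof -
  obtain q l where q: "q \<ge> 1"
    and lim: "\<And>T r. T \<in> run_types \<Longrightarrow> (\<lambda>t. type_ratio T (Suc (q * t + r))) \<longlonglongrightarrow> l T r"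
    and top: "\<And>T r. T \<in> run_types \<Longrightarrow> filterlim (\<lambda>t. real (type_left T (Suc (q * t + r)))) at_top sequentially"
    and alg: "\<And>T r. T \<in> run_types \<Longrightarrow> algebraic (l T r)"
    and rat: "\<And>T r. T \<in> run_types \<Longrightarrow> uniform_on A g \<Longrightarrow> l T r \<in> \<rat>"
    by (rule type_limits) (rule that, assumption+)
  define X where "X k = real (J k) / real (I k)" for k
  define ls where "ls = (\<lambda>(T, r). l T r) ` (run_types \<times> {..<q})"
  \<comment> \<open>The value 1 stands for blocks of bounded length, whose ratios tend to 1, and
    keeps the maximum defined if there are no run types.\<close>
  define M where "M = Max (insert 1 ls)"
  have fin: "finite ls" using finite_run_types by (simp add: ls_def)
  have Ml: "l T r \<le> M" if "T \<in> run_types" "r < q" for T r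
    unfolding M_def using fin that by (intro Max_ge) (force simp: ls_def)+
  have M1: "1 \<le> M" unfolding M_def using fin by (intro Max_ge) auto
  have "M \<in> insert 1 ls" unfolding M_def using fin by (intro Max_in) auto
  then consider "M = 1" | T r where "T \<in> run_types" "r < q" "M = l T r" "M > 1"
    using M1 unfolding ls_def by force
  note M_cases = this
  have kI: "k \<le> I k" for k using I by (rule seq_suble)
  obtain B where B: "\<And>c. c \<in> A \<Longrightarrow> length (g c) \<le> B" using length_bound by blast
  have upper: "eventually (\<lambda>k. X k \<le> M + e) sequentially" if e: "e > 0" for e
  proof -
    have "eventually (\<lambda>t. type_ratio T (Suc (q * t + r)) \<le> M + e) sequentially" if "T \<in> run_types" "r < q" for T r
    proof -
      have "eventually (\<lambda>t. type_ratio T (Suc (q * t + r)) < M + e) sequentially"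
        using Ml[OF that] e by (intro order_tendstoD(2)[OF lim[OF that(1)]]) simp
      then show ?thesis by eventually_elim simp
    qed
    then have "eventually (\<lambda>t. \<forall>T\<in>run_types. \<forall>r\<in>{..<q}. type_ratio T (Suc (q * t + r)) \<le> M + e) sequentially"
      using finite_run_types by (intro eventually_ball_finite ballI) simp_all
    then obtain t0 where t0: "\<And>t T r. t \<ge> t0 \<Longrightarrow> T \<in> run_types \<Longrightarrow> r < q \<Longrightarrow> type_ratio T (Suc (q * t + r)) \<le> M + e"
      by (auto simp: eventually_sequentially)
    define n0 where "n0 = Suc (q * t0)"
    have large: "type_ratio T n \<le> M + e" if "T \<in> run_types" "n \<ge> n0" for T n
    proof -
      have "n = Suc (q * ((n - 1) div q) + (n - 1) mod q)" using that(2) by (simp add: n0_def)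
      moreover have "t0 \<le> (n - 1) div q"
      proof -
        have "(q * t0) div q \<le> (n - 1) div q" using that(2) by (intro div_le_mono) (simp add: n0_def)
        then show ?thesis using q by simp
      qed
      moreover have "(n - 1) mod q < q" using q by simp
      ultimately show ?thesis using t0[of "(n - 1) div q" T "(n - 1) mod q"] that(1) by simp
    qed
    \<comment> \<open>Bounds the distance of the two ends for runs of level 0 and, up to
      translation, for all types at the finitely many levels below \<open>n0\<close>.\<close>
    define D where "D = B + (\<Sum>T\<in>run_types. \<Sum>n<n0. type_right T n)"
    obtain k0 :: nat where k0: "real k0 > real D / e" using reals_Archimedean2 by blast
    have "X k \<le> M + e" if k: "k \<ge> max 1 k0" for k
    proof -
      have Ipos: "I k > 0" using kI[of k] k by simp
      obtain \<phi> where r: "run x w \<phi> (I k - 1) (Suc (J k))" using blocks[OF Ipos] by blast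
      define P where "P = I k - 1"
      define Q where "Q = Suc (J k)"
      have r: "run x w \<phi> P Q" using r by (simp add: P_def Q_def)
      have PQ: "I k = P + 1" "J k = Q - 1" using Ipos by (simp_all add: P_def Q_def)
      have short: ?thesis if "Q \<le> P + D"
      proof -
        have "real (J k) \<le> real (I k) + real D" using that PQ by linarith
        moreover have "real D \<le> e * real (I k)"
        proof -
          have "real D / e \<le> real (I k)" using k0 kI[of k] k by linarith
          then show ?thesis using e by (simp add: field_simps)
        qed
        ultimately have "real (J k) \<le> (1 + e) * real (I k)" by (simp add: algebra_simps)
        then have "X k \<le> 1 + e" using Ipos by (simp add: X_def field_simps)
        then show ?thesis using M1 by simp
      qed
      obtain n where n: "anc n P < anc n Q" "anc (Suc n) P = anc (Suc n) Q"
        by (rule run_level[OF r]) (rule that, assumption+)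
      show ?thesis
      proof (cases "n = 0")
        case True
        then have "Q \<le> P + B" using short_birth_bound[OF _ _ B, of P Q] n by simp
        then show ?thesis by (intro short) (simp add: D_def)
      next
        case False
        then have n1: "n \<ge> 1" by simp
        obtain T where T: "T \<in> run_types" "type_left T n \<le> P" "Q + type_left T n = P + type_right T n"
          by (rule run_type[OF r n1 n]) (rule that, assumption+)
        show ?thesis
        proof (cases "n < n0")
          case True
          have "type_right T n \<le> (\<Sum>n<n0. type_right T n)" using True by (intro member_le_sum) auto
          also have "\<dots> \<le> (\<Sum>T\<in>run_types. \<Sum>n<n0. type_right T n)"
            using T(1) finite_run_types by (intro member_le_sum[of T run_types "\<lambda>T. \<Sum>n<n0. type_right T n"]) auto
          finally have "type_right T n \<le> D" by (simp add: D_def)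
          then show ?thesis using T(3) by (intro short) linarith
        next
          case False
          define \<delta> where "\<delta> = J k - I k"
          have \<delta>: "J k = I k + \<delta>" using IJ[of k] by (simp add: \<delta>_def)
          have tr: "real (type_right T n) - 1 = (real (type_left T n) + 1) + real \<delta>"
          proof -
            have "type_right T n = type_left T n + 2 + \<delta>" using T(3) PQ(1) \<delta> unfolding Q_def by linarith
            then show ?thesis by simp
          qed
          \<comment> \<open>Both ratios are 1 plus the same \<open>\<delta>\<close> divided by the
            start of the block, and the first occurrence starts no later.\<close>
          have "X k = 1 + real \<delta> / real (I k)" using Ipos by (simp add: X_def \<delta> field_simps)
          also have "\<dots> \<le> 1 + real \<delta> / (real (type_left T n) + 1)"
            using T(2) PQ by (intro add_left_mono divide_left_mono) auto
          also have "\<dots> = type_ratio T n" unfolding type_ratio_def tr by (simp add: field_simps)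
          also have "\<dots> \<le> M + e" using False by (intro large T(1)) simp
          finally show ?thesis .
        qed
      qed
    qed
    then show ?thesis unfolding eventually_sequentially by blast
  qed
  have le: "limsup (\<lambda>k. ereal (X k)) \<le> ereal M"
  proof (rule ereal_le_epsilon2)
    fix e :: real assume "0 < e"
    then have "eventually (\<lambda>k. ereal (X k) \<le> ereal M + ereal e) sequentially"
      using upper[of e] by simp
    then show "limsup (\<lambda>k. ereal (X k)) \<le> ereal M + ereal e" by (rule Limsup_bounded)
  qed
  have ge: "ereal M \<le> limsup (\<lambda>k. ereal (X k))"
    using M_cases
  proof cases
    case 1
    have "1 \<le> X k" if "k \<ge> 1" for k
      using IJ[of k] kI[of k] that by (simp add: X_def)
    then have "eventually (\<lambda>k. ereal M \<le> ereal (X k)) sequentially"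
      using 1 by (auto simp: eventually_sequentially)
    then show ?thesis by (intro le_Limsup) simp_all
  next
    case (2 T r)
    show ?thesis
    proof (rule ccontr)
      assume "\<not> ?thesis"
      then obtain z where z: "limsup (\<lambda>k. ereal (X k)) < z" "z < ereal M" using dense by (meson not_le)
      have ev: "eventually (\<lambda>k. ereal (X k) < z) sequentially" by (rule Limsup_lessD[OF z(1)])
      then obtain k0 where k0: "\<And>k. k \<ge> k0 \<Longrightarrow> ereal (X k) < z" by (auto simp: eventually_sequentially)
      define n where "n t = Suc (q * t + r)" for t
      \<comment> \<open>A margin above 1 that forces the run to grow linearly with its
        position.\<close>
      define \<eta> where "\<eta> = (M - 1) / 2"
      have \<eta>: "\<eta> > 0" "1 + \<eta> < M" using 2(4) by (simp_all add: \<eta>_def field_simps)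
      have lim': "(\<lambda>t. type_ratio T (n t)) \<longlonglongrightarrow> M" unfolding n_def 2(3) by (rule lim[OF 2(1)])
      then have "(\<lambda>t. ereal (type_ratio T (n t))) \<longlonglongrightarrow> ereal M" by simp
      then have e1: "eventually (\<lambda>t. z < ereal (type_ratio T (n t))) sequentially"
        using z(2) by (rule order_tendstoD(1))
      have e2: "eventually (\<lambda>t. 1 + \<eta> < type_ratio T (n t)) sequentially"
        using lim' \<eta>(2) by (rule order_tendstoD(1))
      \<comment> \<open>The first bound makes the run longer than \<open>2 * p\<close>, so that it
        is a maximal block; the second makes its index at least \<open>k0\<close>.\<close>
      have e3: "eventually (\<lambda>t. max (2 * real p / \<eta>) (real (I k0)) \<le> real (type_left T (n t))) sequentially"
        using top[OF 2(1), of r] unfolding filterlim_at_top n_def by blast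
      have "eventually (\<lambda>t. False) sequentially"
        using e1 e2 e3
      proof eventually_elim
        case (elim t)
        define P where "P = type_left T (n t)"
        define Q where "Q = type_right T (n t)"
        have ratio: "type_ratio T (n t) = (real Q - 1) / (real P + 1)" by (simp add: type_ratio_def P_def Q_def)
        obtain \<phi> where run: "run x w \<phi> P Q" using type_run[OF 2(1), of "n t"] by (auto simp: P_def Q_def n_def)
        have "(1 + \<eta>) * (real P + 1) < real Q - 1" using elim(2) unfolding ratio by (simp add: field_simps)
        moreover have "2 * real p \<le> \<eta> * real P" using elim(3) \<eta>(1) by (simp add: P_def field_simps)
        ultimately have "real P + 2 * real p < real Q" using \<eta>(1) by (simp add: algebra_simps)
        then have "P + 2 * p < Q" by linarith
        then obtain k where k: "I k = Suc P" "J k = Q - 1" using runs[OF run] by blast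
        have "I k0 < I k" using elim(3) k by (simp add: P_def)
        then have "k0 \<le> k" using I by (simp add: strict_mono_less)
        then have "ereal (X k) < z" by (rule k0)
        moreover have "X k = type_ratio T (n t)"
        proof -
          have "Q \<ge> 1" using run by (simp add: run_def)
          then show ?thesis by (simp add: X_def k ratio of_nat_diff add.commute)
        qed
        ultimately show False using elim(1) by simp
      qed
      then show False by simp
    qed
  qed
  have "algebraic M" using M_cases
  proof cases
    case 1
    then show ?thesis using algebraic_of_nat[of 1] by simp
  qed (use alg in simp)
  moreover have "M \<in> \<rat>" if "uniform_on A g"
    using M_cases by cases (use rat[OF _ that] in simp_all)
  moreover have "limsup (\<lambda>k. ereal (X k)) = ereal M" using le ge by (rule antisym)
  ultimately show ?thesis unfolding X_def by blast
qed

end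

section \<open>From a given presentation to a stable one\<close>

lemma stable_morphic_wordI:
  assumes W: "pure_morphic_word A h a W" and x: "x \<noteq> []"
    and ap: "\<not> (\<exists>m. \<forall>n. (\<tau> \<circ> W) (m + n) = x ! (n mod length x))"
  obtains g where "stable_morphic_word A g a W \<tau> x"
    "uniform_on A h \<Longrightarrow> uniform_on A g"
proof -
  have A: "finite A" "\<And>c. c \<in> A \<Longrightarrow> set (h c) \<subseteq> A"
    using W by (auto simp: pure_morphic_word_def prolongable_def)
  obtain q where q: "q \<ge> 1"
    "\<And>c k. c \<in> A \<Longrightarrow> k \<ge> 1 \<Longrightarrow> length ((hext h ^^ (q * k)) [c]) mod length x = length ((hext h ^^ q) [c]) mod length x"
    "\<And>c k s. c \<in> A \<Longrightarrow> k \<ge> 1 \<Longrightarrow> reads \<tau> x ((hext h ^^ (q * k)) [c]) s = reads \<tau> x ((hext h ^^ q) [c]) s"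
    by (rule stabilizing_power[OF A x, where \<tau> = \<tau>], assumption, rule that, assumption+)
  define g where "g c = (hext h ^^ q) [c]" for c
  have pw: "hext g ^^ n = hext h ^^ (q * n)" for n
    unfolding g_def[abs_def] by (rule hext_of_pow_pow)
  have "stable_morphic_word A g a W \<tau> x"
  proof
    show "pure_morphic_word A g a W" unfolding g_def[abs_def] by (rule pure_morphic_word_pow[OF W q(1)])
    show "x \<noteq> []" by (rule x)
    show "length ((hext g ^^ n) [c]) mod length x = length (g c) mod length x" if "c \<in> A" "n \<ge> 1" for c n
      using q(2)[OF that] by (simp add: pw g_def)
    show "reads \<tau> x ((hext g ^^ n) [c]) s = reads \<tau> x (g c) s" if "c \<in> A" "n \<ge> 1" for c n s
      using q(3)[OF that] by (simp add: pw g_def)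
    show "\<exists>n\<ge>m. mism x (\<tau> \<circ> W) \<phi> n" for m \<phi>
    proof (rule ccontr)
      assume *: "\<not> ?thesis"
      define p where "p = length x"
      have p: "p > 0" using x by (simp add: p_def)
      \<comment> \<open>A position not before \<open>m\<close> at which the phase is 0, so the
        suffix from there would be exactly the repetition of \<open>x\<close>.\<close>
      define M where "M = (m + \<phi>) * p - \<phi>"
      have "m + \<phi> \<le> (m + \<phi>) * p" using p by (cases p) simp_all
      then have M: "M \<ge> m" "M + \<phi> = (m + \<phi>) * p" unfolding M_def by (linarith+)
      have "(\<tau> \<circ> W) (M + n) = x ! (n mod length x)" for n
      proof -
        have "\<not> mism x (\<tau> \<circ> W) \<phi> (M + n)" using * M(1) by (meson le_add1 le_trans)
        moreover have "(M + n + \<phi>) mod p = n mod p"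
        proof -
          have "M + n + \<phi> = n + (m + \<phi>) * p" using M(2) by simp
          then show ?thesis by (simp only: mod_mult_self1)
        qed
        ultimately show ?thesis by (simp add: mism_def p_def)
      qed
      then show False using ap by blast
    qed
  qed
  moreover have "uniform_on A g" if unif: "uniform_on A h"
  proof -
    obtain m where m: "\<And>c. c \<in> A \<Longrightarrow> length (h c) = m" using unif by blast
    have "length ((hext h ^^ q) [c]) = m ^ q * length [c]" if "c \<in> A" for c
      by (rule length_hext_pow_uniform[of A]) (use A(2) m that in auto)
    then have "length (g c) = m ^ q" if "c \<in> A" for c using that by (simp add: g_def)
    then show ?thesis by blast
  qed
  ultimately show ?thesis using that by blast
qed

text \<open>Stated for one given presentation of \<open>w\<close>, so that it applies to an
  arbitrary morphic presentation as well as to a uniform one.\<close>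

lemma max_block_limsup:
  assumes W: "pure_morphic_word A h a W" and w: "w = \<tau> \<circ> W" and x: "x \<noteq> []"
    and ap: "\<not> (\<exists>m. \<forall>n. w (m + n) = x ! (n mod length x))"
    and ii: "strict_mono ii" and blocks: "range (\<lambda>k. (ii k, jj k)) = max_blocks x w"
  shows "\<exists>M. limsup (\<lambda>k. ereal (real (jj k) / real (ii k))) = ereal M \<and> algebraic M \<and>
    (uniform_on A h \<longrightarrow> M \<in> \<rat>)"
proof -
  obtain g where g: "stable_morphic_word A g a W \<tau> x"
    and unif: "uniform_on A h \<Longrightarrow> uniform_on A g"
    by (rule stable_morphic_wordI[OF W x ap[unfolded w]]) (rule that, assumption+)
  have mb: "max_block x w (ii k) (jj k)" for k
  proof -
    have "(ii k, jj k) \<in> max_blocks x w" unfolding blocks[symmetric] by blast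
    then show ?thesis by (simp add: max_blocks_def)
  qed
  have "\<exists>M. limsup (\<lambda>k. ereal (real (jj k) / real (ii k))) = ereal M \<and> algebraic M \<and>
    (uniform_on A g \<longrightarrow> M \<in> \<rat>)"
  proof (rule stable_morphic_word.block_limsup[OF g ii])
    show "ii k \<le> jj k" for k using mb[of k] by (simp add: max_block_def)
    show "\<exists>\<phi>. run x (\<tau> \<circ> W) \<phi> (ii k - 1) (Suc (jj k))" if "ii k > 0" for k
      using max_block_imp_run[OF x mb that] unfolding w by blast
    show "\<exists>k. ii k = Suc P \<and> jj k = Q - 1" if "run x (\<tau> \<circ> W) \<phi> P Q" "P + 2 * length x < Q" for \<phi> P Q
    proof -
      have "(Suc P, Q - 1) \<in> max_blocks x w"
        using run_imp_max_block[OF x that] by (simp add: max_blocks_def w)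
      then show ?thesis unfolding blocks[symmetric] by auto
    qed
  qed
  then show ?thesis using unif by blast
qed

theorem theorem6:
  fixes b :: nat and w :: "nat \<Rightarrow> nat" and x :: "nat list"
    and ii jj :: "nat \<Rightarrow> nat"
  assumes "b \<ge> 2"
    and "\<forall>n. w n < b"
    and "x \<noteq> []" and "set x \<subseteq> {..<b}"
    and "morphic w"
    and "\<not> (\<exists>m. \<forall>n. w (m + n) = x ! (n mod length x))"
    and "infinite (max_blocks x w)"
    and "strict_mono ii"
    and "range (\<lambda>k. (ii k, jj k)) = max_blocks x w"
  shows "let L = limsup (\<lambda>k. ereal (real (jj k) / real (ii k))) in
           L \<noteq> \<infinity> \<and> L \<noteq> -\<infinity> \<and> algebraic (real_of_ereal L) \<and>
           (automatic w \<longrightarrow> real_of_ereal L \<in> \<rat>)"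
proof -
  obtain A h a W \<tau> where "pure_morphic_word A h a W" "w = \<tau> \<circ> W"
    using \<open>morphic w\<close> unfolding morphic_def by blast
  then obtain M where M: "limsup (\<lambda>k. ereal (real (jj k) / real (ii k))) = ereal M" "algebraic M"
    using max_block_limsup[OF _ _ assms(3,6,8,9)] by blast
  have "M \<in> \<rat>" if auto: "automatic w"
  proof -
    \<comment> \<open>The uniform presentation may differ from the one used above, but the limit
      superior depends only on the blocks of \<open>w\<close>, so both values agree.\<close>
    obtain A h a W \<tau> m where "pure_morphic_word A h a W" "w = \<tau> \<circ> W" "\<forall>c\<in>A. length (h c) = m"
      using auto unfolding automatic_def by blast
    then obtain M' where "limsup (\<lambda>k. ereal (real (jj k) / real (ii k))) = ereal M'" "M' \<in> \<rat>"
      using max_block_limsup[OF _ _ assms(3,6,8,9)] by blast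
    then show ?thesis using M by simp
  qed
  then show ?thesis using M by (simp add: Let_def)
qed

end
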